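(* Let $\mu\ge 0$ and let $\omega\in\mathbb{R}\setminus\mathbb{Q}$ be $\mu$-well approximable. Let $h_0(x,x')=\frac12(x-x')^2$. Then for every real $r$ with $0\le r<3+\mu$ and every $\epsilon>0$ there exists a real trigonometric polynomial $R_N(x)$ (of period $1$, of some degree $N$) with $\|R_N\|_{C^r}<\epsilon$ such that the exact area-preserving twist map generated by $h(x,x')=h_0(x,x')+R_N(x')$ admits no invariant circle with frequency $\omega$.
   Context: An irrational $\omega$ is called $\mu$-well approximable if there are infinitely many $q_n\in\mathbb{N}$ and integers $p_n$ with $|q_n\omega-p_n|<q_n^{-1-\mu}$. A function $h:\mathbb{R}^2\to\mathbb{R}$ with $h(x+1,x'+1)=h(x,x')$ and suitable twist condition generates the map $F(x,y)=(x',y')$ of $\mathbb{R}^2$ defined implicitly by $y=-\partial_1h(x,x')$, $y'=\partial_2 h(x,x')$; it commutes with $(x,y)\mapsto(x+1,y)$ and induces an exact area-preserving twist map $f$ of the cylinder $\mathbb{T}\times\mathbb{R}$, $\mathbb{T}=\mathbb{R}/\mathbb{Z}$. An invariant circle is an $f$-invariant simple closed curve in the cylinder that is not homotopic to a point; it has frequency $\omega$ if the restriction of $f$ to it (a circle homeomorphism) has rotation number $\omega$ (with respect to the lift $F$). For $u\in C^r(\mathbb{T})$, $\|u\|_{C^r}=\max_{0\le j\le r}\max_{x\in\mathbb{T}}|u^{(j)}(x)|$, the maximum over integer orders $j\le r$. *)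

theory Defs
  imports "HOL-Analysis.Analysis"
begin

definition well_approximable :: "real \<Rightarrow> real \<Rightarrow> bool" where
  "well_approximable \<mu> \<omega> \<longleftrightarrow>
     infinite {q::nat. q > 0 \<and> (\<exists>p::int. \<bar>real q * \<omega> - real_of_int p\<bar> < real q powr (-1 - \<mu>))}"

definition trig_poly :: "nat \<Rightarrow> (real \<Rightarrow> real) \<Rightarrow> bool" where
  "trig_poly N R \<longleftrightarrow> (\<exists>a b :: nat \<Rightarrow> real.
     R = (\<lambda>x. a 0 + (\<Sum>k=1..N. a k * cos (2 * pi * real k * x) + b k * sin (2 * pi * real k * x))))"

definition cr_norm :: "real \<Rightarrow> (real \<Rightarrow> real) \<Rightarrow> real" where
  "cr_norm r u = (SUP j\<in>{0..nat \<lfloor>r\<rfloor>}. SUP x\<in>UNIV. \<bar>(deriv ^^ j) u x\<bar>)"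

definition partial1 :: "(real \<Rightarrow> real \<Rightarrow> real) \<Rightarrow> real \<Rightarrow> real \<Rightarrow> real" where
  "partial1 h x x' = deriv (\<lambda>t. h t x') x"

definition partial2 :: "(real \<Rightarrow> real \<Rightarrow> real) \<Rightarrow> real \<Rightarrow> real \<Rightarrow> real" where
  "partial2 h x x' = deriv (\<lambda>t. h x t) x'"

definition gen_map :: "(real \<Rightarrow> real \<Rightarrow> real) \<Rightarrow> real \<times> real \<Rightarrow> real \<times> real" where
  "gen_map h = (\<lambda>(x, y). THE (x', y'). y = - partial1 h x x' \<and> y' = partial2 h x x')"

text \<open>F (the lift) has an invariant circle of frequency omega: there is an essential
  simple closed curve in the cylinder, given by its lift gamma (continuous, injective,
  gamma(t+1) = gamma(t) + (1,0)), whose full preimage range gamma is F-invariant, and the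
  induced circle map (lift g = gamma^-1 o F o gamma) has rotation number omega.\<close>
definition has_invariant_circle_freq :: "(real \<times> real \<Rightarrow> real \<times> real) \<Rightarrow> real \<Rightarrow> bool" where
  "has_invariant_circle_freq F \<omega> \<longleftrightarrow>
     (\<exists>\<gamma> :: real \<Rightarrow> real \<times> real.
        continuous_on UNIV \<gamma> \<and> inj \<gamma> \<and> (\<forall>t. \<gamma> (t + 1) = \<gamma> t + (1, 0)) \<and>
        F ` range \<gamma> = range \<gamma> \<and>
        (\<forall>t. ((\<lambda>n. (((\<lambda>s. inv \<gamma> (F (\<gamma> s))) ^^ n) t - t) / real n) \<longlongrightarrow> \<omega>) sequentially))"

end

theory Submission
  imports Defs "HOL-Real_Asymp.Real_Asymp"
begin

text \<open>Writing \<open>\<alpha> = q\<omega> - p\<close> and \<open>R(x) = q\<^sup>-\<^sup>2 P(qx)\<close>, orbits of the map for \<open>R\<close> correspond, by \<open>X = qx - np\<close>,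
  to solutions of \<open>X\<^sub>n\<^sub>+\<^sub>1 - 2X\<^sub>n + X\<^sub>n\<^sub>-\<^sub>1 = P'(X\<^sub>n)\<close>.
  Here \<open>P\<close> is a pendulum potential of size \<open>s\<^sup>2 \<approx> q\<^sup>-\<^sup>\<lambda>\<close>, \<open>\<lambda> = max {\<lfloor>r\<rfloor>, 2} - 2 < 1 + \<mu>\<close>, plus a much smaller bump.

  No orbit can be slower than an invariant circle for a long time and faster than it later: the vector
  from a point of the circle to a point off it only turns clockwise past the vertical, so an orbit above
  the circle is never overtaken by it and an orbit below never overtakes it.

  On the other hand, minimizers of the action which stay near 0 for a long time and then jump from each
  integer to the next in \<open>T \<approx> q\<^sup>1\<^sup>+\<^sup>\<mu>\<close> steps (with \<open>T\<bar>\<alpha>\<bar> \<le> 1/2\<close>) exist as constrained minimizers. The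
  constraint is inactive because the bump sits where the cost of a jump through a given point is
  almost maximal, so that touching the wall there is too expensive. If \<open>\<alpha> < 0\<close> these orbits are reversed
  in time. The errors are of order
  \<open>(1 + s\<^sup>2)\<^sup>-\<^sup>T\<^sup>/\<^sup>4\<close>, since consecutive jumps are separated by \<open>T \<gg> s\<^sup>-\<^sup>2\<close> steps.\<close>

section \<open>Lifted angles of planar curves\<close>

text \<open>The circle is an arbitrary essential curve, not known to be a graph, so "above" and
  "below" are read off from the turning of the vector from a point of the curve to the orbit point.
  The condition r < 3 + \<mu> comes from two demands on s. After scaling, derivative j of the
  pendulum term has size s^2 q^(j-2); smallness up to j = \<lambda> + 2 forces s^2 = const
  q^(-\<lambda>). A minimizer settles at an integer at rate 1/(1+s^2) per step and has only T steps
  between jumps, so s^2 T must tend to infinity, that is \<lambda> < 1 + \<mu>. The errors then beat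
  every power of q, hence a bump of polynomially small height \<open>\<eta>\<close> dominates them,
  although it must have degree about q^(\<lambda>+2) to be narrow at scale s. The obstacle is the
  wall at d between neighbouring boxes: a minimizer stuck to it need not be an orbit, and the
  pendulum alone gives no margin against this. With the bump, passing through d costs nearly
  \<open>\<eta>\<close>/2 more than leaping over it, and a cheap leap exists because good paths can
  be chosen with a gap of width s/50 before their end point.\<close>

lemma ivt_any_order:
  fixes f :: "real \<Rightarrow> real"
  assumes "continuous_on UNIV f" "f u \<le> c" "c \<le> f v"
  shows "\<exists>s. f s = c \<and> min u v \<le> s \<and> s \<le> max u v"
proof (cases "u \<le> v")
  case True
  then show ?thesis
    using IVT'[of f u c v] assms continuous_on_subset[OF assms(1)] by (auto simp: min_def max_def)
next
  case False
  then show ?thesis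
    using IVT2'[of f u c v] assms continuous_on_subset[OF assms(1)] by (auto simp: min_def max_def)
qed

lemma cos_nonpos:
  fixes x :: real
  assumes "pi/2 \<le> x" "x \<le> 3*pi/2"
  shows "cos x \<le> 0"
proof -
  have "0 \<le> sin (x - pi/2)" using assms by (intro sin_ge_zero) auto
  then show ?thesis by (simp add: sin_diff)
qed

text \<open>The last clause normalizes the continuous polar angle: for very negative
  \<open>t\<close> the vector points to the right. This fixes the multiple of 2 pi, so that angles
  of different curves can be compared.\<close>

definition lifts_arg :: "(real \<Rightarrow> real) \<Rightarrow> (real \<Rightarrow> real) \<Rightarrow> (real \<Rightarrow> real) \<Rightarrow> bool" where
  "lifts_arg a b \<theta> \<longleftrightarrow> continuous_on UNIV \<theta> \<and>
     (\<forall>t. \<exists>r>0. a t = r * cos (\<theta> t) \<and> b t = r * sin (\<theta> t)) \<and>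
     (\<exists>t0. \<forall>t\<le>t0. \<bar>\<theta> t\<bar> < pi/2)"

lemma lifts_arg_cont: "lifts_arg a b \<theta> \<Longrightarrow> continuous_on UNIV \<theta>"
  and lifts_arg_polar: "lifts_arg a b \<theta> \<Longrightarrow> \<exists>r>0. a t = r * cos (\<theta> t) \<and> b t = r * sin (\<theta> t)"
  by (auto simp: lifts_arg_def)

text \<open>Leaving (-pi/2, pi/2) would make the cosine, hence \<open>a\<close>, vanish at some
  earlier parameter; this is why positivity is asked on the whole half-line.\<close>

lemma lifts_arg_near_zero:
  assumes l: "lifts_arg a b \<theta>" and pos: "\<And>s. s \<le> t \<Longrightarrow> a s > 0"
  shows "\<bar>\<theta> t\<bar> < pi/2"
proof (rule ccontr)
  assume "\<not> ?thesis"
  then have big: "pi/2 \<le> \<bar>\<theta> t\<bar>" by simp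
  obtain t0 where t0: "\<forall>s\<le>t0. \<bar>\<theta> s\<bar> < pi/2" using l by (auto simp: lifts_arg_def)
  have "\<bar>\<theta> (min t0 t)\<bar> \<le> pi/2" using t0 by (simp add: less_imp_le)
  moreover have "continuous_on UNIV (\<lambda>s. \<bar>\<theta> s\<bar>)"
    using lifts_arg_cont[OF l] by (intro continuous_intros)
  ultimately obtain s where s: "\<bar>\<theta> s\<bar> = pi/2" "s \<le> max (min t0 t) t"
    using ivt_any_order[of "\<lambda>s. \<bar>\<theta> s\<bar>" "min t0 t" "pi/2" t] big by auto
  have "cos (\<theta> s) = cos \<bar>\<theta> s\<bar>" by simp
  then have "cos (\<theta> s) = 0" using s(1) by simp
  then have "a s = 0" using lifts_arg_polar[OF l, of s] by auto
  then show False using pos[of s] s(2) by auto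
qed

lemma lifts_arg_exists:
  assumes ca: "continuous_on UNIV a" and cb: "continuous_on UNIV b"
    and nz: "\<And>t. a t \<noteq> 0 \<or> b t \<noteq> 0" and pos: "\<And>t. t \<le> t0 \<Longrightarrow> a t > 0"
  shows "\<exists>\<theta>. lifts_arg a b \<theta>"
proof -
  have "continuous_on UNIV (\<lambda>t. Complex (a t) (b t))"
    using ca cb by (intro continuous_on_Complex)
  moreover have "contractible (UNIV :: real set)" by (simp add: convex_imp_contractible)
  moreover have "\<And>t. t \<in> UNIV \<Longrightarrow> Complex (a t) (b t) \<noteq> 0"
    using nz by (metis complex.sel zero_complex.simps)
  ultimately obtain g where cg: "continuous_on UNIV g" and g: "\<And>t. Complex (a t) (b t) = exp (g t)"
    using continuous_logarithm_on_contractible[of UNIV "\<lambda>t. Complex (a t) (b t)"] by auto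
  \<comment> \<open>This \<open>k\<close> moves the angle at \<open>t0\<close> into [-pi, pi); since
    \<open>a t0 > 0\<close>, it then lies in (-pi/2, pi/2).\<close>
  define k where "k = \<lfloor>(Im (g t0) + pi) / (2*pi)\<rfloor>"
  define \<theta> where "\<theta> t = Im (g t) - 2*pi*k" for t
  have per: "cos (\<theta> t) = cos (Im (g t))" "sin (\<theta> t) = sin (Im (g t))" for t
  proof -
    have e: "\<theta> t = Im (g t) + 2 * pi * of_int (-k)" by (simp add: \<theta>_def)
    show "cos (\<theta> t) = cos (Im (g t))" "sin (\<theta> t) = sin (Im (g t))"
      unfolding e by (simp_all only: cos_add sin_add cos_int_2pin sin_int_2pin)
  qed
  have polar: "\<exists>r>0. a t = r * cos (\<theta> t) \<and> b t = r * sin (\<theta> t)" for t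
  proof -
    have "a t = Re (exp (g t))" "b t = Im (exp (g t))" using g[of t] by (metis complex.sel)+
    then show ?thesis
      unfolding per by (intro exI[of _ "exp (Re (g t))"]) (simp add: Re_exp Im_exp)
  qed
  have c\<theta>: "continuous_on UNIV \<theta>" unfolding \<theta>_def using cg by (intro continuous_intros)
  have kk: "k \<le> (Im (g t0) + pi) / (2*pi)" "(Im (g t0) + pi) / (2*pi) < k + 1"
    unfolding k_def by linarith+
  have r0: "- pi \<le> \<theta> t0" "\<theta> t0 < pi"
    using kk pi_gt_zero unfolding \<theta>_def by (simp_all add: field_simps)
  have cosne: "cos (\<theta> t) > 0" if "t \<le> t0" for t
    using polar[of t] pos[OF that] by (metis zero_less_mult_pos)
  have s0: "\<bar>\<theta> t0\<bar> < pi/2"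
  proof (rule ccontr)
    assume "\<not> ?thesis"
    then have "cos \<bar>\<theta> t0\<bar> \<le> 0" using r0 by (intro cos_nonpos) auto
    then show False using cosne[of t0] by simp
  qed
  have "\<bar>\<theta> t\<bar> < pi/2" if "t \<le> t0" for t
  proof (rule ccontr)
    assume "\<not> ?thesis"
    moreover have "continuous_on UNIV (\<lambda>s. \<bar>\<theta> s\<bar>)" using c\<theta> by (intro continuous_intros)
    ultimately obtain s where s: "\<bar>\<theta> s\<bar> = pi/2" "s \<le> max t0 t"
      using ivt_any_order[of "\<lambda>s. \<bar>\<theta> s\<bar>" t0 "pi/2" t] s0 by auto
    have "cos (\<theta> s) = cos \<bar>\<theta> s\<bar>" by simp
    then show False using cosne[of s] s that by simp
  qed
  then show ?thesis using c\<theta> polar unfolding lifts_arg_def by blast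
qed

text \<open>Two direction fields which are never opposite have lifted angles differing by less than
  half a turn, because the difference would have to pass through an odd multiple of \<open>\<pi>\<close>.\<close>

lemma lifts_arg_diff:
  assumes l: "lifts_arg a b \<theta>" and l': "lifts_arg a' b' \<theta>'"
    and nonopp: "\<And>t c. c > 0 \<Longrightarrow> \<not> (a' t = - c * a t \<and> b' t = - c * b t)"
  shows "\<bar>\<theta>' t - \<theta> t\<bar> < pi"
proof (rule ccontr)
  assume "\<not> ?thesis"
  then have big: "pi \<le> \<bar>\<theta>' t - \<theta> t\<bar>" by simp
  obtain t0 t1 where t0: "\<forall>s\<le>t0. \<bar>\<theta> s\<bar> < pi/2" and t1: "\<forall>s\<le>t1. \<bar>\<theta>' s\<bar> < pi/2"
    using l l' by (auto simp: lifts_arg_def)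
  have "\<bar>\<theta> (min t0 t1)\<bar> < pi/2" "\<bar>\<theta>' (min t0 t1)\<bar> < pi/2" using t0 t1 by simp_all
  then have small: "\<bar>\<theta>' (min t0 t1) - \<theta> (min t0 t1)\<bar> \<le> pi" by linarith
  have "continuous_on UNIV (\<lambda>s. \<bar>\<theta>' s - \<theta> s\<bar>)"
    using lifts_arg_cont[OF l] lifts_arg_cont[OF l'] by (intro continuous_intros)
  then obtain s where s: "\<bar>\<theta>' s - \<theta> s\<bar> = pi"
    using ivt_any_order[of "\<lambda>s. \<bar>\<theta>' s - \<theta> s\<bar>" "min t0 t1" pi t] big small by auto
  then consider "\<theta>' s = \<theta> s + pi" | "\<theta> s = \<theta>' s + pi" by linarith
  then have "cos (\<theta>' s) = - cos (\<theta> s)" "sin (\<theta>' s) = - sin (\<theta> s)" by (cases; simp)+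
  moreover obtain r r' where "r > 0" "a s = r * cos (\<theta> s)" "b s = r * sin (\<theta> s)"
    "r' > 0" "a' s = r' * cos (\<theta>' s)" "b' s = r' * sin (\<theta>' s)"
    using lifts_arg_polar[OF l, of s] lifts_arg_polar[OF l', of s] by auto
  ultimately have "r'/r > 0" "a' s = - (r'/r) * a s" "b' s = - (r'/r) * b s" by simp_all
  then show False using nonopp by blast
qed

text \<open>If \<open>\<theta>'\<close> reached pi/2, then \<open>\<theta>\<close> would lie in the
  right half-plane and \<open>\<theta>'\<close> in the left one, within half a turn. The clockwise
  hypothesis puts both in the lower half-plane, so \<open>\<theta>\<close> < 0 and
  \<open>\<theta>'\<close> > pi, which are more than pi apart.\<close>

lemma angle_below_right:
  fixes \<theta> \<theta>' :: real
  assumes "\<theta> < pi/2" "\<bar>\<theta>' - \<theta>\<bar> < pi"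
    and clockwise: "cos \<theta> > 0 \<Longrightarrow> cos \<theta>' \<le> 0 \<Longrightarrow> sin \<theta> < 0 \<and> sin \<theta>' < 0"
  shows "\<theta>' < pi/2"
proof (rule ccontr)
  assume "\<not> ?thesis"
  then have ge: "\<theta>' \<ge> pi/2" by simp
  then have "\<theta> > - (pi/2)" using assms(2) by linarith
  then have "cos \<theta> > 0" using assms(1) cos_gt_zero_pi by auto
  moreover have "cos \<theta>' \<le> 0" using ge assms by (intro cos_nonpos) linarith+
  ultimately have sn: "sin \<theta> < 0" "sin \<theta>' < 0" using clockwise by auto
  have "\<theta> < 0"
  proof (rule ccontr)
    assume "\<not> \<theta> < 0"
    then have "sin \<theta> \<ge> 0" using assms(1) pi_gt_zero by (intro sin_ge_zero) linarith+
    then show False using sn by simp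
  qed
  moreover have "\<theta>' > pi"
  proof (rule ccontr)
    assume "\<not> \<theta>' > pi"
    then have "sin \<theta>' \<ge> 0" using ge pi_gt_zero by (intro sin_ge_zero) linarith+
    then show False using sn by simp
  qed
  ultimately show False using assms(2) by linarith
qed

text \<open>The vertical can only be crossed clockwise, so the bounds pi/2 and -pi/2 persist from
  above; the second is the first for the opposite vectors, with angles shifted by pi. For the third,
  a far parameter keeps its angle above -pi/2 because the change is less than pi, and
  \<open>a' < 0\<close> carries this along the whole ray by continuity.\<close>

lemma lifts_arg_step:
  assumes l: "lifts_arg a b \<theta>" and l': "lifts_arg a' b' \<theta>'"
    and nonopp: "\<And>t c. c > 0 \<Longrightarrow> \<not> (a' t = - c * a t \<and> b' t = - c * b t)"
    and cw: "\<And>t. a t > 0 \<Longrightarrow> a' t \<le> 0 \<Longrightarrow> b t < 0 \<and> b' t < 0"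
    and cw': "\<And>t. a t < 0 \<Longrightarrow> a' t \<ge> 0 \<Longrightarrow> b t > 0 \<and> b' t > 0"
  shows "\<theta> t < pi/2 \<Longrightarrow> \<theta>' t < pi/2"
    and "\<theta> t < - (pi/2) \<Longrightarrow> \<theta>' t < - (pi/2)"
    and "(\<And>t. t \<ge> t1 \<Longrightarrow> \<theta> t > pi/2) \<Longrightarrow> (\<And>t. t \<ge> t2 \<Longrightarrow> a' t < 0) \<Longrightarrow> (\<And>t. t \<ge> t2 \<Longrightarrow> \<theta>' t > pi/2)"
proof -
  have d: "\<bar>\<theta>' s - \<theta> s\<bar> < pi" for s by (rule lifts_arg_diff[OF l l' nonopp])
  have c1: "cos (\<theta> s) > 0 \<Longrightarrow> cos (\<theta>' s) \<le> 0 \<Longrightarrow> sin (\<theta> s) < 0 \<and> sin (\<theta>' s) < 0" for s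
    using lifts_arg_polar[OF l, of s] lifts_arg_polar[OF l', of s] cw[of s]
    by (auto simp: mult_less_0_iff mult_le_0_iff)
  have c2: "- cos (\<theta> s) > 0 \<Longrightarrow> - cos (\<theta>' s) \<le> 0 \<Longrightarrow> - sin (\<theta> s) < 0 \<and> - sin (\<theta>' s) < 0" for s
    using lifts_arg_polar[OF l, of s] lifts_arg_polar[OF l', of s] cw'[of s]
    by (auto simp: mult_less_0_iff zero_le_mult_iff zero_less_mult_iff)
  show "\<theta> t < pi/2 \<Longrightarrow> \<theta>' t < pi/2"
    by (rule angle_below_right[of "\<theta> t" "\<theta>' t"]) (use d c1 in auto)
  have "\<theta> t + pi < pi/2 \<Longrightarrow> \<theta>' t + pi < pi/2"
    by (rule angle_below_right[of "\<theta> t + pi" "\<theta>' t + pi"]) (use d c2 in \<open>auto simp: cos_add sin_add\<close>)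
  then show "\<theta> t < - (pi/2) \<Longrightarrow> \<theta>' t < - (pi/2)" by simp
  show "\<theta>' t > pi/2"
    if P: "\<And>t. t \<ge> t1 \<Longrightarrow> \<theta> t > pi/2" and N: "\<And>t. t \<ge> t2 \<Longrightarrow> a' t < 0" and t: "t \<ge> t2" for t
  proof (rule ccontr)
    assume "\<not> ?thesis"
    then have lo: "\<theta>' t \<le> pi/2" by simp
    define u where "u = max t1 t2"
    have "\<theta> u > pi/2" using P by (simp add: u_def)
    then have hi: "\<theta>' u > - (pi/2)" using d[of u] by (simp add: abs_if split: if_splits)
    have cneg: "cos (\<theta>' s) < 0" if "s \<ge> t2" for s
      using lifts_arg_polar[OF l', of s] N[OF that] by (auto simp: mult_less_0_iff)
    have nin: "\<theta>' s < - (pi/2) \<or> \<theta>' s > pi/2" if "s \<ge> t2" for s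
      using cneg[OF that] cos_ge_zero[of "\<theta>' s"] by fastforce
    have "\<theta>' t < - (pi/2)" using nin[OF t] lo by auto
    moreover have "\<theta>' u > pi/2" using nin[of u] hi by (auto simp: u_def)
    ultimately obtain s where "\<theta>' s = 0" "min t u \<le> s"
      using ivt_any_order[OF lifts_arg_cont[OF l'], of t 0 u] pi_gt_zero by auto
    moreover have "min t u \<ge> t2" using t by (auto simp: u_def)
    ultimately show False using cneg[of s] by fastforce
  qed
qed

text \<open>On the ray the vector stays in the left half-plane, so the angle cannot pass through 0.
  Angles above pi/2 mean that the vector has turned over the top, i.e. the point is above the curve;
  angles below -pi/2 mean that it is below.\<close>

lemma lifts_arg_dichotomy:
  assumes l: "lifts_arg a b \<theta>" and N: "\<And>t. t \<ge> t2 \<Longrightarrow> a t < 0"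
  shows "(\<forall>t\<ge>t2. \<theta> t > pi/2) \<or> (\<forall>t\<ge>t2. \<theta> t < - (pi/2))"
proof (rule ccontr)
  assume "\<not> ?thesis"
  then obtain u v where uv: "u \<ge> t2" "\<theta> u \<le> pi/2" "v \<ge> t2" "\<theta> v \<ge> - (pi/2)" by (meson leI)
  have cneg: "cos (\<theta> s) < 0" if "s \<ge> t2" for s
    using lifts_arg_polar[OF l, of s] N[OF that] by (auto simp: mult_less_0_iff)
  have nin: "\<theta> s < - (pi/2) \<or> \<theta> s > pi/2" if "s \<ge> t2" for s
    using cneg[OF that] cos_ge_zero[of "\<theta> s"] by fastforce
  have "\<theta> u \<le> 0" "0 \<le> \<theta> v" using nin[of u] nin[of v] uv pi_gt_zero by linarith+
  then obtain s where "\<theta> s = 0" "min u v \<le> s"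
    using ivt_any_order[OF lifts_arg_cont[OF l]] by blast
  moreover then have "s \<ge> t2" using uv by linarith
  ultimately show False using cneg[of s] by simp
qed

section \<open>Orbits in the presence of an invariant circle\<close>

text \<open>The map is the shear (x, y) to (x + y, y) followed by a vertical kick; the two halves
  act differently on angles and are treated separately in \<open>comparison\<close>.\<close>

locale invariant_circle =
  fixes \<phi> :: "real \<Rightarrow> real" and F :: "real \<times> real \<Rightarrow> real \<times> real"
    and \<gamma> :: "real \<Rightarrow> real \<times> real" and \<omega> :: real
  assumes cont_\<phi>: "continuous_on UNIV \<phi>" and per_\<phi>: "\<And>x. \<phi> (x + 1) = \<phi> x"
    and F_eq: "\<And>x y. F (x, y) = (x + y, y + \<phi> (x + y))"
    and cont_\<gamma>: "continuous_on UNIV \<gamma>" and inj_\<gamma>: "inj \<gamma>"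
    and per_\<gamma>: "\<And>t. \<gamma> (t + 1) = \<gamma> t + (1, 0)"
    and inv_\<gamma>: "F ` range \<gamma> = range \<gamma>"
    and freq: "\<And>t. ((\<lambda>n. (((\<lambda>s. inv \<gamma> (F (\<gamma> s))) ^^ n) t - t) / real n) \<longlongrightarrow> \<omega>) sequentially"
begin

section \<open>The induced map of the parameter line and its rotation number\<close>

definition g where "g s = inv \<gamma> (F (\<gamma> s))"
definition X where "X t = fst (\<gamma> t)"

lemma F_fst: "fst (F p) = fst p + snd p" and F_snd: "snd (F p) = snd p + \<phi> (fst (F p))"
  by (cases p; simp add: F_eq)+

lemma cont_F: "continuous_on UNIV F"
proof -
  have "F = (\<lambda>p. (fst p + snd p, snd p + \<phi> (fst p + snd p)))" by (auto simp: F_eq fun_eq_iff)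
  moreover have "continuous_on UNIV (\<lambda>p :: real \<times> real. \<phi> (fst p + snd p))"
    by (rule continuous_on_compose2[OF cont_\<phi>]) (auto intro!: continuous_intros)
  ultimately show ?thesis by (auto intro!: continuous_intros)
qed

lemma inj_F: "inj F"
proof (rule injI)
  fix p q assume e: "F p = F q"
  then have "snd p = snd q" using F_snd[of p] F_snd[of q] by simp
  moreover then have "fst p = fst q" using F_fst[of p] F_fst[of q] e by simp
  ultimately show "p = q" by (simp add: prod_eq_iff)
qed

lemma F_shift: "F (p + (1, 0)) = F p + (1, 0)"
  using per_\<phi>[of "fst p + snd p"] by (cases p) (simp add: F_eq add.commute add.left_commute)

lemma \<gamma>_g: "\<gamma> (g s) = F (\<gamma> s)"
proof -
  have "F (\<gamma> s) \<in> range \<gamma>" using inv_\<gamma> by blast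
  then show ?thesis unfolding g_def by (rule f_inv_into_f)
qed

lemma \<gamma>_inj: "\<gamma> s = \<gamma> t \<Longrightarrow> s = t"
  using inj_\<gamma> by (auto dest: injD)

lemma g_shift: "g (t + 1) = g t + 1"
  by (rule \<gamma>_inj) (simp add: \<gamma>_g per_\<gamma> F_shift)

lemma \<gamma>_gn: "\<gamma> ((g ^^ n) t) = (F ^^ n) (\<gamma> t)"
  by (induction n) (simp_all add: \<gamma>_g)

lemma inj_g: "inj g"
  by (rule injI) (metis \<gamma>_g \<gamma>_inj inj_F injD)

lemma cont_X: "continuous_on UNIV X"
  unfolding X_def using cont_\<gamma> by (intro continuous_intros)

lemma X_shift: "X (t + 1) = X t + 1"
  by (simp add: X_def per_\<gamma>)

lemma X_shift_int: "X (t + of_int k) = X t + of_int k"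
proof -
  have n: "X (t + real n) = X t + real n" for n t
    by (induction n) (simp_all add: X_shift add.assoc[symmetric] add.commute[of 1])
  show ?thesis
  proof (cases "k \<ge> 0")
    case True
    then show ?thesis using n[of t "nat k"] by simp
  next
    case False
    then show ?thesis using n[of "t + of_int k" "nat (-k)"] by simp
  qed
qed

lemma X_bound: "\<exists>C\<ge>0. \<forall>t. \<bar>X t - t\<bar> \<le> C"
proof -
  have "compact ((\<lambda>t. X t - t) ` {0..1})"
    by (intro compact_continuous_image continuous_intros continuous_on_subset[OF cont_X]) auto
  then obtain C where C: "\<And>t. 0 \<le> t \<Longrightarrow> t \<le> 1 \<Longrightarrow> \<bar>X t - t\<bar> \<le> C"
    using bounded_real compact_imp_bounded by (metis (no_types, lifting) atLeastAtMost_iff imageI)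
  have "\<bar>X t - t\<bar> \<le> C" for t
  proof -
    have "X t = X (frac t) + of_int \<lfloor>t\<rfloor>" using X_shift_int[of "frac t" "\<lfloor>t\<rfloor>"] by (simp add: frac_def)
    then show ?thesis using C[of "frac t"] frac_lt_1[of t] by (simp add: frac_def)
  qed
  moreover have "C \<ge> 0" using C[of 0] by simp
  ultimately show ?thesis by blast
qed

text \<open>Near \<open>s\<close> the values of \<open>g\<close> stay in a bounded interval because
  \<open>X\<close> is close to the identity; on a compact interval the injective curve
  \<open>\<gamma>\<close> is a homeomorphism onto its image, so \<open>inv \<gamma>\<close> is
  continuous there.\<close>

lemma cont_g: "continuous_on UNIV g"
proof -
  obtain C where C: "\<And>t. \<bar>X t - t\<bar> \<le> C" using X_bound by blast
  have "continuous (at s) g" for s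
  proof -
    have cFg: "continuous_on UNIV (\<lambda>s. F (\<gamma> s))"
      using continuous_on_compose2[OF cont_F cont_\<gamma>] by simp
    then have "compact ((\<lambda>s. fst (F (\<gamma> s))) ` {s-1..s+1})"
      by (intro compact_continuous_image continuous_intros continuous_on_subset[OF cFg]) auto
    then obtain B where B: "\<And>t. s - 1 \<le> t \<Longrightarrow> t \<le> s + 1 \<Longrightarrow> \<bar>fst (F (\<gamma> t))\<bar> \<le> B"
      using bounded_real compact_imp_bounded by (metis (no_types, lifting) atLeastAtMost_iff imageI)
    have gB: "g t \<in> {-(B+C)..B+C}" if "s - 1 \<le> t" "t \<le> s + 1" for t
      using B[OF that] C[of "g t"] \<gamma>_g[of t] by (auto simp: X_def abs_le_iff)
    have "continuous_on (\<gamma> ` {-(B+C)..B+C}) (inv \<gamma>)"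
      by (rule continuous_on_inv[OF continuous_on_subset[OF cont_\<gamma>]]) (simp_all add: inj_\<gamma>)
    then have "continuous_on {s-1..s+1} (\<lambda>t. inv \<gamma> (F (\<gamma> t)))"
    proof (rule continuous_on_compose2)
      show "continuous_on {s-1..s+1} (\<lambda>t. F (\<gamma> t))" by (rule continuous_on_subset[OF cFg]) simp
      show "(\<lambda>t. F (\<gamma> t)) ` {s-1..s+1} \<subseteq> \<gamma> ` {-(B+C)..B+C}"
        using gB \<gamma>_g by (metis (no_types, lifting) atLeastAtMost_iff image_eqI image_subsetI)
    qed
    then have "continuous_on {s-1..s+1} g" by (simp add: g_def[abs_def])
    then have "continuous_on {s-1<..<s+1} g" by (rule continuous_on_subset) auto
    then show ?thesis by (simp add: continuous_on_eq_continuous_at)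
  qed
  then show ?thesis by (simp add: continuous_at_imp_continuous_on)
qed

text \<open>A continuous injection of the line is strictly monotone, and commuting with the unit
  translation excludes the decreasing case.\<close>

lemma g_mono: "s \<le> t \<Longrightarrow> g s \<le> g t"
proof -
  have "strict_mono g"
  proof -
    have "strict_mono_on UNIV g \<or> strict_antimono_on UNIV g"
      using injective_eq_monotone_map[of UNIV g] cont_g inj_g by (simp add: is_interval_univ)
    moreover have "\<not> strict_antimono_on UNIV g"
    proof
      assume "strict_antimono_on UNIV g"
      then have "g 0 > g (0 + 1)" by (auto simp: monotone_on_def)
      then show False using g_shift[of 0] by simp
    qed
    ultimately show ?thesis by simp
  qed
  then show "s \<le> t \<Longrightarrow> g s \<le> g t" by (simp add: strict_mono_less_eq)
qed

lemma gn_mono: "s \<le> t \<Longrightarrow> (g ^^ n) s \<le> (g ^^ n) t"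
  by (induction n) (simp_all add: g_mono)

lemma gn_shift: "(g ^^ n) (t + 1) = (g ^^ n) t + 1"
  by (induction n) (simp_all add: g_shift)

lemma gn_shift_int: "(g ^^ n) (t + of_int k) = (g ^^ n) t + of_int k"
proof -
  have n: "(g ^^ n) (t + real m) = (g ^^ n) t + real m" for m t
    by (induction m) (simp_all add: gn_shift add.assoc[symmetric] add.commute[of 1])
  show ?thesis
  proof (cases "k \<ge> 0")
    case True
    then show ?thesis using n[of t "nat k"] by simp
  next
    case False
    then show ?thesis using n[of "t + of_int k" "nat (-k)"] by simp
  qed
qed

text \<open>The displacement is 1-periodic and the iterate is monotone: move \<open>t\<close> by an
  integer to just beyond \<open>t0\<close>, at most one unit away, and compare.\<close>

lemma gn_displacement_osc: "(g ^^ n) t - t \<ge> (g ^^ n) t0 - t0 - 1"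
proof -
  define k where "k = \<lfloor>t0 - t\<rfloor> + 1"
  have "t0 \<le> t + of_int k" "t + of_int k \<le> t0 + 1" unfolding k_def by linarith+
  then have "(g ^^ n) t0 \<le> (g ^^ n) t + of_int k" using gn_mono[of t0 "t + of_int k" n] gn_shift_int by simp
  then show ?thesis using \<open>t + of_int k \<le> t0 + 1\<close> by linarith
qed

lemma gn_freq: "(\<lambda>m. (((g ^^ n) ^^ m) t - t) / real m) \<longlonglongrightarrow> real n * \<omega>"
proof (cases "n = 0")
  case True
  then show ?thesis by simp
next
  case False
  have "(\<lambda>k. ((g ^^ k) t - t) / real k) \<longlonglongrightarrow> \<omega>" using freq[of t] by (simp add: g_def[abs_def])
  moreover have "strict_mono (\<lambda>m. n * m)" using False by (auto simp: strict_mono_def)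
  ultimately have "(\<lambda>m. ((g ^^ (n * m)) t - t) / real (n * m)) \<longlonglongrightarrow> \<omega>"
    by (auto dest: LIMSEQ_subseq_LIMSEQ simp: o_def)
  then have "(\<lambda>m. real n * (((g ^^ (n * m)) t - t) / real (n * m))) \<longlonglongrightarrow> real n * \<omega>"
    by (intro tendsto_intros)
  then show ?thesis using False by (simp add: funpow_mult mult.commute)
qed

text \<open>Displacements of the n-th iterate at two points differ by at most 1. Averaging them
  along the orbit of \<open>t\<close> tends to n \<omega>, so each single displacement is within 1
  of n \<omega>.\<close>

lemma gn_bound: "\<bar>(g ^^ n) t - t - real n * \<omega>\<bar> \<le> 1"
proof -
  have hm: "((g ^^ n) ^^ m) s - s \<ge> real m * c" if "\<And>s. (g ^^ n) s - s \<ge> c" for m s c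
  proof (induction m)
    case (Suc m)
    then show ?case using that[of "((g ^^ n) ^^ m) s"] by (simp add: algebra_simps)
  qed simp
  have hm': "((g ^^ n) ^^ m) s - s \<le> real m * c" if "\<And>s. (g ^^ n) s - s \<le> c" for m s c
  proof (induction m)
    case (Suc m)
    then show ?case using that[of "((g ^^ n) ^^ m) s"] by (simp add: algebra_simps)
  qed simp
  have "(g ^^ n) t - t - 1 \<le> real n * \<omega>"
  proof (rule LIMSEQ_le_const[OF gn_freq[of n t]], intro exI[of _ 1] allI impI)
    fix m :: nat assume "m \<ge> 1"
    then show "(g ^^ n) t - t - 1 \<le> (((g ^^ n) ^^ m) t - t) / real m"
      using hm[of "(g ^^ n) t - t - 1" m t] gn_displacement_osc[of n t] by (simp add: field_simps)
  qed
  moreover have "real n * \<omega> \<le> (g ^^ n) t - t + 1"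
  proof (rule LIMSEQ_le_const2[OF gn_freq[of n t]], intro exI[of _ 1] allI impI)
    fix m :: nat assume "m \<ge> 1"
    moreover have "(g ^^ n) s - s \<le> (g ^^ n) t - t + 1" for s
      using gn_displacement_osc[of n s t] by simp
    ultimately show "(((g ^^ n) ^^ m) t - t) / real m \<le> (g ^^ n) t - t + 1"
      using hm'[of "(g ^^ n) t - t + 1" m t] by (simp add: field_simps)
  qed
  ultimately show ?thesis by linarith
qed

text \<open>A point on the upper side at time 0 stays there, which contradicts the slow phase; a
  point on the lower side at time \<open>L\<close> stays there, which contradicts the fast phase.
  \<open>C\<close> absorbs the bounded deviation of orbits on the circle from uniform
  rotation.\<close>

lemma comparison:
  "\<exists>C. \<forall>z L M. \<not> (fst ((F ^^ L) z) - fst z < real L * \<omega> - C \<and>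
                 fst ((F ^^ (L + M)) z) - fst ((F ^^ L) z) > real M * \<omega> + C)"
proof -
  obtain C0 where C0: "\<And>t. \<bar>X t - t\<bar> \<le> C0" "C0 \<ge> 0" using X_bound by blast
  \<comment> \<open>Orbits on the circle deviate from uniform rotation by at most
    \<open>C0 + 1\<close>; a margin of \<open>C0 + 2\<close> is used on either side of the orbit
    point.\<close>
  define C where "C = 2 * C0 + 4"
  have "\<not> (fst ((F ^^ L) z) - fst z < real L * \<omega> - C \<and>
           fst ((F ^^ (L + M)) z) - fst ((F ^^ L) z) > real M * \<omega> + C)" for z L M
  proof
    assume A: "fst ((F ^^ L) z) - fst z < real L * \<omega> - C \<and>
           fst ((F ^^ (L + M)) z) - fst ((F ^^ L) z) > real M * \<omega> + C"
    define x where "x n = fst ((F ^^ n) z)" for n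
    \<comment> \<open>\<open>(a n t, b n t)\<close> is the vector from the circle point to the orbit
      point at time \<open>n\<close>; \<open>t\<close> is the parameter of the circle point at time
      0.\<close>
    define a where "a n t = x n - X ((g ^^ n) t)" for n t
    define b where "b n t = snd ((F ^^ n) z) - snd (\<gamma> ((g ^^ n) t))" for n t
    have Xn: "\<bar>X ((g ^^ n) t) - t - real n * \<omega>\<bar> \<le> C0 + 1" for n t
      using gn_bound[of n t] C0(1)[of "(g ^^ n) t"] by linarith
    have slow: "x L - x 0 < real L * \<omega> - C" and fast: "x (L + M) - x L > real M * \<omega> + C"
      using A by (auto simp: x_def)
    show False
    proof (cases "z \<in> range \<gamma>")
      case True
      then obtain t where "z = \<gamma> t" by auto
      then have "x n = X ((g ^^ n) t)" for n by (simp add: x_def X_def \<gamma>_gn)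
      then show False using slow Xn[of L t] Xn[of 0 t] by (simp add: C_def)
    next
      case False
      have off: "(F ^^ n) z \<notin> range \<gamma>" for n
      proof (induction n)
        case (Suc n)
        show ?case
        proof
          assume "(F ^^ Suc n) z \<in> range \<gamma>"
          then obtain w where "w \<in> range \<gamma>" "F w = F ((F ^^ n) z)" using inv_\<gamma> by (metis imageE funpow.simps(2) o_apply)
          then show False using Suc inj_F by (metis injD)
        qed
      qed (use False in simp)
      have nz: "a n t \<noteq> 0 \<or> b n t \<noteq> 0" for n t
      proof (rule ccontr)
        assume "\<not> ?thesis"
        then have "(F ^^ n) z = \<gamma> ((g ^^ n) t)" by (simp add: a_def b_def x_def X_def prod_eq_iff)
        then show False using off[of n] by auto
      qed
      have aS: "a (Suc n) t = a n t + b n t" for n t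
        by (simp add: a_def b_def x_def X_def \<gamma>_g F_fst)
      have bS: "b (Suc n) t = b n t + (\<phi> (x (Suc n)) - \<phi> (X ((g ^^ Suc n) t)))" for n t
        by (simp add: b_def x_def X_def \<gamma>_g F_snd)
      have cgn: "continuous_on UNIV (g ^^ n)" for n
      proof (induction n)
        case 0
        show ?case by (simp add: continuous_on_id)
      next
        case (Suc n)
        then show ?case using continuous_on_compose2[OF cont_g Suc] by (simp add: o_def)
      qed
      have c\<gamma>: "continuous_on UNIV (\<lambda>t. \<gamma> ((g ^^ n) t))" for n
        using continuous_on_compose2[OF cont_\<gamma> cgn] by simp
      have ca: "continuous_on UNIV (a n)" and cb: "continuous_on UNIV (b n)" for n
        unfolding a_def b_def X_def using c\<gamma>[of n] by (auto intro!: continuous_intros)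
      have apos: "a n t > 0" if "t + real n * \<omega> + C0 + 1 < x n" for n t
        using Xn[of n t] that by (simp add: a_def abs_le_iff)
      have aneg: "a n t < 0" if "t + real n * \<omega> - C0 - 1 > x n" for n t
        using Xn[of n t] that by (simp add: a_def abs_le_iff)
      have "\<exists>\<theta>. lifts_arg (a n) (b n) \<theta>" for n
        by (rule lifts_arg_exists[OF ca cb nz, of "x n - real n * \<omega> - C0 - 2"]) (auto intro!: apos)
      then obtain \<theta> where \<theta>: "\<And>n. lifts_arg (a n) (b n) (\<theta> n)" by metis
      \<comment> \<open>The intermediate vector after the shear and before the kick, with lifted
        angle \<open>\<psi> n\<close>.\<close>
      have nz': "a (Suc n) t \<noteq> 0 \<or> b n t \<noteq> 0" for n t using nz[of n t] aS[of n t] by auto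
      have "\<exists>\<theta>. lifts_arg (a (Suc n)) (b n) \<theta>" for n
        by (rule lifts_arg_exists[OF ca cb nz', of "x (Suc n) - real (Suc n) * \<omega> - C0 - 2"]) (auto intro!: apos)
      then obtain \<psi> where \<psi>: "\<And>n. lifts_arg (a (Suc n)) (b n) (\<psi> n)" by metis
      define T where "T n = x n - real n * \<omega> + C0 + 2" for n
      have anegT: "a n t < 0" if "t \<ge> T n" for n t using that by (intro aneg) (simp add: T_def)
      text \<open>The map is a shear followed by a vertical kick. Under the shear a vector turns clockwise,
        under the kick it stays on its side of the vertical.\<close>
      have nonopp1: "\<not> (a (Suc n) t = - c * a n t \<and> b n t = - c * b n t)" if "c > 0" for n t c
      proof
        assume e: "a (Suc n) t = - c * a n t \<and> b n t = - c * b n t"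
        then have "(1 + c) * b n t = 0" by (simp add: algebra_simps)
        then have b0: "b n t = 0" using that by auto
        then have "(1 + c) * a n t = 0" using e aS[of n t] by (simp add: algebra_simps)
        then show False using that b0 nz[of n t] by auto
      qed
      have nonopp2: "\<not> (a (Suc n) t = - c * a (Suc n) t \<and> b (Suc n) t = - c * b n t)" if "c > 0" for n t c
      proof
        assume e: "a (Suc n) t = - c * a (Suc n) t \<and> b (Suc n) t = - c * b n t"
        then have "(1 + c) * a (Suc n) t = 0" by (simp add: algebra_simps)
        then have a0: "a (Suc n) t = 0" using that by auto
        then have "b (Suc n) t = b n t" using bS[of n t] by (simp add: a_def)
        then have "(1 + c) * b n t = 0" using e by (simp add: algebra_simps)
        then show False using that a0 nz'[of n t] by auto
      qed
      have cw: "a n t > 0 \<Longrightarrow> a (Suc n) t \<le> 0 \<Longrightarrow> b n t < 0"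
        "a n t < 0 \<Longrightarrow> a (Suc n) t \<ge> 0 \<Longrightarrow> b n t > 0" for n t
        using aS[of n t] by auto
      note s1 = lifts_arg_step[OF \<theta> \<psi> nonopp1] and s2 = lifts_arg_step[OF \<psi> \<theta> nonopp2]
      \<comment> \<open>A time step is the shear (\<open>s1\<close>) and then the kick
        (\<open>s2\<close>). The kick leaves the first component alone, so its clockwise hypotheses
        hold vacuously.\<close>
      have lt: "\<theta> (Suc n) t < pi/2" if "\<theta> n t < pi/2" for n t
        by (rule s2(1)[OF _ _ _ s1(1)]) (use that aS in auto)
      have lt': "\<theta> (Suc n) t < - (pi/2)" if "\<theta> n t < - (pi/2)" for n t
        by (rule s2(2)[OF _ _ _ s1(2)]) (use that aS in auto)
      have pos: "\<forall>t\<ge>T (Suc n). \<theta> (Suc n) t > pi/2" if P: "\<forall>t\<ge>T n. \<theta> n t > pi/2" for n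
      proof -
        have "\<psi> n t > pi/2" if "t \<ge> T (Suc n)" for t
          by (rule s1(3)[where ?t1.0 = "T n" and ?t2.0 = "T (Suc n)"]) (use P anegT that in \<open>auto simp: cw\<close>)
        then show ?thesis
          by (intro allI impI s2(3)[where ?t1.0 = "T (Suc n)" and ?t2.0 = "T (Suc n)"]) (use anegT in auto)
      qed
      \<comment> \<open>The lower side is preserved by \<open>lt'\<close>, so a point on the upper
        side at time \<open>L\<close> was already there at time 0.\<close>
      consider "\<forall>t\<ge>T 0. \<theta> 0 t > pi/2" | "\<forall>t\<ge>T L. \<theta> L t < - (pi/2)"
      proof -
        have dich: "(\<forall>t\<ge>T n. \<theta> n t > pi/2) \<or> (\<forall>t\<ge>T n. \<theta> n t < - (pi/2))" for n
          by (rule lifts_arg_dichotomy[OF \<theta> anegT])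
        have "\<forall>t\<ge>T 0. \<theta> 0 t > pi/2" if "\<forall>t\<ge>T L. \<theta> L t > pi/2"
        proof (rule ccontr)
          assume "\<not> ?thesis"
          then have "\<theta> 0 t < - (pi/2)" if "t \<ge> T 0" for t
            using dich[of 0] that by blast
          then have "\<theta> 0 (max (T 0) (T L)) < - (pi/2)" by simp
          moreover have "\<theta> n t < - (pi/2)" if "\<theta> 0 t < - (pi/2)" for n t
            by (induction n) (use that lt' in auto)
          ultimately have "\<theta> L (max (T 0) (T L)) < - (pi/2)" by blast
          moreover have "\<theta> L (max (T 0) (T L)) > pi/2" using that by simp
          ultimately show False using pi_gt_zero by linarith
        qed
        then show ?thesis using dich[of L] that by blast
      qed
      then show False
      proof cases
        case 1
        have P: "\<forall>t\<ge>T n. \<theta> n t > pi/2" for n by (induction n) (use 1 pos in auto)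
        \<comment> \<open>At time 0 this parameter lies to the left of the orbit point, so its angle
          never reaches pi/2. After the slow phase it is beyond \<open>T L\<close>, where the upper
          side demands an angle above pi/2.\<close>
        define t where "t = x 0 - C0 - 2"
        have "\<bar>\<theta> 0 t\<bar> < pi/2" by (rule lifts_arg_near_zero[OF \<theta>]) (auto intro!: apos simp: t_def)
        then have "\<theta> n t < pi/2" for n by (induction n) (use lt in auto)
        from this[of L] have "\<theta> L t < pi/2" .
        moreover have "t \<ge> T L" using slow C0(2) unfolding t_def T_def C_def by linarith
        ultimately show False using P[of L] by (meson less_asym)
      next
        case 2
        \<comment> \<open>The angle at this parameter stays below -pi/2, yet after the fast phase
          the orbit point is far to the right of it, which forces an angle near 0.\<close>
        then have "\<theta> L (T L) < - (pi/2)" by simp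
        then have "\<theta> (L + n) (T L) < - (pi/2)" for n by (induction n) (use lt' in auto)
        moreover have "\<bar>\<theta> (L + M) (T L)\<bar> < pi/2"
          by (rule lifts_arg_near_zero[OF \<theta>], rule apos)
             (use fast in \<open>simp add: T_def C_def algebra_simps\<close>)
        ultimately show False by (smt (verit))
      qed
    qed
  qed
  then show ?thesis by blast
qed

end

section \<open>The action and nearly optimal paths\<close>

text \<open>The potential is charged at the later point of each step, as in the generating function,
  where it depends on x'. Hence end point terms appear under time reversal.\<close>

definition act :: "(real \<Rightarrow> real) \<Rightarrow> (nat \<Rightarrow> real) \<Rightarrow> nat \<Rightarrow> nat \<Rightarrow> real" where
  "act V z a b = (\<Sum>i=a..<b. (z (Suc i) - z i)\<^sup>2 / 2 + V (z (Suc i)))"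

lemma act_refl [simp]: "act V z a a = 0"
  by (simp add: act_def)

lemma act_Suc: "a \<le> b \<Longrightarrow> act V z a (Suc b) = act V z a b + ((z (Suc b) - z b)\<^sup>2 / 2 + V (z (Suc b)))"
  by (simp add: act_def)

lemma act_head: "a < b \<Longrightarrow> act V z a b = ((z (Suc a) - z a)\<^sup>2 / 2 + V (z (Suc a))) + act V z (Suc a) b"
  by (simp add: act_def sum.atLeast_Suc_lessThan)

lemma act_split: "a \<le> b \<Longrightarrow> b \<le> c \<Longrightarrow> act V z a c = act V z a b + act V z b c"
  by (simp add: act_def sum.atLeastLessThan_concat)

lemma act_cong: "(\<And>i. a \<le> i \<Longrightarrow> i \<le> b \<Longrightarrow> z i = y i) \<Longrightarrow> act V z a b = act V y a b"
  unfolding act_def by (rule sum.cong) auto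

lemma act_shift: "act V (\<lambda>i. z (i + m)) a b = act V z (a + m) (b + m)"
  unfolding act_def using sum.shift_bounds_nat_ivl[of "\<lambda>i. (z (Suc i) - z i)\<^sup>2 / 2 + V (z (Suc i))" a m b] by simp

lemma act_nonneg: "(\<And>x. V x \<ge> 0) \<Longrightarrow> act V z a b \<ge> 0"
  unfolding act_def by (intro sum_nonneg) (simp add: add_nonneg_nonneg)

lemma act_mono_pot:
  "(\<And>i. a < i \<Longrightarrow> i \<le> b \<Longrightarrow> V (z i) \<le> W (z i)) \<Longrightarrow> act V z a b \<le> act W z a b"
  unfolding act_def by (intro sum_mono) auto

lemma act_reverse:
  "act V (\<lambda>i. - z (n - i)) 0 n + V (- z n) = act (\<lambda>x. V (- x)) z 0 n + V (- z 0)"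
proof -
  have "(\<Sum>i=0..<n. (- z (n - Suc i) - - z (n - i))\<^sup>2 / 2 + V (- z (n - Suc i)))
      = (\<Sum>i=0..<n. (z (Suc i) - z i)\<^sup>2 / 2 + V (- z i))"
    by (rule sum.reindex_bij_witness[of _ "\<lambda>i. n - Suc i" "\<lambda>i. n - Suc i"])
       (auto simp: Suc_diff_Suc power2_commute)
  moreover have "(\<Sum>i=0..<n. V (- z i)) + V (- z n) = (\<Sum>i=0..<n. V (- z (Suc i))) + V (- z 0)"
    by (induction n) simp_all
  ultimately show ?thesis by (simp add: act_def sum.distrib)
qed

text \<open>The sum over the points at depth more than \<open>k\<close> is at most \<open>L\<close> times what is lost by passing
  from depth \<open>k\<close> to depth \<open>k + 1\<close>, hence decays geometrically in \<open>k\<close>.\<close>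

lemma depth_decay:
  fixes f :: "nat \<Rightarrow> real"
  assumes f: "\<And>n. f n \<ge> 0" and L: "L > 0" and e: "e \<ge> 0"
    and H: "\<And>i j. p \<le> i \<Longrightarrow> i < j \<Longrightarrow> j \<le> q \<Longrightarrow> (\<Sum>n\<in>{i<..<j}. f n) \<le> L * (f i + f j) + e"
    and n: "p + w \<le> n" "n + w \<le> q"
  shows "f n \<le> (L / (1 + L)) ^ w * (\<Sum>n=p..q. f n) + e"
proof -
  define S where "S k = (\<Sum>n\<in>{p+k..q-k}. f n)" for k
  have S0: "S k \<ge> 0" for k unfolding S_def by (intro sum_nonneg f)
  have "p + k \<le> n \<Longrightarrow> n + k \<le> q \<Longrightarrow> S k \<le> (L / (1 + L)) ^ k * S 0 + e" for k
  proof (induction k)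
    case 0
    then show ?case using e by simp
  next
    case (Suc k)
    have lt: "p + k < q - k" using Suc.prems by linarith
    have set: "{p+k..q-k} = insert (p+k) (insert (q-k) {p+k<..<q-k})" using lt by auto
    have "{p + Suc k..q - Suc k} = {p+k<..<q-k}" by auto
    then have S1: "S (Suc k) = (\<Sum>n\<in>{p+k<..<q-k}. f n)" by (simp add: S_def)
    have "S k = f (p+k) + f (q-k) + S (Suc k)"
      unfolding S1 unfolding S_def set using lt by simp
    moreover have "S (Suc k) \<le> L * (f (p+k) + f (q-k)) + e"
      unfolding S1 by (rule H) (use lt in auto)
    ultimately have "S (Suc k) \<le> L * (S k - S (Suc k)) + e" by simp
    then have "(1 + L) * S (Suc k) \<le> L * S k + e" by (simp add: algebra_simps)
    also have "\<dots> \<le> L * ((L / (1 + L)) ^ k * S 0 + e) + e"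
      using Suc L by (intro add_right_mono mult_left_mono) auto
    also have "\<dots> = ((1 + L) * (L / (1 + L))) * (L / (1 + L)) ^ k * S 0 + (1 + L) * e"
    proof -
      have "(1 + L) * (L / (1 + L)) = L" using L by simp
      then show ?thesis by (simp add: algebra_simps)
    qed
    also have "\<dots> = (1 + L) * ((L / (1 + L)) ^ Suc k * S 0 + e)"
      unfolding power_Suc by (simp only: algebra_simps)
    finally show ?case using L by (simp add: mult_le_cancel_left)
  qed
  from this[OF n] have "S w \<le> (L / (1 + L)) ^ w * S 0 + e" .
  moreover have "f n \<le> S w"
    unfolding S_def by (rule member_le_sum) (use n f in auto)
  ultimately show ?thesis by (simp add: S_def)
qed

text \<open>All that is used of the pendulum: \<open>V_ge\<close> makes time away from 0 expensive,
  \<open>V_le_sq\<close> makes jumps from and to points near 0 cheap, and \<open>V_mid\<close> with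
  \<open>V_le\<close> fixes the potential up to a factor 2 in the middle of the period.\<close>

locale barrier =
  fixes V :: "real \<Rightarrow> real" and s :: real
  assumes s: "0 < s" "s \<le> 1/100"
    and V_nonneg: "V x \<ge> 0" and V_even: "V (- x) = V x" and V_per: "V (x + 1) = V x"
    and V_le: "V x \<le> 2 * s\<^sup>2" and V_le_sq: "V x \<le> x\<^sup>2"
    and V_ge: "\<bar>x\<bar> \<le> 3/4 \<Longrightarrow> s\<^sup>2 * x\<^sup>2 \<le> V x"
    and V_mid: "1/4 \<le> x \<Longrightarrow> x \<le> 3/4 \<Longrightarrow> s\<^sup>2 \<le> V x"
begin

lemma V0 [simp]: "V 0 = 0"
  using V_le_sq[of 0] V_nonneg[of 0] by simp

lemma V_refl: "V (1 - x) = V x"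
  using V_per[of "- x"] V_even[of x] by simp

lemma s2_pos: "s\<^sup>2 > 0" using s by simp

lemma s2_le: "s\<^sup>2 \<le> 1/10000"
  using power_mono[OF s(2), of 2] s(1) by (simp add: power2_eq_square)

text \<open>The Mane potential (Peierls barrier) from 0 with free number of steps. Waiting at 0
  costs nothing, so a bound on the number of steps from above is the only real restriction.\<close>

definition U :: "real \<Rightarrow> real" where
  "U x = Inf {act V z 0 n |z n. z 0 = 0 \<and> z n = x}"

lemma U_bdd: "bdd_below {act V z 0 n |z n. z 0 = 0 \<and> z n = x}"
  by (rule bdd_belowI[of _ 0]) (auto intro: act_nonneg V_nonneg)

lemma U_le: "z 0 = 0 \<Longrightarrow> z n = x \<Longrightarrow> U x \<le> act V z 0 n"
  unfolding U_def by (rule cInf_lower[OF _ U_bdd]) blast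

lemma direct_path: "act V (\<lambda>i. if i = 0 then 0 else x) 0 1 = x\<^sup>2 / 2 + V x"
  by (simp add: act_def)

lemma U_le_direct: "U x \<le> x\<^sup>2 / 2 + V x"
  using U_le[of "\<lambda>i. if i = 0 then 0 else x" 1 x] direct_path[of x] by simp

lemma U_approx: "e > 0 \<Longrightarrow> \<exists>z n. z 0 = 0 \<and> z n = x \<and> act V z 0 n < U x + e"
proof -
  assume "e > 0"
  moreover have "{act V z 0 n |z n. z 0 = 0 \<and> z n = x} \<noteq> {}"
  proof -
    have "act V (\<lambda>i. if i = 0 then 0 else x) 0 1 \<in> {act V z 0 n |z n. z 0 = 0 \<and> z n = x}"
      by (auto intro!: exI[of _ "\<lambda>i. if i = 0 then 0 else x"] exI[of _ "1::nat"])
    then show ?thesis by blast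
  qed
  ultimately have "\<exists>v\<in>{act V z 0 n |z n. z 0 = 0 \<and> z n = x}. v < U x + e"
    by (intro cInf_lessD) (simp_all add: U_def)
  then show ?thesis by auto
qed

text \<open>Stop at the first time the path reaches \<open>x\<close> or beyond and clamp it to
  [0, x]. Clamping is 1-Lipschitz, so kinetic terms do not grow, and negative values are moved to
  the zero 0 of the potential.\<close>

lemma confine:
  assumes x: "0 < x" and z: "z 0 = 0" "z n = x"
  shows "\<exists>y m. y 0 = 0 \<and> y m = x \<and> (\<forall>i<m. 0 \<le> y i \<and> y i < x) \<and> act V y 0 m \<le> act V z 0 n"
proof -
  define m where "m = (LEAST i. z i \<ge> x)"
  have zm: "z m \<ge> x" unfolding m_def by (rule LeastI[of _ n]) (use z in simp)
  have mn: "m \<le> n" unfolding m_def by (rule Least_le) (use z in simp)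
  have lt: "z i < x" if "i < m" for i using not_less_Least[of i "\<lambda>i. z i \<ge> x"] that unfolding m_def by auto
  have m0: "m > 0" using zm z x by (cases m) auto
  define y where "y i = max 0 (min x (z i))" for i
  have ym: "y m = x" using zm x by (simp add: y_def)
  have kin: "(y (Suc i) - y i)\<^sup>2 \<le> (z (Suc i) - z i)\<^sup>2" for i
  proof -
    have "\<bar>y (Suc i) - y i\<bar> \<le> \<bar>z (Suc i) - z i\<bar>" by (auto simp: y_def max_def min_def abs_if)
    then show ?thesis by (rule abs_le_square_iff[THEN iffD1])
  qed
  obtain k where k: "m = Suc k" using m0 by (cases m) auto
  have "act V y 0 k \<le> act V z 0 k"
    unfolding act_def
  proof (intro sum_mono add_mono divide_right_mono kin)
    fix i assume "i \<in> {0..<k}"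
    then have "z (Suc i) < x" using lt k by auto
    then show "V (y (Suc i)) \<le> V (z (Suc i))" by (auto simp: y_def max_def V_nonneg)
  qed simp
  moreover have "act V y 0 m = act V y 0 k + ((y m - y k)\<^sup>2 / 2 + V x)"
    unfolding k by (simp add: act_Suc ym[unfolded k])
  \<comment> \<open>The clamped path pays \<open>V x\<close> at its end although \<open>z m\<close>
    may lie beyond \<open>x\<close>, where the potential can be smaller; the term is found at the
    end of \<open>z\<close>, which is exactly at \<open>x\<close>.\<close>
  moreover have "act V z 0 n \<ge> act V z 0 k + ((z m - z k)\<^sup>2 / 2 + V x)"
  proof (cases "m = n")
    case True
    then show ?thesis using act_Suc[of 0 k V z] k z by simp
  next
    case False
    then obtain l where l: "n = Suc l" "m \<le> l" using mn by (cases n) auto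
    have "act V z 0 n = act V z 0 m + act V z m n" using mn by (intro act_split) auto
    moreover have "act V z m n = act V z m l + ((z n - z l)\<^sup>2 / 2 + V x)"
      using act_Suc[of m l V z] l z by simp
    moreover have "act V z m l \<ge> 0" by (intro act_nonneg V_nonneg)
    moreover have "(z n - z l)\<^sup>2 / 2 \<ge> 0" by simp
    moreover have "act V z 0 m = act V z 0 k + ((z m - z k)\<^sup>2 / 2 + V (z m))"
      unfolding k by (simp add: act_Suc)
    ultimately show ?thesis using V_nonneg[of "z m"] by linarith
  qed
  moreover have "(y m - y k)\<^sup>2 \<le> (z m - z k)\<^sup>2" using kin[of k] k by simp
  ultimately have "act V y 0 m \<le> act V z 0 n" by linarith
  moreover have "\<forall>i<m. 0 \<le> y i \<and> y i < x" using lt x by (auto simp: y_def)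
  moreover have "y 0 = 0" using z x by (simp add: y_def)
  ultimately show ?thesis using ym by blast
qed

text \<open>A nearly optimal path spends many steps only near 0, and a long initial piece near 0 can be
  replaced by a single jump.\<close>

lemma short_path:
  assumes x: "1/4 \<le> x" "x \<le> 3/4" and tol: "tol > 0"
  shows "\<exists>y m. y 0 = 0 \<and> y m = x \<and> m \<le> 2 * w + 1 \<and> (\<forall>i<m. 0 \<le> y i \<and> y i < x) \<and>
     act V y 0 m \<le> U x + 2 * ((1 / (1 + s\<^sup>2)) ^ w * (2 + 1 / s\<^sup>2)) + tol"
proof -
  \<comment> \<open>Chosen so that both the excess \<open>e\<close> and its amplification
    \<open>e / s\<^sup>2\<close> by the decay estimate fit into \<open>tol\<close>.\<close>
  define e where "e = min (s\<^sup>2) (tol * s\<^sup>2 / 3)"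
  have e: "e > 0" "e \<le> s\<^sup>2" "e \<le> tol * s\<^sup>2 / 3" using s tol by (auto simp: e_def)
  obtain z0 n0 where "z0 0 = 0" "z0 n0 = x" "act V z0 0 n0 < U x + e" using U_approx[OF e(1)] by blast
  then obtain z n where z: "z 0 = 0" "z n = x" "\<And>i. i < n \<Longrightarrow> 0 \<le> z i \<and> z i < x"
    and cost: "act V z 0 n < U x + e"
  proof -
    obtain z n where "z 0 = 0" "z n = x" "\<forall>i<n. 0 \<le> z i \<and> z i < x" "act V z 0 n \<le> act V z0 0 n0"
      using confine[of x z0 n0] x \<open>z0 0 = 0\<close> \<open>z0 n0 = x\<close> by auto
    then show ?thesis using that[of z n] \<open>act V z0 0 n0 < U x + e\<close> by auto
  qed
  define D where "D = (1 / (1 + s\<^sup>2)) ^ w * (2 + 1 / s\<^sup>2)"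
  have D0: "D \<ge> 0" unfolding D_def by (intro mult_nonneg_nonneg zero_le_power) (auto simp: add_nonneg_nonneg)
  have etol: "e + 2 * (e / s\<^sup>2) \<le> tol"
  proof -
    have "e / s\<^sup>2 \<le> tol / 3" using e(3) s2_pos by (simp add: field_simps)
    moreover have "e \<le> tol / 3"
    proof -
      have "tol * s\<^sup>2 \<le> tol * 1" using s2_le tol by (intro mult_left_mono) auto
      then show ?thesis using e(3) by simp
    qed
    ultimately show ?thesis by linarith
  qed
  show ?thesis
  proof (cases "n \<le> 2 * w + 1")
    case True
    have "e / s\<^sup>2 \<ge> 0" using e s2_pos by simp
    then have "act V z 0 n \<le> U x + 2 * D + tol" using cost D0 etol by linarith
    then show ?thesis using True z unfolding D_def by blast
  next
    \<comment> \<open>Now the index \<open>n - w\<close> has distance at least \<open>w\<close> from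
      both ends, so the decay estimate applies there.\<close>
    case False
    have zle: "\<bar>z i\<bar> \<le> 3/4" if "i \<le> n" for i
      using z(2) z(3)[of i] x that by (cases "i = n") auto
    have H: "(\<Sum>k\<in>{i<..<j}. (z k)\<^sup>2) \<le> 1 / s\<^sup>2 * ((z i)\<^sup>2 + (z j)\<^sup>2) + e / s\<^sup>2"
      if ij: "0 \<le> i" "i < j" "j \<le> n" for i j
    proof -
      \<comment> \<open>The points strictly between \<open>i\<close> and \<open>j\<close> are
        replaced by the single point 0. The changed length is harmless since \<open>U\<close> allows
        any number of steps.\<close>
      define y where "y k = (if k \<le> i then z k else if k = Suc i then 0 else z (k + j - i - 2))" for k
      have y0: "y 0 = 0" using z by (simp add: y_def)
      have "y (n - j + i + 2) = z (n - j + i + 2 + j - i - 2)" by (simp add: y_def)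
      moreover have "n - j + i + 2 + j - i - 2 = n" using ij by simp
      ultimately have yn: "y (n - j + i + 2) = x" using z by simp
      have "act V y 0 (n - j + i + 2) = act V y 0 i + act V y i (i + 2) + act V y (i + 2) (n - j + i + 2)"
        using act_split[of 0 "i+2" "n-j+i+2" V y] act_split[of 0 i "i+2" V y] by simp
      moreover have "act V y 0 i = act V z 0 i" by (rule act_cong) (simp add: y_def)
      moreover have "act V y (i + 2) (n - j + i + 2) = act V z j n"
      proof -
        have "act V y (i + 2) (n - j + i + 2) = act V (\<lambda>k. y (k + (i + 2))) 0 (n - j)"
          using act_shift[of V y "i + 2" 0 "n - j"] by (simp only: add_0 add.assoc)
        also have "\<dots> = act V (\<lambda>k. z (k + j)) 0 (n - j)" by (rule act_cong) (simp add: y_def)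
        also have "\<dots> = act V z j n" using ij by (simp add: act_shift)
        finally show ?thesis .
      qed
      moreover have "act V y i (i + 2) = (z i)\<^sup>2 / 2 + (z j)\<^sup>2 / 2 + V (z j)"
        using ij by (simp add: numeral_2_eq_2 act_Suc y_def)
      moreover have "U x \<le> act V y 0 (n - j + i + 2)" by (rule U_le[OF y0 yn])
      moreover have "act V z 0 n = act V z 0 i + act V z i j + act V z j n"
        using act_split[of 0 j n V z] act_split[of 0 i j V z] ij by simp
      ultimately have c: "act V z i j \<le> (z i)\<^sup>2 / 2 + (z j)\<^sup>2 / 2 + V (z j) + e" using cost by linarith
      obtain l where l: "j = Suc l" "i \<le> l" using ij by (cases j) auto
      have "s\<^sup>2 * (\<Sum>k\<in>{i<..<j}. (z k)\<^sup>2) \<le> (\<Sum>k\<in>{i<..<j}. V (z k))"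
        unfolding sum_distrib_left by (rule sum_mono) (use V_ge zle ij in auto)
      also have "\<dots> = (\<Sum>k=i..<l. V (z (Suc k)))"
      proof -
        have "{i<..<j} = {Suc i..<Suc l}" using l by auto
        then show ?thesis by (simp only: sum.shift_bounds_Suc_ivl)
      qed
      also have "\<dots> \<le> act V z i l" unfolding act_def by (rule sum_mono) simp
      also have "\<dots> \<le> act V z i j - V (z j)" using act_Suc[of i l V z] l by simp
      also have "\<dots> \<le> ((z i)\<^sup>2 + (z j)\<^sup>2) + e"
        using c zero_le_power2[of "z i"] zero_le_power2[of "z j"] by linarith
      finally show ?thesis using s2_pos by (simp add: field_simps)
    qed
    have "(z (n - w))\<^sup>2 \<le> (1 / s\<^sup>2 / (1 + 1 / s\<^sup>2)) ^ w * (\<Sum>k=0..n. (z k)\<^sup>2) + e / s\<^sup>2"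
      by (rule depth_decay[where p = 0 and q = n]) (use H s2_pos e False in auto)
    moreover have "1 / s\<^sup>2 / (1 + 1 / s\<^sup>2) = 1 / (1 + s\<^sup>2)" using s2_pos by (simp add: field_simps)
    moreover have "(\<Sum>k=0..n. (z k)\<^sup>2) \<le> 2 + 1 / s\<^sup>2"
    proof -
      have xx: "x\<^sup>2 \<le> (3/4)\<^sup>2" using x by (intro power_mono) auto
      have "{0..n} = insert 0 (insert n {0<..<n})" using False by auto
      then have "(\<Sum>k=0..n. (z k)\<^sup>2) = x\<^sup>2 + (\<Sum>k\<in>{0<..<n}. (z k)\<^sup>2)" using z False by simp
      moreover have "(\<Sum>k\<in>{0<..<n}. (z k)\<^sup>2) \<le> 1 / s\<^sup>2 * x\<^sup>2 + e / s\<^sup>2" using H[of 0 n] False z by simp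
      moreover have "1 / s\<^sup>2 * x\<^sup>2 \<le> 1 / s\<^sup>2 * 1" using xx s2_pos by (intro mult_left_mono) (auto simp: power2_eq_square)
      moreover have "e / s\<^sup>2 \<le> 1" using e s2_pos by simp
      moreover have "x\<^sup>2 \<le> 1" using xx by (simp add: power2_eq_square)
      ultimately show ?thesis by linarith
    qed
    then have "(1 / (1 + s\<^sup>2)) ^ w * (\<Sum>k=0..n. (z k)\<^sup>2) \<le> D"
      unfolding D_def by (intro mult_left_mono zero_le_power) (auto simp: add_nonneg_nonneg)
    ultimately have zw: "(z (n - w))\<^sup>2 \<le> D + e / s\<^sup>2" by simp
    \<comment> \<open>One jump from 0 to \<open>z (n - w)\<close>, then the last \<open>w\<close>
      steps of \<open>z\<close>.\<close>
    define y where "y k = (if k = 0 then 0 else z (k + (n - w) - 1))" for k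
    have y0: "y 0 = 0" by (simp add: y_def)
    have ym: "y (w + 1) = x" using z False by (simp add: y_def)
    have y1: "y 1 = z (n - w)" by (simp add: y_def)
    have "act V y 0 (w + 1) = ((y 1 - y 0)\<^sup>2 / 2 + V (y 1)) + act V y 1 (w + 1)"
      using act_head[of 0 "w+1" V y] by simp
    also have "act V y 1 (w + 1) = act V (\<lambda>k. y (k + 1)) 0 w" using act_shift[of V y 1 0 w] by (simp add: add.commute[of w])
    also have "\<dots> = act V (\<lambda>k. z (k + (n - w))) 0 w" by (rule act_cong) (simp add: y_def)
    also have "\<dots> = act V z (n - w) n"
    proof -
      have "w + (n - w) = n" using False by simp
      then show ?thesis using act_shift[of V z "n - w" 0 w] by (simp only: add_0)
    qed
    also have "\<dots> \<le> act V z 0 n"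
      using act_split[of 0 "n-w" n V z] act_nonneg[of V z 0 "n-w"] V_nonneg by simp
    finally have "act V y 0 (w + 1) \<le> (z (n - w))\<^sup>2 / 2 + V (z (n - w)) + act V z 0 n"
      using y0 by (simp only: y1 diff_0_right)
    also have "\<dots> \<le> (z (n - w))\<^sup>2 / 2 + (z (n - w))\<^sup>2 + (U x + e)"
      using V_le_sq[of "z (n-w)"] cost by simp
    also have "\<dots> \<le> 2 * (D + e / s\<^sup>2) + (U x + e)"
    proof (rule add_right_mono)
      have "q / 2 + q \<le> 2 * b" if "q \<le> b" "0 \<le> q" for q b :: real using that by linarith
      from this[OF zw zero_le_power2] show "(z (n - w))\<^sup>2 / 2 + (z (n - w))\<^sup>2 \<le> 2 * (D + e / s\<^sup>2)" .
    qed
    also have "\<dots> = U x + 2 * D + (e + 2 * (e / s\<^sup>2))" by (simp add: algebra_simps)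
    also have "\<dots> \<le> U x + 2 * D + tol" using etol by (rule add_left_mono)
    finally have "act V y 0 (w + 1) \<le> U x + 2 * D + tol" .
    moreover have "\<forall>i<w+1. 0 \<le> y i \<and> y i < x" using z(3) x False by (auto simp: y_def)
    ultimately show ?thesis using y0 ym unfolding D_def
      by (intro exI[of _ y] exI[of _ "w+1"]) auto
  qed
qed

end

lemma act_eqI:
  assumes "\<And>i. a \<le> i \<Longrightarrow> i < b \<Longrightarrow> z (Suc i) - z i = y (Suc i) - y i"
    and "\<And>i. a < i \<Longrightarrow> i \<le> b \<Longrightarrow> V (z i) = W (y i)"
  shows "act V z a b = act W y a b"
  unfolding act_def by (rule sum.cong) (use assms in auto)

context barrier
begin

text \<open>An optimal path to \<open>x\<close> has no point slightly below \<open>x\<close>: skipping such a point saves its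
  potential \<open>s\<^sup>2\<close> at little kinetic cost, unless the preceding jump is long, in which case the point
  is better placed in the middle.\<close>

lemma gap_path:
  assumes x: "1/4 + s/50 \<le> x" "x \<le> 3/4" and z: "z 0 = 0" "z n = x" "\<And>i. i < n \<Longrightarrow> 0 \<le> z i \<and> z i < x"
  shows "\<exists>y m. y 0 = 0 \<and> y m = x \<and> m \<le> n \<and> (\<forall>i<m. 0 \<le> y i \<and> y i \<le> x - s/50) \<and>
    act V y 0 m \<le> act V z 0 n"
proof -
  define m where "m = (LEAST i. z i > x - s/50)"
  have zm: "z m > x - s/50" unfolding m_def by (rule LeastI[of _ n]) (use z s in simp)
  have mn: "m \<le> n" unfolding m_def by (rule Least_le) (use z s in simp)
  have le: "z i \<le> x - s/50" if "i < m" for i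
    using not_less_Least[of i "\<lambda>i. z i > x - s/50"] that unfolding m_def by auto
  have m0: "m > 0" using zm z x by (cases m) auto
  obtain k where k: "m = Suc k" using m0 by (cases m) auto
  show ?thesis
  proof (cases "m = n")
    case True
    then show ?thesis using le z by (intro exI[of _ z] exI[of _ n]) auto
  next
    case False
    then have mlt: "m < n" using mn by simp
    then obtain l where l: "n = Suc l" "m \<le> l" by (cases n) auto
    define g where "g = z m - z k"
    define e where "e = x - z m"
    have zk: "0 \<le> z k" "z k \<le> x - s/50" using z(3)[of k] le[of k] k mlt by auto
    have e: "0 < e" "e < s/50" using zm z(3)[OF mlt] by (auto simp: e_def)
    have g: "g > 0" using zk zm by (simp add: g_def)
    have split: "act V z 0 n = act V z 0 m + act V z m l + ((z n - z l)\<^sup>2 / 2 + V x)"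
      using act_split[of 0 m n V z] act_Suc[of m l V z] l z mn by simp
    have "act V z 0 m = act V z 0 k + (g\<^sup>2 / 2 + V (z m))"
      unfolding k by (simp add: act_Suc g_def k)
    then have old: "act V z 0 n \<ge> act V z 0 k + g\<^sup>2 / 2 + V (z m) + V x"
      using split act_nonneg[of V z m l] V_nonneg zero_le_power2[of "z n - z l"] by (simp add: field_simps)
    have Vzm: "V (z m) \<ge> s\<^sup>2" using zm z(3)[OF mlt] x by (intro V_mid) auto
    show ?thesis
    \<comment> \<open>For a short jump, lengthening it by \<open>e\<close> < s/50 adds less than s^2
      of kinetic cost. For a long one, halving the lengthened jump saves nearly g^2/4 > 9/4 s^2,
      more than the potential 2 s^2 at the new midpoint.\<close>
    proof (cases "g \<le> 3 * s")
      case True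
      define y where "y i = (if i = m then x else z i)" for i
      have "act V y 0 m = act V y 0 k + ((x - z k)\<^sup>2 / 2 + V x)"
        unfolding k by (simp add: act_Suc y_def k)
      also have "act V y 0 k = act V z 0 k" by (rule act_cong) (simp add: y_def k)
      finally have new: "act V y 0 m = act V z 0 k + (x - z k)\<^sup>2 / 2 + V x" by simp
      have "x - z k = g + e" by (simp add: g_def e_def)
      then have "(x - z k)\<^sup>2 = g\<^sup>2 + 2 * (g * e) + e\<^sup>2" by (simp add: power2_sum)
      moreover have "g * e \<le> (3 * s) * (s / 50)" using True e g s by (intro mult_mono) auto
      moreover have "e\<^sup>2 \<le> (s/50)\<^sup>2" using e by (intro power_mono) auto
      ultimately have "(x - z k)\<^sup>2 / 2 \<le> g\<^sup>2 / 2 + s\<^sup>2" using s2_pos by (simp add: power2_eq_square field_simps)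
      then have "act V y 0 m \<le> act V z 0 n" using old new Vzm by linarith
      moreover have "\<forall>i<m. 0 \<le> y i \<and> y i \<le> x - s/50" using le z(3) mlt by (auto simp: y_def)
      ultimately show ?thesis using z mn m0 by (intro exI[of _ y] exI[of _ m]) (auto simp: y_def)
    next
      case False
      define u where "u = (z k + x) / 2"
      define y where "y i = (if i = m then u else if i = Suc m then x else z i)" for i
      have "act V y 0 (Suc m) = act V y 0 k + ((u - z k)\<^sup>2 / 2 + V u) + ((x - u)\<^sup>2 / 2 + V x)"
        unfolding k by (simp add: act_Suc y_def k)
      also have "act V y 0 k = act V z 0 k" by (rule act_cong) (simp add: y_def k)
      finally have new: "act V y 0 (Suc m) = act V z 0 k + (u - z k)\<^sup>2 / 2 + (x - u)\<^sup>2 / 2 + V u + V x" by simp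
      have eg: "e \<le> g / 150" using False e by simp
      have half: "u - z k = (g + e) / 2" "x - u = (g + e) / 2" by (simp_all add: u_def g_def e_def field_simps)
      have "(g + e)\<^sup>2 \<le> (151/150 * g)\<^sup>2" using eg e g by (intro power_mono) auto
      also have "\<dots> = 22801/22500 * g\<^sup>2" by (simp add: power_mult_distrib power_divide)
      finally have k1: "(g + e)\<^sup>2 \<le> 22801/22500 * g\<^sup>2" .
      have "(3 * s)\<^sup>2 \<le> g\<^sup>2" using False s by (intro power_mono) auto
      then have k2: "9 * s\<^sup>2 \<le> g\<^sup>2" by (simp add: power_mult_distrib)
      have "((g + e) / 2)\<^sup>2 = (g + e)\<^sup>2 / 4" by (simp add: power_divide)
      then have "((g + e) / 2)\<^sup>2 / 2 + ((g + e) / 2)\<^sup>2 / 2 + 2 * s\<^sup>2 \<le> g\<^sup>2 / 2"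
        using k1 k2 zero_le_power2[of g] by linarith
      then have "act V y 0 (Suc m) \<le> act V z 0 n" using old new V_le[of u] V_nonneg[of "z m"] half by simp
      moreover have "0 \<le> u" "u \<le> x - s/50" using zk x half False e by (auto simp: u_def field_simps)
      then have "\<forall>i<Suc m. 0 \<le> y i \<and> y i \<le> x - s/50" using le z(3) mlt by (auto simp: y_def less_Suc_eq)
      ultimately show ?thesis using z mlt m0
        by (intro exI[of _ y] exI[of _ "Suc m"]) (auto simp: y_def)
    qed
  qed
qed

text \<open>Waiting at 0 is free; truncated subtraction produces the waiting phase.\<close>

lemma pad_path:
  assumes "y 0 = 0" "m \<le> N"
  shows "act V (\<lambda>i. y (i - (N - m))) 0 N = act V y 0 m"
proof -
  let ?z = "\<lambda>i. y (i - (N - m))"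
  have "act V ?z 0 N = act V ?z 0 (N - m) + act V ?z (N - m) N" by (intro act_split) auto
  moreover have "act V ?z 0 (N - m) = act V (\<lambda>i. 0) 0 (N - m)" by (rule act_cong) (use assms in auto)
  moreover have "act V (\<lambda>i. 0) 0 (N - m) = 0" by (simp add: act_def)
  moreover have "act V ?z (N - m) N = act V (\<lambda>i. ?z (i + (N - m))) 0 m"
    using act_shift[of V ?z "N - m" 0 m] assms by (simp only: add_0 le_add_diff_inverse)
  ultimately show ?thesis by simp
qed

definition short_err :: "nat \<Rightarrow> real" where
  "short_err w = 2 * ((1 / (1 + s\<^sup>2)) ^ w * (2 + 1 / s\<^sup>2))"

lemma short_path_exact:
  assumes x: "1/4 \<le> x" "x \<le> 3/4" and tol: "tol > 0" and N: "N = 2 * w + 1"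
  shows "\<exists>y. y 0 = 0 \<and> y N = x \<and> (\<forall>i<N. 0 \<le> y i \<and> y i < x) \<and> act V y 0 N \<le> U x + short_err w + tol"
proof -
  obtain y m where y: "y 0 = 0" "y m = x" "m \<le> N" "\<forall>i<m. 0 \<le> y i \<and> y i < x"
      "act V y 0 m \<le> U x + short_err w + tol"
    using short_path[OF x tol, of w] unfolding N short_err_def by blast
  have "m > 0" using y x by (cases m) auto
  then show ?thesis using y pad_path[of y m N]
    by (intro exI[of _ "\<lambda>i. y (i - (N - m))"]) auto
qed

lemma short_gap_path_exact:
  assumes x: "1/4 + s/50 \<le> x" "x \<le> 3/4" and tol: "tol > 0" and N: "N = 2 * w + 1"
  shows "\<exists>y. y 0 = 0 \<and> y N = x \<and> (\<forall>i<N. 0 \<le> y i \<and> y i \<le> x - s/50) \<and>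
    act V y 0 N \<le> U x + short_err w + tol"
proof -
  have x': "1/4 \<le> x" using x s by linarith
  obtain z n where z: "z 0 = 0" "z n = x" "n \<le> N" "\<forall>i<n. 0 \<le> z i \<and> z i < x"
      "act V z 0 n \<le> U x + short_err w + tol"
    using short_path[OF x' x(2) tol, of w] unfolding N short_err_def by blast
  obtain y m where y: "y 0 = 0" "y m = x" "m \<le> n" "\<forall>i<m. 0 \<le> y i \<and> y i \<le> x - s/50"
      "act V y 0 m \<le> act V z 0 n"
    using gap_path[OF x z(1,2)] z(4) by blast
  have "m > 0" using y x' by (cases m) auto
  then show ?thesis using y z pad_path[of y m N]
    by (intro exI[of _ "\<lambda>i. y (i - (N - m))"]) auto
qed

text \<open>The infimal cost of passing from 0 to 1 through \<open>x\<close>: by reflection, \<open>U (1 - x)\<close> accounts for the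
  second half, but both halves contain the potential at \<open>x\<close>.\<close>

definition E :: "real \<Rightarrow> real" where "E x = U x + U (1 - x) - V x"

lemma E_refl: "E (1 - x) = E x"
  by (simp add: E_def V_refl)

text \<open>An approximate maximum needs only boundedness of \<open>E\<close>, not its continuity.
  The symmetry \<open>E_refl\<close> allows \<open>d\<close> to be taken in the left half.\<close>

lemma E_near_max:
  assumes "tol > 0"
  shows "\<exists>d. 3/8 \<le> d \<and> d \<le> 1/2 \<and> (\<forall>x. 3/8 \<le> x \<longrightarrow> x \<le> 5/8 \<longrightarrow> E x \<le> E d + tol)"
proof -
  have bdd: "bdd_above (E ` {3/8..5/8})"
  proof (rule bdd_aboveI2)
    fix x :: real assume x: "x \<in> {3/8..5/8}"
    have sq: "y\<^sup>2 \<le> 1" if "0 \<le> y" "y \<le> 1" for y :: real using that by (simp add: power_le_one)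
    have "E x \<le> U x + U (1 - x)" using V_nonneg[of x] by (simp add: E_def)
    also have "\<dots> \<le> (x\<^sup>2 / 2 + x\<^sup>2) + ((1-x)\<^sup>2 / 2 + (1-x)\<^sup>2)"
      using U_le_direct[of x] U_le_direct[of "1-x"] V_le_sq[of x] V_le_sq[of "1-x"] by linarith
    also have "\<dots> \<le> 3" using sq[of x] sq[of "1-x"] x by auto
    finally show "E x \<le> 3" .
  qed
  define S where "S = Sup (E ` {3/8..5/8})"
  have "\<exists>v\<in>E ` {3/8..5/8}. S - tol < v"
    by (rule less_cSupD) (use assms in \<open>auto simp: S_def\<close>)
  then obtain c where c: "c \<in> {3/8..5/8}" "S - tol < E c" by auto
  have mx: "E x \<le> E c + tol" if "3/8 \<le> x" "x \<le> 5/8" for x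
    using cSup_upper[of "E x" "E ` {3/8..5/8}"] bdd that c by (auto simp: S_def)
  show ?thesis
  proof (cases "c \<le> 1/2")
    case True
    then show ?thesis using c mx by auto
  next
    case False
    then show ?thesis using c mx by (intro exI[of _ "1 - c"]) (auto simp: E_refl)
  qed
qed

end

section \<open>Breaking the barrier by a bump\<close>

lemma act_add_const: "act (\<lambda>u. V u + c) y a b = act V y a b + real (b - a) * c"
  by (simp add: act_def sum.distrib algebra_simps del: sum.op_ivl_Suc)

text \<open>\<open>\<theta>\<close> bounds the squared distance from an integer at cell ends. The
  hypothesis \<open>small\<close> makes the lower bound for paths through \<open>d\<close> in
  \<open>peak_cost\<close> exceed the cost of the competitor in \<open>kink_path\<close>.\<close>

locale bumped = barrier V s for V s +
  fixes P :: "real \<Rightarrow> real" and d \<eta> \<beta> tol \<theta> :: real and w N :: nat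
  assumes d: "3/8 \<le> d" "d \<le> 1/2"
    and near_max: "3/8 \<le> x \<Longrightarrow> x \<le> 5/8 \<Longrightarrow> E x \<le> E d + tol"
    and P_ge: "V x \<le> P x" and P_per: "P (x + 1) = P x" and P_le_sq: "P x \<le> x\<^sup>2"
    and P_peak: "V d + \<eta> / 2 \<le> P d"
    and P_off: "0 \<le> x \<Longrightarrow> x \<le> 1 \<Longrightarrow> s/100 \<le> \<bar>x - d\<bar> \<Longrightarrow> P x \<le> V x + \<eta> * \<beta>"
    and N: "N = 2 * w + 1"
    and tol: "tol > 0"
    and \<theta>: "\<theta> < s\<^sup>2"
    and small: "4 * \<theta> + 2 * short_err w + 3 * tol + 2 * N * (\<eta> * \<beta>) < \<eta> / 2"
begin

lemma P_nonneg: "P x \<ge> 0"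
  using P_ge[of x] V_nonneg[of x] by linarith

lemma P_zero [simp]: "P 0 = 0" "P 1 = 0"
  using P_le_sq[of 0] P_nonneg[of 0] P_per[of 0] by simp_all

text \<open>Replacing a stretch of the minimizer by 0 costs only two jumps, of squared sizes at its
  ends, while every point of the stretch pays at least \<open>s\<^sup>2\<close> times its square. So
  \<open>depth_decay\<close> applies with L = 1/s^2.\<close>

lemma block_decay:
  assumes box: "\<And>n. p \<le> n \<Longrightarrow> n \<le> q \<Longrightarrow> d - 1 \<le> x n \<and> x n \<le> d"
    and opt: "\<And>i j. p \<le> i \<Longrightarrow> i < j \<Longrightarrow> j \<le> q \<Longrightarrow>
      act P x i j \<le> act P (\<lambda>k. if i < k \<and> k < j then 0 else x k) i j"
    and n: "p + w \<le> n" "n + w \<le> q"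
  shows "(x n)\<^sup>2 \<le> (1 / (1 + s\<^sup>2)) ^ w * real (q - p + 1)"
proof -
  have H: "(\<Sum>k\<in>{i<..<j}. (x k)\<^sup>2) \<le> 1 / s\<^sup>2 * ((x i)\<^sup>2 + (x j)\<^sup>2) + 0"
    if ij: "p \<le> i" "i < j" "j \<le> q" for i j
  proof (cases "j = Suc i")
    case True
    then have "{i<..<j} = {}" by auto
    then show ?thesis by simp
  next
    case False
    obtain l where l: "j = Suc l" "i < l" using ij False by (cases j) auto
    let ?y = "\<lambda>k. if i < k \<and> k < j then 0 else x k"
    have "act P ?y (Suc i) l = act P (\<lambda>k. 0) (Suc i) l" by (rule act_cong) (use l in auto)
    also have "\<dots> = 0" by (simp add: act_def)
    finally have "act P ?y i j = (x i)\<^sup>2 / 2 + (x j)\<^sup>2 / 2 + P (x j)"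
      using act_head[of i l P ?y] act_Suc[of i l P ?y] l by simp
    then have c: "act P x i j \<le> (x i)\<^sup>2 / 2 + (x j)\<^sup>2 / 2 + P (x j)" using opt[OF ij] by simp
    have "s\<^sup>2 * (\<Sum>k\<in>{i<..<j}. (x k)\<^sup>2) \<le> (\<Sum>k\<in>{i<..<j}. P (x k))"
      unfolding sum_distrib_left
    proof (rule sum_mono)
      fix k assume "k \<in> {i<..<j}"
      then have "\<bar>x k\<bar> \<le> 3/4" using box[of k] d ij by auto
      then show "s\<^sup>2 * (x k)\<^sup>2 \<le> P (x k)" using V_ge P_ge by (meson order_trans)
    qed
    also have "\<dots> = (\<Sum>k=i..<l. P (x (Suc k)))"
    proof -
      have "{i<..<j} = {Suc i..<Suc l}" using l by auto
      then show ?thesis by (simp only: sum.shift_bounds_Suc_ivl)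
    qed
    also have "\<dots> \<le> act P x i l" unfolding act_def by (rule sum_mono) simp
    also have "\<dots> \<le> act P x i j - P (x j)" using act_Suc[of i l P x] l by simp
    also have "\<dots> \<le> (x i)\<^sup>2 + (x j)\<^sup>2"
      using c zero_le_power2[of "x i"] zero_le_power2[of "x j"] by linarith
    finally show ?thesis using s2_pos by (simp add: field_simps)
  qed
  have "(x n)\<^sup>2 \<le> (1 / s\<^sup>2 / (1 + 1 / s\<^sup>2)) ^ w * (\<Sum>k=p..q. (x k)\<^sup>2) + 0"
    by (rule depth_decay[OF _ _ _ H n]) (use s2_pos in auto)
  moreover have "1 / s\<^sup>2 / (1 + 1 / s\<^sup>2) = 1 / (1 + s\<^sup>2)" using s2_pos by (simp add: field_simps)
  moreover have "(\<Sum>k=p..q. (x k)\<^sup>2) \<le> real (card {p..q}) * 1"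
  proof (rule sum_bounded_above)
    fix k assume "k \<in> {p..q}"
    then have "\<bar>x k\<bar> \<le> 1" using box[of k] d by auto
    then show "(x k)\<^sup>2 \<le> 1" by (simp add: abs_square_le_1)
  qed
  then have "(1 / (1 + s\<^sup>2)) ^ w * (\<Sum>k=p..q. (x k)\<^sup>2) \<le> (1 / (1 + s\<^sup>2)) ^ w * real (q - p + 1)"
    using n by (intro mult_left_mono zero_le_power) (auto simp: add_nonneg_nonneg Suc_diff_le)
  ultimately show ?thesis by simp
qed

text \<open>Prepend a jump from 0 to \<open>x a\<close>.\<close>

lemma U_le_enter:
  assumes "a \<le> n" "x n = d" "(x a)\<^sup>2 \<le> \<theta>"
  shows "U d \<le> 3/2 * \<theta> + act V x a n"
proof -
  let ?z = "\<lambda>i. if i = 0 then 0 else x (i + a - 1)"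
  have "U d \<le> act V ?z 0 (Suc (n - a))" using assms by (intro U_le) auto
  also have "\<dots> = (x a)\<^sup>2 / 2 + V (x a) + act V ?z 1 (Suc (n - a))"
    using act_head[of 0 "Suc (n - a)" V ?z] by simp
  also have "act V ?z 1 (Suc (n - a)) = act V (\<lambda>i. ?z (i + 1)) 0 (n - a)"
    using act_shift[of V ?z 1 0 "n - a"] by simp
  also have "\<dots> = act V (\<lambda>i. x (i + a)) 0 (n - a)" by simp
  also have "\<dots> = act V x a n" using act_shift[of V x a 0 "n - a"] assms by simp
  finally show ?thesis using assms V_le_sq[of "x a"] by linarith
qed

text \<open>Reflect and reverse the tail and prepend a jump from 0 to \<open>1 - x b\<close>.
  Reversal trades the potential at \<open>x b\<close> for the one at \<open>d\<close>, which the
  definition of \<open>E\<close> subtracts again.\<close>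

lemma U_le_exit:
  assumes "n \<le> b" "x n = d" "(x b - 1)\<^sup>2 \<le> \<theta>"
  shows "U (1 - d) \<le> \<theta> / 2 + act V x n b + V d"
proof -
  let ?z = "\<lambda>i. if i = 0 then 0 else 1 - x (b + 1 - i)"
  let ?y = "\<lambda>i. x (i + n) - 1"
  have "U (1 - d) \<le> act V ?z 0 (Suc (b - n))" using assms by (intro U_le) auto
  also have "\<dots> = (1 - x b)\<^sup>2 / 2 + V (1 - x b) + act V ?z 1 (Suc (b - n))"
    using act_head[of 0 "Suc (b - n)" V ?z] by simp
  also have "act V ?z 1 (Suc (b - n)) = act V (\<lambda>i. ?z (i + 1)) 0 (b - n)"
    using act_shift[of V ?z 1 0 "b - n"] by simp
  also have "\<dots> = act V (\<lambda>i. - ?y (b - n - i)) 0 (b - n)"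
    by (rule act_cong) (use assms in auto)
  also have "\<dots> = act (\<lambda>u. V (- u)) ?y 0 (b - n) + V (- ?y 0) - V (- ?y (b - n))"
    using act_reverse[of V ?y "b - n"] by simp
  also have "act (\<lambda>u. V (- u)) ?y 0 (b - n) = act V (\<lambda>i. x (i + n)) 0 (b - n)"
    by (rule act_eqI) (auto simp: V_refl)
  also have "\<dots> = act V x n b" using act_shift[of V x n 0 "b - n"] assms by simp
  finally show ?thesis using assms by (simp add: V_refl power2_commute)
qed

text \<open>The competitor jumps to 0, waits, follows a short path to \<open>h\<close>, continues
  with a reversed short path to 1, waits and jumps to \<open>x b\<close>. It changes sides of
  \<open>d\<close> exactly after time \<open>\<kappa>\<close>, as the boxes demand.\<close>

lemma kink_path:
  assumes aN: "a + N < \<kappa>" and Nb: "\<kappa> + N + 2 < b"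
    and xa: "(x a)\<^sup>2 \<le> \<theta>" and xb: "(x b - 1)\<^sup>2 \<le> \<theta>"
  shows "\<exists>y. y a = x a \<and> y b = x b \<and> (\<forall>n. a < n \<longrightarrow> n \<le> \<kappa> \<longrightarrow> 0 \<le> y n \<and> y n \<le> d) \<and>
    (\<forall>n. \<kappa> < n \<longrightarrow> n < b \<longrightarrow> d \<le> y n \<and> y n \<le> 1) \<and>
    act P y a b \<le> E d + 2 * \<theta> + 2 * short_err w + 3 * tol + 2 * N * (\<eta> * \<beta>)"
proof -
  \<comment> \<open>The gap of width s/50 before \<open>h\<close> is centred at \<open>d\<close>, so
    every point of the path keeps distance at least s/100 from the bump.\<close>
  define h where "h = d + s/100"
  have h: "3/8 \<le> h" "h \<le> 5/8" using d s by (auto simp: h_def)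
  obtain z1 where z1: "z1 0 = 0" "z1 N = h" "\<forall>i<N. 0 \<le> z1 i \<and> z1 i \<le> h - s/50"
      "act V z1 0 N \<le> U h + short_err w + tol"
    using short_gap_path_exact[of h tol N w] h s tol N by auto
  obtain z2 where z2: "z2 0 = 0" "z2 N = 1 - h" "\<forall>i<N. 0 \<le> z2 i \<and> z2 i < 1 - h"
      "act V z2 0 N \<le> U (1 - h) + short_err w + tol"
    using short_path_exact[of "1 - h" tol N w] h s tol N by auto
  have z2le: "0 \<le> z2 i \<and> z2 i \<le> 1 - h" if "i \<le> N" for i
  proof (cases "i = N")
    case True
    then show ?thesis using z2(2) h by simp
  next
    case False
    then show ?thesis using z2(3) that by (simp add: less_imp_le)
  qed
  define A where "A = Suc \<kappa> - N"
  define B where "B = Suc \<kappa> + N"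
  have AB: "a < A" "A + N = Suc \<kappa>" "Suc \<kappa> + N = B" "B + 1 < b" using aN Nb by (auto simp: A_def B_def)
  obtain b' where b': "b = Suc b'" "B \<le> b'" using AB by (cases b) auto
  \<comment> \<open>Truncated subtraction supplies the waiting phases: before \<open>A\<close> it
    gives \<open>z1 0 = 0\<close>, after \<open>B\<close> it gives
    \<open>1 - z2 0 = 1\<close>.\<close>
  define y where "y k = (if k \<le> a then x k else if k \<le> \<kappa> then z1 (k - A)
     else if k < b then 1 - z2 (B - k) else x k)" for k
  have off: "P (y k) \<le> V (y k) + \<eta> * \<beta>" if "A \<le> k" "k \<le> B" for k
  proof (cases "k \<le> \<kappa>")
    case True
    then have "k - A < N" using that AB by auto
    then have "0 \<le> z1 (k - A)" "z1 (k - A) \<le> h - s/50" using z1 by auto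
    then show ?thesis using True that AB d s by (simp add: y_def h_def P_off)
  next
    case False
    have "B - k \<le> N" using False AB by linarith
    note zz = z2le[OF this]
    then show ?thesis using False that AB d s by (simp add: y_def h_def P_off)
  qed
  have "act P y a A = (x a)\<^sup>2 / 2"
  proof -
    have "act P y (Suc a) A = act P (\<lambda>k. 0) (Suc a) A"
    proof (rule act_cong)
      fix i assume "Suc a \<le> i" "i \<le> A"
      then show "y i = 0" using AB z1 N by (auto simp: y_def)
    qed
    moreover have "act P (\<lambda>k. 0) (Suc a) A = 0" by (simp add: act_def)
    moreover have "y (Suc a) = 0" using AB z1 N by (auto simp: y_def)
    ultimately show ?thesis using act_head[of a A P y] AB by (simp add: y_def)
  qed
  moreover have "act P y A (Suc \<kappa>) \<le> act V z1 0 N + N * (\<eta> * \<beta>)"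
  proof -
    have "act P y A (Suc \<kappa>) \<le> act (\<lambda>u. V u + \<eta> * \<beta>) y A (Suc \<kappa>)"
      by (rule act_mono_pot) (use off AB in auto)
    also have "\<dots> = act V y A (Suc \<kappa>) + N * (\<eta> * \<beta>)"
    proof -
      have "Suc \<kappa> - A = N" using AB by linarith
      then show ?thesis by (simp only: act_add_const)
    qed
    also have "act V y A (Suc \<kappa>) = act V (\<lambda>i. y (i + A)) 0 N"
      using act_shift[of V y A 0 N] AB by (simp add: add.commute)
    also have "\<dots> = act V z1 0 N"
    proof (rule act_cong)
      fix i assume "0 \<le> i" "i \<le> N"
      show "y (i + A) = z1 i"
      proof (cases "i = N")
        case True
        then have "i + A = Suc \<kappa>" using AB by linarith
        moreover have "B - Suc \<kappa> = N" using AB by linarith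
        then have "y (Suc \<kappa>) = h" using aN AB z2(2) by (simp add: y_def)
        ultimately show ?thesis using True z1(2) by simp
      next
        case False
        then have "i + A \<le> \<kappa>" "a < i + A" using \<open>i \<le> N\<close> AB by linarith+
        then show ?thesis by (simp add: y_def)
      qed
    qed
    finally show ?thesis by simp
  qed
  moreover have "act P y (Suc \<kappa>) B \<le> act V z2 0 N - V h + N * (\<eta> * \<beta>)"
  proof -
    let ?z = "\<lambda>i. z2 i - 1"
    have "act P y (Suc \<kappa>) B \<le> act (\<lambda>u. V u + \<eta> * \<beta>) y (Suc \<kappa>) B"
      by (rule act_mono_pot) (use off AB in auto)
    also have "\<dots> = act V y (Suc \<kappa>) B + N * (\<eta> * \<beta>)"
    proof -
      have "B - Suc \<kappa> = N" using AB by linarith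
      then show ?thesis by (simp only: act_add_const)
    qed
    also have "act V y (Suc \<kappa>) B = act V (\<lambda>i. y (i + Suc \<kappa>)) 0 N"
      using act_shift[of V y "Suc \<kappa>" 0 N] AB by (simp add: add.commute)
    also have "\<dots> = act V (\<lambda>i. - ?z (N - i)) 0 N"
      by (rule act_cong) (use AB in \<open>auto simp: y_def B_def\<close>)
    also have "\<dots> = act (\<lambda>u. V (- u)) ?z 0 N + V (- ?z 0) - V (- ?z N)"
      using act_reverse[of V ?z N] by simp
    also have "act (\<lambda>u. V (- u)) ?z 0 N = act V z2 0 N"
      by (rule act_eqI) (auto simp: V_refl)
    finally show ?thesis using z2 V_refl[of 0] by simp
  qed
  moreover have "act P y B b \<le> 3/2 * \<theta>"
  proof -
    have "act P y B b' = act P (\<lambda>k. 1) B b'"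
    proof (rule act_cong)
      fix i assume "B \<le> i" "i \<le> b'"
      then show "y i = 1" using AB b' z2 by (auto simp: y_def)
    qed
    moreover have "act P (\<lambda>k. 1) B b' = 0" by (simp add: act_def)
    moreover have "y b' = 1" using AB b' z2 by (auto simp: y_def)
    moreover have "y b = x b" using AB by (auto simp: y_def)
    ultimately have "act P y B b = (x b - 1)\<^sup>2 / 2 + P (x b)"
      using act_Suc[of B b' P y] b' by simp
    moreover have "P (x b) \<le> (x b - 1)\<^sup>2" using P_le_sq[of "x b - 1"] P_per[of "x b - 1"] by simp
    ultimately show ?thesis using xb by linarith
  qed
  moreover have "act P y a b = act P y a A + act P y A (Suc \<kappa>) + act P y (Suc \<kappa>) B + act P y B b"
    using act_split[of a B b P y] act_split[of a "Suc \<kappa>" B P y] act_split[of a A "Suc \<kappa>" P y] AB by simp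
  moreover have "E h \<le> E d + tol" by (rule near_max[OF h])
  ultimately have "act P y a b \<le> E d + 2 * \<theta> + 2 * short_err w + 3 * tol + 2 * N * (\<eta> * \<beta>)"
    using z1(4) z2(4) xa unfolding E_def by linarith
  moreover have "0 \<le> y n \<and> y n \<le> d" if "a < n" "n \<le> \<kappa>" for n
  proof -
    have "n - A < N" using that AB N by linarith
    then have "0 \<le> z1 (n - A)" "z1 (n - A) \<le> h - s/50" using z1 by auto
    then show ?thesis using that s by (simp add: y_def h_def)
  qed
  moreover have "d \<le> y n \<and> y n \<le> 1" if "\<kappa> < n" "n < b" for n
  proof -
    have "B - n \<le> N" using that AB by linarith
    from z2le[OF this] show ?thesis using that aN s by (simp add: y_def h_def)
  qed
  moreover have "y a = x a" "y b = x b" using AB by (auto simp: y_def)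
  ultimately show ?thesis by blast
qed

lemma d_ge: "P d \<ge> s\<^sup>2"
  using V_mid[of d] P_ge[of d] d by linarith

text \<open>One altered end jump loses at most \<open>\<theta> / 2\<close>, while leaving the wall
  at time \<open>n\<close> gains \<open>s\<^sup>2\<close>.\<close>

lemma act_gain:
  assumes n: "a < n" "n \<le> b"
    and le: "\<And>i. a \<le> i \<Longrightarrow> i < b \<Longrightarrow> (y (Suc i) - y i)\<^sup>2 \<le> (x (Suc i) - x i)\<^sup>2 + (if i = e then \<theta> else 0)"
    and e: "a \<le> e" "e < b"
    and pot: "\<And>i. a < i \<Longrightarrow> i \<le> b \<Longrightarrow> P (y i) \<le> P (x i)" and at_n: "P (y n) \<le> P (x n) - s\<^sup>2"
    and \<theta>0: "0 \<le> \<theta>"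
  shows "act P y a b < act P x a b"
proof -
  have "act P y a b \<le> (\<Sum>i=a..<b. ((x (Suc i) - x i)\<^sup>2 / 2 + P (x (Suc i))) + ((if i = e then \<theta> / 2 else 0) - (if i = n - 1 then s\<^sup>2 else 0)))"
    unfolding act_def
  proof (rule sum_mono)
    fix i assume i: "i \<in> {a..<b}"
    have "P (y (Suc i)) \<le> P (x (Suc i)) - (if i = n - 1 then s\<^sup>2 else 0)"
      using pot[of "Suc i"] at_n i n by auto
    moreover have "(y (Suc i) - y i)\<^sup>2 / 2 \<le> (x (Suc i) - x i)\<^sup>2 / 2 + (if i = e then \<theta> / 2 else 0)"
      using le[of i] i by (auto split: if_splits)
    ultimately show "(y (Suc i) - y i)\<^sup>2 / 2 + P (y (Suc i)) \<le> ((x (Suc i) - x i)\<^sup>2 / 2 + P (x (Suc i))) + ((if i = e then \<theta> / 2 else 0) - (if i = n - 1 then s\<^sup>2 else 0))"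
      by linarith
  qed
  also have "\<dots> = act P x a b + (\<theta> / 2 - s\<^sup>2)"
  proof -
    have "n - 1 \<in> {a..<b}" "e \<in> {a..<b}" using n e by auto
    then show ?thesis unfolding act_def sum.distrib sum_subtractf by (simp add: sum.delta)
  qed
  finally show ?thesis using \<theta> \<theta>0 s2_pos by linarith
qed

text \<open>Cutting at time \<open>n\<close> gives a path into \<open>d\<close> and one out of it,
  together worth \<open>E d\<close> up to end jumps; on top of that the bump is paid at
  \<open>d\<close>.\<close>

lemma peak_cost:
  assumes n: "a < n" "n \<le> b" "x n = d" and xa: "(x a)\<^sup>2 \<le> \<theta>" and xb: "(x b - 1)\<^sup>2 \<le> \<theta>"
  shows "E d + \<eta> / 2 \<le> act P x a b + 2 * \<theta>"
proof -
  have "E d \<le> act V x a b + 2 * \<theta>"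
    using U_le_enter[of a n x] U_le_exit[of n b x] n xa xb act_split[of a n b V x]
    unfolding E_def by simp
  moreover have "act P x a b - act V x a b \<ge> P d - V d"
  proof -
    have "act P x a b - act V x a b = (\<Sum>i=a..<b. P (x (Suc i)) - V (x (Suc i)))"
      by (simp add: act_def sum_subtractf[symmetric])
    moreover have "P (x (Suc (n - 1))) - V (x (Suc (n - 1))) \<le> \<dots>"
      by (rule member_le_sum) (use n P_ge in auto)
    ultimately show ?thesis using n by simp
  qed
  ultimately show ?thesis using P_peak by linarith
qed

text \<open>The common wall \<open>d\<close> is excluded by comparison with
  \<open>kink_path\<close>. The outer walls \<open>d - 1\<close> and \<open>d + 1\<close> are
  excluded by truncating at 0 and at 1, which saves the potential there at the price of one end
  jump.\<close>

lemma cell_interior: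
  assumes aN: "a + N < \<kappa>" and Nb: "\<kappa> + N + 2 < b"
    and xa: "(x a)\<^sup>2 \<le> \<theta>" and xb: "(x b - 1)\<^sup>2 \<le> \<theta>"
    and box0: "\<And>n. a \<le> n \<Longrightarrow> n \<le> \<kappa> \<Longrightarrow> d - 1 \<le> x n \<and> x n \<le> d"
    and box1: "\<And>n. \<kappa> < n \<Longrightarrow> n \<le> b \<Longrightarrow> d \<le> x n \<and> x n \<le> d + 1"
    and opt: "\<And>y. y a = x a \<Longrightarrow> y b = x b \<Longrightarrow> (\<And>n. a \<le> n \<Longrightarrow> n \<le> \<kappa> \<Longrightarrow> d - 1 \<le> y n \<and> y n \<le> d) \<Longrightarrow>
      (\<And>n. \<kappa> < n \<Longrightarrow> n \<le> b \<Longrightarrow> d \<le> y n \<and> y n \<le> d + 1) \<Longrightarrow> act P x a b \<le> act P y a b"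
    and n: "a < n" "n < b"
  shows "n \<le> \<kappa> \<Longrightarrow> d - 1 < x n \<and> x n < d" and "\<kappa> < n \<Longrightarrow> d < x n \<and> x n < d + 1"
proof -
  have \<theta>0: "0 \<le> \<theta>" using xa zero_le_power2[of "x a"] by linarith
  have not_peak: "x n \<noteq> d"
  proof
    assume "x n = d"
    then have lower: "E d + \<eta> / 2 \<le> act P x a b + 2 * \<theta>" using peak_cost n xa xb by simp
    obtain y where y: "y a = x a" "y b = x b" "\<forall>n. a < n \<longrightarrow> n \<le> \<kappa> \<longrightarrow> 0 \<le> y n \<and> y n \<le> d"
        "\<forall>n. \<kappa> < n \<longrightarrow> n < b \<longrightarrow> d \<le> y n \<and> y n \<le> 1"
        "act P y a b \<le> E d + 2 * \<theta> + 2 * short_err w + 3 * tol + 2 * N * (\<eta> * \<beta>)"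
      using kink_path[OF aN Nb xa xb] by blast
    have "act P x a b \<le> act P y a b"
    proof (rule opt[OF y(1,2)])
      fix k assume k: "a \<le> k" "k \<le> \<kappa>"
      show "d - 1 \<le> y k \<and> y k \<le> d"
      proof (cases "k = a")
        case True
        then show ?thesis using y(1) box0[of a] k by simp
      next
        case False
        then have "0 \<le> y k \<and> y k \<le> d" using y(3) k by simp
        then show ?thesis using d by linarith
      qed
    next
      fix k assume k: "\<kappa> < k" "k \<le> b"
      show "d \<le> y k \<and> y k \<le> d + 1"
      proof (cases "k = b")
        case True
        then show ?thesis using y(2) box1[of b] k by simp
      next
        case False
        then have "d \<le> y k \<and> y k \<le> 1" using y(4) k by simp
        then show ?thesis using d by linarith
      qed
    qed
    then show False using lower y(5) small by linarith
  qed
  show "d - 1 < x n \<and> x n < d" if nk: "n \<le> \<kappa>"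
  proof -
    have "x n \<noteq> d - 1"
    proof
      assume xn: "x n = d - 1"
      define y where "y k = (if a < k \<and> k \<le> \<kappa> then max (x k) 0 else x k)" for k
      have "act P y a b < act P x a b"
      proof (rule act_gain[where e = a and n = n])
        fix i assume i: "a \<le> i" "i < b"
        show "(y (Suc i) - y i)\<^sup>2 \<le> (x (Suc i) - x i)\<^sup>2 + (if i = a then \<theta> else 0)"
        proof (cases "i = a")
          case True
          have y1: "y (Suc a) = max (x (Suc a)) 0" "y a = x a" using aN by (auto simp: y_def)
          show ?thesis
          proof (cases "x (Suc a) \<ge> 0")
            case True
            then show ?thesis using y1 \<open>i = a\<close> \<theta>0 by (simp add: max_def)
          next
            case False
            then have "(y (Suc i) - y i)\<^sup>2 = (x a)\<^sup>2" using y1 \<open>i = a\<close> by (simp add: max_def)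
            then have "(y (Suc i) - y i)\<^sup>2 \<le> \<theta>" using xa by simp
            then show ?thesis using \<open>i = a\<close> by (simp add: add_increasing)
          qed
        next
          case False
          have "\<bar>y (Suc i) - y i\<bar> \<le> \<bar>x (Suc i) - x i\<bar>"
          proof (cases "i = \<kappa>")
            case True
            then have "x i \<le> d" "d \<le> x (Suc i)" using box0[of i] box1[of "Suc i"] i by auto
            moreover have "y (Suc i) = x (Suc i)" "y i = max (x i) 0" using True aN by (auto simp: y_def)
            ultimately show ?thesis using d by (auto simp: max_def abs_if)
          next
            case False
            then show ?thesis using \<open>i \<noteq> a\<close> i by (auto simp: y_def max_def abs_if)
          qed
          then have "(y (Suc i) - y i)\<^sup>2 \<le> (x (Suc i) - x i)\<^sup>2" by (rule abs_le_square_iff[THEN iffD1])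
          then show ?thesis using False by simp
        qed
      next
        fix i show "P (y i) \<le> P (x i)" by (auto simp: y_def max_def P_nonneg)
      next
        have "P (x n) = P d" using P_per[of "d - 1"] xn by simp
        moreover have "P (y n) = 0" using xn n nk d by (simp add: y_def max_def)
        ultimately show "P (y n) \<le> P (x n) - s\<^sup>2" using d_ge by simp
      qed (use n aN \<theta>0 in auto)
      moreover have "act P x a b \<le> act P y a b"
      proof (rule opt)
        show "y a = x a" by (simp add: y_def)
        show "y b = x b" using Nb by (simp add: y_def)
        show "d - 1 \<le> y k \<and> y k \<le> d" if "a \<le> k" "k \<le> \<kappa>" for k
          using box0[OF that] d by (auto simp: y_def max_def)
        show "d \<le> y k \<and> y k \<le> d + 1" if "\<kappa> < k" "k \<le> b" for k
          using box1[OF that] that by (auto simp: y_def)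
      qed
      ultimately show False by simp
    qed
    then show ?thesis using box0[of n] not_peak n nk by fastforce
  qed
  show "d < x n \<and> x n < d + 1" if nk: "\<kappa> < n"
  proof -
    have "x n \<noteq> d + 1"
    proof
      assume xn: "x n = d + 1"
      define y where "y k = (if \<kappa> < k \<and> k < b then min (x k) 1 else x k)" for k
      have "act P y a b < act P x a b"
      proof (rule act_gain[where e = "b - 1" and n = n])
        fix i assume i: "a \<le> i" "i < b"
        show "(y (Suc i) - y i)\<^sup>2 \<le> (x (Suc i) - x i)\<^sup>2 + (if i = b - 1 then \<theta> else 0)"
        proof (cases "i = b - 1")
          case True
          then have Si: "Suc i = b" using i by simp
          have y1: "y i = min (x i) 1" "y b = x b" using Nb Si by (auto simp: y_def)
          show ?thesis
          proof (cases "x i \<le> 1")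
            case True
            then show ?thesis using y1 Si \<theta>0 by (simp add: min_def)
          next
            case False
            then have "(y (Suc i) - y i)\<^sup>2 = (x b - 1)\<^sup>2" using y1 Si by (simp add: min_def)
            then have "(y (Suc i) - y i)\<^sup>2 \<le> \<theta>" using xb by simp
            then show ?thesis using \<open>i = b - 1\<close> by (simp add: add_increasing)
          qed
        next
          case False
          have "\<bar>y (Suc i) - y i\<bar> \<le> \<bar>x (Suc i) - x i\<bar>"
          proof (cases "i = \<kappa>")
            case True
            then have "x i \<le> d" "d \<le> x (Suc i)" using box0[of i] box1[of "Suc i"] i by auto
            moreover have "y (Suc i) = min (x (Suc i)) 1" "y i = x i" using True Nb by (auto simp: y_def)
            ultimately show ?thesis using d by (auto simp: min_def abs_if)
          next
            case False
            then show ?thesis using \<open>i \<noteq> b - 1\<close> i by (auto simp: y_def min_def abs_if)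
          qed
          then have "(y (Suc i) - y i)\<^sup>2 \<le> (x (Suc i) - x i)\<^sup>2" by (rule abs_le_square_iff[THEN iffD1])
          then show ?thesis using False by simp
        qed
      next
        fix i show "P (y i) \<le> P (x i)" by (auto simp: y_def min_def P_nonneg)
      next
        have "P (x n) = P d" using P_per[of d] xn by simp
        moreover have "P (y n) = 0" using xn n nk d by (simp add: y_def min_def)
        ultimately show "P (y n) \<le> P (x n) - s\<^sup>2" using d_ge by simp
      qed (use n aN Nb \<theta>0 in auto)
      moreover have "act P x a b \<le> act P y a b"
      proof (rule opt)
        show "y a = x a" using aN by (simp add: y_def)
        show "y b = x b" by (simp add: y_def)
        show "d - 1 \<le> y k \<and> y k \<le> d" if "a \<le> k" "k \<le> \<kappa>" for k
          using box0[OF that] that by (auto simp: y_def)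
        show "d \<le> y k \<and> y k \<le> d + 1" if "\<kappa> < k" "k \<le> b" for k
          using box1[OF that] d by (auto simp: y_def min_def)
      qed
      ultimately show False by simp
    qed
    then show ?thesis using box1[of n] not_peak n nk by fastforce
  qed
qed

end

section \<open>Constrained minimizers with prescribed jump times\<close>

lemma compact_box:
  fixes lo hi :: "nat \<Rightarrow> real"
  shows "compact {x. \<forall>n. lo n \<le> x n \<and> x n \<le> hi n}"
proof -
  have "compactin (product_topology (\<lambda>i. euclidean) UNIV) (Pi\<^sub>E UNIV (\<lambda>n. {lo n..hi n}))"
    by (subst compactin_PiE) auto
  moreover have "Pi\<^sub>E UNIV (\<lambda>n. {lo n..hi n}) = {x. \<forall>n. lo n \<le> x n \<and> x n \<le> hi n}" by auto
  ultimately show ?thesis by (simp add: euclidean_product_topology)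
qed

lemma act_minimizer:
  fixes lo hi :: "nat \<Rightarrow> real"
  assumes P: "continuous_on UNIV P" and ne: "\<And>n. lo n \<le> hi n"
  shows "\<exists>x. (\<forall>n. lo n \<le> x n \<and> x n \<le> hi n) \<and>
    (\<forall>y. (\<forall>n. lo n \<le> y n \<and> y n \<le> hi n) \<longrightarrow> act P x 0 M \<le> act P y 0 M)"
proof -
  have cP: "continuous_on UNIV (\<lambda>x :: nat \<Rightarrow> real. P (x i))" for i
    by (rule continuous_on_compose2[OF P]) auto
  have "continuous_on UNIV (\<lambda>x. act P x 0 M)"
    unfolding act_def by (intro continuous_intros cP continuous_on_product_coordinates) auto
  then have "continuous_on {x. \<forall>n. lo n \<le> x n \<and> x n \<le> hi n} (\<lambda>x. act P x 0 M)"
    by (rule continuous_on_subset) simp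
  moreover have "lo \<in> {x. \<forall>n. lo n \<le> x n \<and> x n \<le> hi n}" using ne by simp
  ultimately obtain x where "x \<in> {x. \<forall>n. lo n \<le> x n \<and> x n \<le> hi n}"
      "\<forall>y\<in>{x. \<forall>n. lo n \<le> x n \<and> x n \<le> hi n}. act P x 0 M \<le> act P y 0 M"
    using continuous_attains_inf[OF compact_box[of lo hi]] by blast
  then show ?thesis by auto
qed

text \<open>The number of jumps scheduled before time \<open>n\<close>: jump j + 1 takes place
  between the times L + jT and L + jT + 1.\<close>

definition level :: "nat \<Rightarrow> nat \<Rightarrow> nat \<Rightarrow> nat" where
  "level L T n = (LEAST j. n \<le> L + j * T)"

lemma level_eqI:
  assumes "n \<le> L + j * T" "j > 0 \<Longrightarrow> L + (j - 1) * T < n"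
  shows "level L T n = j"
  unfolding level_def
proof (rule Least_equality)
  fix i assume i: "n \<le> L + i * T"
  show "j \<le> i"
  proof (rule ccontr)
    assume "\<not> j \<le> i"
    then have "i * T \<le> (j - 1) * T" "j > 0" by (auto intro: mult_right_mono)
    then show False using assms(2) i by linarith
  qed
qed (rule assms)

lemma level_bounds:
  assumes "T > 0"
  shows "n \<le> L + level L T n * T" and "level L T n > 0 \<Longrightarrow> L + (level L T n - 1) * T < n"
proof -
  have "n \<le> L + n * T" using assms by (cases T) auto
  then show "n \<le> L + level L T n * T" unfolding level_def by (rule LeastI)
  assume "level L T n > 0"
  then have "level L T n - 1 < (LEAST j. n \<le> L + j * T)" by (simp add: level_def)
  from not_less_Least[OF this] show "L + (level L T n - 1) * T < n" by simp
qed

context bumped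
begin

lemma P_shift: "P (x - real j) = P x"
proof (induction j)
  case (Suc j)
  then show ?case using P_per[of "x - real (Suc j)"] by (simp add: algebra_simps)
qed simp

lemma act_translate: "act P (\<lambda>k. x k - real j) a b = act P x a b"
  by (rule act_eqI) (simp_all add: P_shift)

text \<open>A minimizer in the boxes prescribed by \<open>level\<close> is near an integer in the
  middle of each block. Between consecutive such midpoints it satisfies
  \<open>cell_interior\<close>, so no constraint is active and the Euler-Lagrange equation
  holds.\<close>

theorem kink_orbit:
  assumes P': "\<And>x. (P has_field_derivative P' x) (at x)"
    and T: "T = 4 * w + 10" and \<theta>T: "(1 / (1 + s\<^sup>2)) ^ w * real T \<le> \<theta>" and L: "T \<le> L" and K: "K > 0"
  shows "\<exists>x. x 0 = 0 \<and> x L \<le> 1 \<and> x (L + K * T) = real K \<and>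
    (\<forall>n. 0 < n \<longrightarrow> n < L + K * T \<longrightarrow> x (n + 1) - 2 * x n + x (n - 1) = P' (x n))"
proof -
  have T0: "T > 0" using T by simp
  define M where "M = L + K * T"
  define lev where "lev = level L T"
  \<comment> \<open>Degenerate intervals fix both end points and freeze the irrelevant coordinates
    beyond \<open>M\<close>.\<close>
  define lo where "lo n = (if n = 0 \<or> n > M then 0 else if n = M then real K else real (lev n) - 1 + d)" for n
  define hi where "hi n = (if n = 0 \<or> n > M then 0 else if n = M then real K else real (lev n) + d)" for n
  have M: "L + T \<le> M" using K by (cases K) (auto simp: M_def)
  have "continuous_on UNIV P"
    using P' by (meson DERIV_isCont continuous_at_imp_continuous_on)
  then obtain x where box: "\<And>n. lo n \<le> x n \<and> x n \<le> hi n"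
      and opt: "\<And>y. (\<And>n. lo n \<le> y n \<and> y n \<le> hi n) \<Longrightarrow> act P x 0 M \<le> act P y 0 M"
    using act_minimizer[of P lo hi M] by (fastforce simp: lo_def hi_def)
  have lopt: "act P x a b \<le> act P y a b"
    if "a \<le> b" "b \<le> M" and eq: "y a = x a" "y b = x b"
      and ybox: "\<And>n. a < n \<Longrightarrow> n < b \<Longrightarrow> lo n \<le> y n \<and> y n \<le> hi n" for y a b
  proof -
    define u where "u n = (if a < n \<and> n < b then y n else x n)" for n
    have "act P x 0 M \<le> act P u 0 M"
      by (rule opt) (use box ybox in \<open>auto simp: u_def\<close>)
    moreover have "act P u 0 a = act P x 0 a" "act P u b M = act P x b M"
      by (rule act_cong; auto simp: u_def)+
    moreover have "act P u a b = act P y a b" by (rule act_cong) (use eq in \<open>auto simp: u_def\<close>)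
    moreover have "act P z 0 M = act P z 0 a + act P z a b + act P z b M" for z
      using act_split[of 0 b M P z] act_split[of 0 a b P z] that by simp
    ultimately show ?thesis by simp
  qed
  have x0: "x 0 = 0" using box[of 0] by (simp add: lo_def hi_def)
  have xM: "x M = real K" using box[of M] M T0 by (simp add: lo_def hi_def split: if_splits)
  have in_box: "real (lev n) - 1 + d \<le> x n \<and> x n \<le> real (lev n) + d" if "0 < n" "n < M" for n
    using box[of n] that by (auto simp: lo_def hi_def)
  have levM: "lev M = K"
    unfolding lev_def
  proof (rule level_eqI)
    show "M \<le> L + K * T" by (simp add: M_def)
    show "L + (K - 1) * T < M" using K T0 by (cases K) (auto simp: M_def)
  qed
  have lev0: "lev n = 0" if "n \<le> L" for n unfolding lev_def by (rule level_eqI) (use that in auto)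
  have levj: "lev n = j" if "L + (j - 1) * T < n" "n \<le> L + j * T" for n j
    unfolding lev_def by (rule level_eqI) (use that in auto)
  have in_box': "real (lev n) - 1 + d \<le> x n \<and> x n \<le> real (lev n) + d" if "n \<le> M" for n
    using in_box[of n] that x0 xM levM lev0[of 0] d by (cases "n = 0"; cases "n = M") auto
  \<comment> \<open>Cell ends: the two end points of the path and the block midpoints. Half a block,
    2w + 5, exceeds N + 2 = 2w + 3 and so leaves room for the competitor of
    \<open>kink_path\<close>.\<close>
  define c where "c j = (if j = 0 then 0 else if j < K then L + (j - 1) * T + (2 * w + 5) else M)" for j
  have KT: "L + j * T \<le> M" if "j \<le> K" for j using that by (simp add: M_def mult_right_mono)
  have Suc_T: "L + j * T = L + (j - 1) * T + T" if "j > 0" for j using that by (cases j) auto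
  have near: "(x (c j) - real j)\<^sup>2 \<le> \<theta>" if "j \<le> K" for j
  proof -
    have \<theta>0: "0 \<le> \<theta>" using \<theta>T by (rule order_trans[rotated]) (simp add: add_nonneg_nonneg)
    consider "j = 0" | "j = K" | "0 < j" "j < K" using \<open>j \<le> K\<close> by linarith
    then show ?thesis
    proof cases
      case 1
      then show ?thesis using x0 \<theta>0 by (simp add: c_def)
    next
      case 2
      then show ?thesis using xM \<theta>0 K by (simp add: c_def)
    next
      case 3
      define p where "p = Suc (L + (j - 1) * T)"
      define q where "q = L + j * T"
      have qp: "q = p + (T - 1)" using Suc_T[OF 3(1)] T0 by (simp add: p_def q_def)
      have "L + Suc j * T \<le> M" using 3 by (intro KT) simp
      then have qM: "q < M" using T0 by (simp add: q_def)
      have levpq: "lev n = j" if "p \<le> n" "n \<le> q" for n by (rule levj) (use that in \<open>auto simp: p_def q_def\<close>)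
      let ?x = "\<lambda>k. x k - real j"
      have "(?x (c j))\<^sup>2 \<le> (1 / (1 + s\<^sup>2)) ^ w * real (q - p + 1)"
      proof (rule block_decay[where x = ?x and n = "c j" and p = p and q = q])
        fix n assume n: "p \<le> n" "n \<le> q"
        show "d - 1 \<le> ?x n \<and> ?x n \<le> d" using in_box[of n] levpq[OF n] n qM by (auto simp: p_def)
      next
        fix i k assume ik: "p \<le> i" "i < k" "k \<le> q"
        have "act P x i k \<le> act P (\<lambda>n. if i < n \<and> n < k then real j else x n) i k"
        proof (rule lopt)
          fix n assume n: "i < n" "n < k"
          then have "lev n = j" by (intro levpq) (use ik in auto)
          then show "lo n \<le> (if i < n \<and> n < k then real j else x n) \<and> (if i < n \<and> n < k then real j else x n) \<le> hi n"
            using n ik qM d by (auto simp: lo_def hi_def)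
        qed (use ik qM in auto)
        also have "\<dots> = act P (\<lambda>n. (if i < n \<and> n < k then real j else x n) - real j) i k"
          by (rule act_translate[symmetric])
        also have "\<dots> = act P (\<lambda>n. if i < n \<and> n < k then 0 else ?x n) i k" by (rule act_cong) auto
        finally show "act P ?x i k \<le> act P (\<lambda>n. if i < n \<and> n < k then 0 else ?x n) i k"
          by (simp add: act_translate)
      next
        show "p + w \<le> c j" using 3 by (simp add: c_def p_def)
        show "c j + w \<le> q" using 3 T Suc_T[OF 3(1)] by (simp add: c_def q_def)
      qed
      also have "real (q - p + 1) = real T" using qp T0 by simp
      finally show ?thesis using \<theta>T by linarith
    qed
  qed
  have interior: "real (lev n) - 1 + d < x n \<and> x n < real (lev n) + d" if n: "0 < n" "n < M" for n
  proof -
    have cell: ?thesis if j: "j < K" and cn: "c j < n" "n < c (Suc j)" for j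
    proof -
      define \<kappa> where "\<kappa> = L + j * T"
      have aN: "c j + N < \<kappa>" using j N T L Suc_T[of j] by (auto simp: c_def \<kappa>_def)
      have Nb: "\<kappa> + N + 2 < c (Suc j)"
      proof (cases "Suc j < K")
        case True
        then show ?thesis using N by (simp add: c_def \<kappa>_def)
      next
        case False
        then have "K = Suc j" using j by simp
        then show ?thesis using N T by (simp add: c_def \<kappa>_def M_def)
      qed
      have bM: "c (Suc j) \<le> M" using KT[of "Suc j"] j T by (auto simp: c_def)
      have b\<kappa>: "c (Suc j) \<le> \<kappa> + T"
      proof (cases "Suc j < K")
        case True
        then show ?thesis using T by (simp add: c_def \<kappa>_def)
      next
        case False
        then have "K = Suc j" using j by simp
        then show ?thesis by (simp add: c_def \<kappa>_def M_def)
      qed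
      have lev_lo: "lev k = j" if "c j \<le> k" "k \<le> \<kappa>" for k
      proof (cases "j = 0")
        case True
        then show ?thesis using lev0[of k] that by (simp add: \<kappa>_def)
      next
        case False
        then show ?thesis using that j by (intro levj) (auto simp: c_def \<kappa>_def)
      qed
      have lev_hi: "lev k = Suc j" if "\<kappa> < k" "k \<le> c (Suc j)" for k
        by (rule levj) (use that b\<kappa> in \<open>auto simp: \<kappa>_def\<close>)
      let ?x = "\<lambda>k. x k - real j"
      have b0: "d - 1 \<le> ?x k \<and> ?x k \<le> d" if "c j \<le> k" "k \<le> \<kappa>" for k
        using in_box'[of k] lev_lo[OF that] that Nb bM by auto
      have b1: "d \<le> ?x k \<and> ?x k \<le> d + 1" if "\<kappa> < k" "k \<le> c (Suc j)" for k
        using in_box'[of k] lev_hi[OF that] that bM by auto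
      have o: "act P ?x (c j) (c (Suc j)) \<le> act P y (c j) (c (Suc j))"
        if y: "y (c j) = ?x (c j)" "y (c (Suc j)) = ?x (c (Suc j))"
          "\<And>n. c j \<le> n \<Longrightarrow> n \<le> \<kappa> \<Longrightarrow> d - 1 \<le> y n \<and> y n \<le> d"
          "\<And>n. \<kappa> < n \<Longrightarrow> n \<le> c (Suc j) \<Longrightarrow> d \<le> y n \<and> y n \<le> d + 1" for y
      proof -
        have "act P x (c j) (c (Suc j)) \<le> act P (\<lambda>k. y k + real j) (c j) (c (Suc j))"
        proof (rule lopt)
          fix k assume k: "c j < k" "k < c (Suc j)"
          show "lo k \<le> y k + real j \<and> y k + real j \<le> hi k"
          proof (cases "k \<le> \<kappa>")
            case True
            then show ?thesis using y(3)[of k] lev_lo[of k] k bM by (auto simp: lo_def hi_def)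
          next
            case False
            then show ?thesis using y(4)[of k] lev_hi[of k] k bM by (auto simp: lo_def hi_def)
          qed
        qed (use y bM aN Nb in auto)
        also have "\<dots> = act P y (c j) (c (Suc j))"
          using act_translate[of "\<lambda>k. y k + real j" j] by simp
        finally show ?thesis by (simp add: act_translate)
      qed
      have n1: "(?x (c j))\<^sup>2 \<le> \<theta>" using near[of j] j by simp
      have n2: "(?x (c (Suc j)) - 1)\<^sup>2 \<le> \<theta>" using near[of "Suc j"] j by (simp add: algebra_simps)
      note ci = cell_interior[where x = ?x and a = "c j" and b = "c (Suc j)" and \<kappa> = \<kappa> and n = n, OF aN Nb n1 n2]
      show ?thesis
      proof (cases "n \<le> \<kappa>")
        case True
        have "d - 1 < ?x n \<and> ?x n < d"
        proof (rule ci(1))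
          fix y assume "y (c j) = ?x (c j)" "y (c (Suc j)) = ?x (c (Suc j))"
            "\<And>n. c j \<le> n \<Longrightarrow> n \<le> \<kappa> \<Longrightarrow> d - 1 \<le> y n \<and> y n \<le> d"
            "\<And>n. \<kappa> < n \<Longrightarrow> n \<le> c (Suc j) \<Longrightarrow> d \<le> y n \<and> y n \<le> d + 1"
          then show "act P ?x (c j) (c (Suc j)) \<le> act P y (c j) (c (Suc j))" by (rule o)
        qed (fact b0 b1 cn True)+
        then show ?thesis using True lev_lo[of n] cn by auto
      next
        case False
        then have k: "\<kappa> < n" by simp
        have "d < ?x n \<and> ?x n < d + 1"
        proof (rule ci(2))
          fix y assume "y (c j) = ?x (c j)" "y (c (Suc j)) = ?x (c (Suc j))"
            "\<And>n. c j \<le> n \<Longrightarrow> n \<le> \<kappa> \<Longrightarrow> d - 1 \<le> y n \<and> y n \<le> d"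
            "\<And>n. \<kappa> < n \<Longrightarrow> n \<le> c (Suc j) \<Longrightarrow> d \<le> y n \<and> y n \<le> d + 1"
          then show "act P ?x (c j) (c (Suc j)) \<le> act P y (c j) (c (Suc j))" by (rule o)
        qed (fact b0 b1 cn k)+
        then show ?thesis using k lev_hi[of n] cn by auto
      qed
    qed
    define j where "j = lev n"
    have jn: "n \<le> L + j * T" "j > 0 \<Longrightarrow> L + (j - 1) * T < n"
      using level_bounds[OF T0] unfolding j_def lev_def by auto
    have jK: "j \<le> K"
    proof (rule ccontr)
      assume "\<not> j \<le> K"
      then have "K * T \<le> (j - 1) * T" "j > 0" by (auto intro: mult_right_mono)
      then show False using jn(2) n unfolding M_def by linarith
    qed
    consider "0 < j" "n < c j" | "0 < j" "n = c j" | "c j < n" | "j = 0" using n by (metis linorder_neqE_nat neq0_conv)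
    then show ?thesis
    proof cases
      case 1
      have "c (j - 1) < n"
      proof (cases "j - 1 = 0")
        case True
        then show ?thesis using n by (simp add: c_def)
      next
        case False
        moreover have "j - 1 < K" using jK 1 by simp
        ultimately show ?thesis using jn(2) 1 Suc_T[of "j - 1"] T by (simp add: c_def)
      qed
      then show ?thesis using cell[of "j - 1"] 1 jK by simp
    next
      case 2
      \<comment> \<open>Cell ends lie in no open cell, but there the path is within s of an integer
        and thus away from the walls.\<close>
      have "(x n - real j)\<^sup>2 < s\<^sup>2" using near[OF jK] 2 \<theta> by simp
      then have "\<bar>x n - real j\<bar> < s" using s power2_less_imp_less[of "\<bar>x n - real j\<bar>" s] by simp
      then show ?thesis using s d unfolding j_def[symmetric] by linarith
    next
      case 3
      have "j < K"
      proof (rule ccontr)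
        assume "\<not> j < K"
        then show False using 3 n jK K by (simp add: c_def)
      qed
      moreover have "n < c (Suc j)"
      proof (cases "Suc j < K")
        case True
        then show ?thesis using jn(1) by (simp add: c_def)
      next
        case False
        then show ?thesis using n by (simp add: c_def)
      qed
      ultimately show ?thesis using cell 3 by blast
    next
      case 4
      then have "n < c (Suc 0)" using jn(1) n by (auto simp: c_def)
      then show ?thesis using cell[of 0] n K by (simp add: c_def)
    qed
  qed
  have EL: "x (n + 1) - 2 * x n + x (n - 1) = P' (x n)" if n: "0 < n" "n < M" for n
  proof -
    define \<delta> where "\<delta> = min (x n - (real (lev n) - 1 + d)) (real (lev n) + d - x n)"
    have \<delta>: "\<delta> > 0" using interior[OF n] by (simp add: \<delta>_def)
    \<comment> \<open>The part of the action that depends on coordinate \<open>n\<close>; this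
      coordinate may be varied freely within \<open>\<delta>\<close>.\<close>
    define G where "G t = ((t - x (n - 1))\<^sup>2 / 2 + P t) + ((x (n + 1) - t)\<^sup>2 / 2 + P (x (n + 1)))" for t
    have two: "act P y (n - 1) (n + 1) = ((y n - y (n - 1))\<^sup>2 / 2 + P (y n)) + ((y (n + 1) - y n)\<^sup>2 / 2 + P (y (n + 1)))" for y
    proof -
      obtain k where "n = Suc k" using n by (cases n) auto
      then show ?thesis by (simp add: act_Suc)
    qed
    have "G (x n) \<le> G t" if t: "\<bar>x n - t\<bar> < \<delta>" for t
    proof -
      have "act P x (n - 1) (n + 1) \<le> act P (x(n := t)) (n - 1) (n + 1)"
      proof (rule lopt)
        fix k assume "n - 1 < k" "k < n + 1"
        then have "k = n" by simp
        then show "lo k \<le> (x(n := t)) k \<and> (x(n := t)) k \<le> hi k"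
          using n t by (auto simp: lo_def hi_def \<delta>_def)
      qed (use n in auto)
      moreover have e: "(x(n := t)) (n - 1) = x (n - 1)" using n by auto
      ultimately show ?thesis unfolding two G_def e by simp
    qed
    moreover have "(G has_field_derivative ((x n - x (n - 1)) + P' (x n) - (x (n + 1) - x n))) (at (x n))"
      unfolding G_def by (auto intro!: derivative_eq_intros P' simp: field_simps)
    ultimately have "(x n - x (n - 1)) + P' (x n) - (x (n + 1) - x n) = 0"
      using DERIV_local_min[of G _ "x n" \<delta>] \<delta> by blast
    then show ?thesis by simp
  qed
  have "x L \<le> 1" using in_box[of L] lev0[of L] L M T0 d by simp
  then show ?thesis using x0 xM EL unfolding M_def by blast
qed

end

section \<open>Trigonometric polynomials and the choice of the potential\<close>

text \<open>\<open>D\<close> bounds the frequencies and \<open>C\<close> the sum of the absolute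
  amplitudes, so derivative bounds need no Fourier coefficients. Free phases make the class closed
  under differentiation and multiplication by a cosine.\<close>

inductive trig_sum :: "nat \<Rightarrow> real \<Rightarrow> (real \<Rightarrow> real) \<Rightarrow> bool" where
  zero: "0 \<le> C \<Longrightarrow> trig_sum D C (\<lambda>x. 0)"
| add: "trig_sum D C f \<Longrightarrow> k \<le> D \<Longrightarrow> C + \<bar>c\<bar> \<le> C' \<Longrightarrow>
    trig_sum D C' (\<lambda>x. f x + c * cos (2 * pi * real k * x + \<psi>))"

lemma trig_sum_bound: "trig_sum D C f \<Longrightarrow> \<bar>f x\<bar> \<le> C"
proof (induction rule: trig_sum.induct)
  case (add D C f k c C' \<psi>)
  have "\<bar>c * cos (2 * pi * real k * x + \<psi>)\<bar> \<le> \<bar>c\<bar> * 1"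
    unfolding abs_mult by (intro mult_left_mono) auto
  then show ?case using add by linarith
qed simp

lemma trig_sum_mono: "trig_sum D C f \<Longrightarrow> D \<le> D' \<Longrightarrow> C \<le> C' \<Longrightarrow> trig_sum D' C' f"
proof (induction arbitrary: C' rule: trig_sum.induct)
  case (zero C D)
  then show ?case by (auto intro: trig_sum.zero)
next
  case (add D C f k c C' \<psi>)
  show ?case by (rule trig_sum.add[of _ C]) (use add in auto)
qed

lemma trig_sum_plus:
  assumes "trig_sum D C f" "trig_sum D C' g"
  shows "trig_sum D (C + C') (\<lambda>x. f x + g x)"
  using assms(2,1)
proof (induction rule: trig_sum.induct)
  case (zero C' D)
  then show ?case by (auto intro: trig_sum_mono)
next
  case (add D C1 g k c C2 \<psi>)
  have "trig_sum D (C + C2) (\<lambda>x. (f x + g x) + c * cos (2 * pi * real k * x + \<psi>))"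
    by (rule trig_sum.add[of _ "C + C1"]) (use add in auto)
  then show ?case by (simp add: add.assoc)
qed

lemma trig_sum_scale: "trig_sum D C f \<Longrightarrow> trig_sum D (\<bar>a\<bar> * C) (\<lambda>x. a * f x)"
proof (induction rule: trig_sum.induct)
  case (zero C D)
  then show ?case by (auto intro: trig_sum.zero)
next
  case (add D C f k c C' \<psi>)
  have "\<bar>a\<bar> * C + \<bar>a * c\<bar> \<le> \<bar>a\<bar> * C'"
    using mult_left_mono[OF add(3), of "\<bar>a\<bar>"] by (simp add: abs_mult algebra_simps)
  then have "trig_sum D (\<bar>a\<bar> * C') (\<lambda>x. a * f x + (a * c) * cos (2 * pi * real k * x + \<psi>))"
    using add by (intro trig_sum.add[of _ "\<bar>a\<bar> * C"]) auto
  then show ?case by (simp add: algebra_simps)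
qed

lemma trig_sum_dilate: "trig_sum D C f \<Longrightarrow> trig_sum (q * D) C (\<lambda>x. f (real q * x))"
proof (induction rule: trig_sum.induct)
  case (zero C D)
  then show ?case by (auto intro: trig_sum.zero)
next
  case (add D C f k c C' \<psi>)
  have "trig_sum (q * D) C' (\<lambda>x. f (real q * x) + c * cos (2 * pi * real (q * k) * x + \<psi>))"
    by (rule trig_sum.add[of _ C]) (use add in auto)
  then show ?case by (simp add: mult.assoc mult.left_commute)
qed

text \<open>Product-to-sum splits each amplitude into two halves, so \<open>C\<close> does not
  grow.\<close>

lemma trig_sum_mult_cos:
  "trig_sum D C f \<Longrightarrow> trig_sum (Suc D) C (\<lambda>x. f x * cos (2 * pi * x + \<beta>))"
proof (induction rule: trig_sum.induct)
  case (zero C D)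
  then show ?case by (auto intro: trig_sum.zero)
next
  case (add D C f k c C' \<psi>)
  define g where "g x = f x * cos (2 * pi * x + \<beta>)" for x
  have 1: "trig_sum (Suc D) (C + \<bar>c\<bar> / 2) (\<lambda>x. g x + c / 2 * cos (2 * pi * real (Suc k) * x + (\<psi> + \<beta>)))"
    by (rule trig_sum.add[of _ C]) (use add in \<open>auto simp: g_def\<close>)
  have pr: "c * cos u * cos v = c / 2 * cos (u + v) + c / 2 * cos (u - v)" for u v
    by (simp add: cos_add cos_diff algebra_simps)
  show ?case
  proof (cases k)
    \<comment> \<open>The difference frequency would be -1; evenness of the cosine turns it into
      1.\<close>
    case 0
    have "trig_sum (Suc D) C' (\<lambda>x. (g x + c / 2 * cos (2 * pi * real (Suc k) * x + (\<psi> + \<beta>)))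
        + c / 2 * cos (2 * pi * real 1 * x + (\<beta> - \<psi>)))"
      by (rule trig_sum.add[OF 1]) (use add 0 in auto)
    also have "(\<lambda>x. (g x + c / 2 * cos (2 * pi * real (Suc k) * x + (\<psi> + \<beta>)))
        + c / 2 * cos (2 * pi * real 1 * x + (\<beta> - \<psi>)))
      = (\<lambda>x. (f x + c * cos (2 * pi * real k * x + \<psi>)) * cos (2 * pi * x + \<beta>))"
    proof
      fix x
      have "cos (2 * pi * real 1 * x + (\<beta> - \<psi>)) = cos (\<psi> - (2 * pi * x + \<beta>))"
        by (subst cos_minus[symmetric]) (simp add: algebra_simps)
      then show "(g x + c / 2 * cos (2 * pi * real (Suc k) * x + (\<psi> + \<beta>)))
        + c / 2 * cos (2 * pi * real 1 * x + (\<beta> - \<psi>))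
        = (f x + c * cos (2 * pi * real k * x + \<psi>)) * cos (2 * pi * x + \<beta>)"
        using pr[of \<psi> "2 * pi * x + \<beta>"] 0 by (simp add: g_def algebra_simps)
    qed
    finally show ?thesis .
  next
    case (Suc l)
    have "trig_sum (Suc D) C' (\<lambda>x. (g x + c / 2 * cos (2 * pi * real (Suc k) * x + (\<psi> + \<beta>)))
        + c / 2 * cos (2 * pi * real l * x + (\<psi> - \<beta>)))"
      by (rule trig_sum.add[OF 1]) (use add Suc in auto)
    also have "(\<lambda>x. (g x + c / 2 * cos (2 * pi * real (Suc k) * x + (\<psi> + \<beta>)))
        + c / 2 * cos (2 * pi * real l * x + (\<psi> - \<beta>)))
      = (\<lambda>x. (f x + c * cos (2 * pi * real k * x + \<psi>)) * cos (2 * pi * x + \<beta>))"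
    proof
      fix x
      have "2 * pi * real (Suc k) * x + (\<psi> + \<beta>) = (2 * pi * real k * x + \<psi>) + (2 * pi * x + \<beta>)"
        "2 * pi * real l * x + (\<psi> - \<beta>) = (2 * pi * real k * x + \<psi>) - (2 * pi * x + \<beta>)"
        by (simp_all add: Suc algebra_simps)
      then show "(g x + c / 2 * cos (2 * pi * real (Suc k) * x + (\<psi> + \<beta>)))
        + c / 2 * cos (2 * pi * real l * x + (\<psi> - \<beta>))
        = (f x + c * cos (2 * pi * real k * x + \<psi>)) * cos (2 * pi * x + \<beta>)"
        using pr[of "2 * pi * real k * x + \<psi>" "2 * pi * x + \<beta>"] by (simp only: g_def distrib_right add.assoc)
    qed
    finally show ?thesis .
  qed
qed

lemma trig_sum_const: "\<bar>c\<bar> \<le> C \<Longrightarrow> trig_sum D C (\<lambda>x. c)"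
  using trig_sum.add[OF trig_sum.zero[of 0 D], of 0 c C 0] by simp

lemma trig_sum_has_derivative:
  "trig_sum D C f \<Longrightarrow> \<exists>f'. (\<forall>x. (f has_field_derivative f' x) (at x)) \<and> trig_sum D (2 * pi * real D * C) f'"
proof (induction rule: trig_sum.induct)
  case (zero C D)
  then show ?case by (intro exI[of _ "\<lambda>x. 0"]) (auto intro!: trig_sum.zero)
next
  case (add D C f k c C' \<psi>)
  then obtain f' where f': "\<And>x. (f has_field_derivative f' x) (at x)" "trig_sum D (2 * pi * real D * C) f'" by blast
  define c' where "c' = 2 * pi * real k * c"
  have "trig_sum D (2 * pi * real D * C') (\<lambda>x. f' x + c' * cos (2 * pi * real k * x + (\<psi> + pi/2)))"
  proof (rule trig_sum.add[OF f'(2) add(2)])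
    have "\<bar>c'\<bar> \<le> 2 * pi * real D * \<bar>c\<bar>"
      using add(2) by (simp add: c'_def abs_mult mult_right_mono)
    moreover have "2 * pi * real D * C + 2 * pi * real D * \<bar>c\<bar> \<le> 2 * pi * real D * C'"
      using mult_left_mono[OF add(3), of "2 * pi * real D"] by (simp add: distrib_left)
    ultimately show "2 * pi * real D * C + \<bar>c'\<bar> \<le> 2 * pi * real D * C'" by linarith
  qed
  moreover have "((\<lambda>x. f x + c * cos (2 * pi * real k * x + \<psi>)) has_field_derivative
      f' x + c' * cos (2 * pi * real k * x + (\<psi> + pi/2))) (at x)" for x
  proof -
    have "cos (2 * pi * real k * x + (\<psi> + pi/2)) = - sin (2 * pi * real k * x + \<psi>)"
      by (simp add: add.assoc[symmetric] cos_add)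
    then show ?thesis by (auto intro!: derivative_eq_intros f'(1) simp: c'_def)
  qed
  ultimately show ?case
    by (intro exI[of _ "\<lambda>x. f' x + c' * cos (2 * pi * real k * x + (\<psi> + pi/2))"] conjI allI)
qed

lemma trig_sum_deriv:
  assumes "trig_sum D C f"
  shows "(f has_field_derivative deriv f x) (at x)" "trig_sum D (2 * pi * real D * C) (deriv f)"
proof -
  obtain f' where f': "\<forall>x. (f has_field_derivative f' x) (at x)" "trig_sum D (2 * pi * real D * C) f'"
    using trig_sum_has_derivative[OF assms] by blast
  then have "deriv f = f'" by (auto intro: DERIV_imp_deriv)
  then show "(f has_field_derivative deriv f x) (at x)" "trig_sum D (2 * pi * real D * C) (deriv f)"
    using f' by auto
qed

text \<open>A crude Bernstein inequality: each derivative costs a factor of 2 pi times the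
  degree.\<close>

lemma trig_sum_higher_deriv:
  "trig_sum D C f \<Longrightarrow> trig_sum D ((2 * pi * real D) ^ j * C) ((deriv ^^ j) f)"
proof (induction j)
  case (Suc j)
  then show ?case using trig_sum_deriv(2)[OF Suc.IH] by (simp add: mult.assoc)
qed simp

lemma higher_deriv_add_trig_sum:
  assumes "trig_sum D C f" "trig_sum D' C' g"
  shows "(deriv ^^ j) (\<lambda>x. f x + g x) = (\<lambda>x. (deriv ^^ j) f x + (deriv ^^ j) g x)"
proof (induction j)
  case (Suc j)
  have "deriv (\<lambda>x. (deriv ^^ j) f x + (deriv ^^ j) g x) x = deriv ((deriv ^^ j) f) x + deriv ((deriv ^^ j) g) x" for x
    by (intro DERIV_imp_deriv DERIV_add trig_sum_deriv(1)[OF trig_sum_higher_deriv[OF assms(1)]]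
        trig_sum_deriv(1)[OF trig_sum_higher_deriv[OF assms(2)]])
  then show ?case by (simp add: Suc fun_eq_iff)
qed simp

lemma trig_poly_if_trig_sum: "trig_sum D C f \<Longrightarrow> trig_poly D f"
proof (induction rule: trig_sum.induct)
  case (zero C D)
  show ?case unfolding trig_poly_def by (intro exI[of _ "\<lambda>k. 0"]) simp
next
  case (add D C f k c C' \<psi>)
  then obtain a b where f: "f = (\<lambda>x. a 0 + (\<Sum>k=1..D. a k * cos (2 * pi * real k * x) + b k * sin (2 * pi * real k * x)))"
    unfolding trig_poly_def by blast
  have tr: "c * cos (2 * pi * real k * x + \<psi>) = (c * cos \<psi>) * cos (2 * pi * real k * x) + (- c * sin \<psi>) * sin (2 * pi * real k * x)" for x
    by (simp add: cos_add algebra_simps)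
  define a' where "a' = a(k := a k + c * cos \<psi>)"
  define b' where "b' = b(k := b k - c * sin \<psi>)"
  have "f x + c * cos (2 * pi * real k * x + \<psi>)
    = a' 0 + (\<Sum>k=1..D. a' k * cos (2 * pi * real k * x) + b' k * sin (2 * pi * real k * x))" for x
  proof (cases "k = 0")
    case True
    have "(\<Sum>k=1..D. a' k * cos (2 * pi * real k * x) + b' k * sin (2 * pi * real k * x))
      = (\<Sum>k=1..D. a k * cos (2 * pi * real k * x) + b k * sin (2 * pi * real k * x))"
      by (rule sum.cong) (auto simp: a'_def b'_def True)
    then show ?thesis by (simp add: f a'_def True)
  next
    case False
    have "(\<Sum>l=1..D. a' l * cos (2 * pi * real l * x) + b' l * sin (2 * pi * real l * x))
      = (\<Sum>l=1..D. (a l * cos (2 * pi * real l * x) + b l * sin (2 * pi * real l * x)) +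
          (if l = k then c * cos (2 * pi * real k * x + \<psi>) else 0))"
      by (rule sum.cong) (auto simp: a'_def b'_def tr distrib_right left_diff_distrib)
    also have "\<dots> = (\<Sum>l=1..D. a l * cos (2 * pi * real l * x) + b l * sin (2 * pi * real l * x))
        + c * cos (2 * pi * real k * x + \<psi>)"
      using False add(2) by (simp add: sum.distrib sum.delta)
    finally show ?thesis using False by (simp add: f a'_def)
  qed
  then show ?case unfolding trig_poly_def by blast
qed

lemma cr_norm_le:
  assumes "\<And>j x. j \<le> nat \<lfloor>r\<rfloor> \<Longrightarrow> \<bar>(deriv ^^ j) u x\<bar> \<le> B"
  shows "cr_norm r u \<le> B"
  unfolding cr_norm_def by (intro cSUP_least) (use assms in auto)

section \<open>The pendulum potential and the bump\<close>

lemma sin_ge_sqrt2: "pi/4 \<le> y \<Longrightarrow> y \<le> 3*pi/4 \<Longrightarrow> sqrt 2 / 2 \<le> sin y"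
proof -
  assume y: "pi/4 \<le> y" "y \<le> 3*pi/4"
  have "\<bar>y - pi/2\<bar> \<le> pi/4" using y by (auto simp: abs_if)
  then have "cos (pi/4) \<le> cos \<bar>y - pi/2\<bar>" by (intro cos_monotone_0_pi_le) auto
  also have "\<dots> = cos (y - pi/2)" by simp
  also have "\<dots> = sin y" by (simp add: cos_diff)
  finally show ?thesis by (simp add: cos_45)
qed

lemma sin_pi_sq_ge_half: "1/4 \<le> x \<Longrightarrow> x \<le> 3/4 \<Longrightarrow> 1/2 \<le> (sin (pi * x))\<^sup>2"
proof -
  assume x: "1/4 \<le> x" "x \<le> 3/4"
  have "pi/4 \<le> pi * x" "pi * x \<le> 3*pi/4"
    using mult_left_mono[OF x(1), of pi] mult_left_mono[OF x(2), of pi] by auto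
  then have "sqrt 2 / 2 \<le> sin (pi * x)" by (rule sin_ge_sqrt2)
  then have "(sqrt 2 / 2)\<^sup>2 \<le> (sin (pi * x))\<^sup>2" by (intro power_mono) auto
  then show ?thesis by (simp add: power_divide)
qed

lemma sin_pi_sq_ge: "\<bar>x\<bar> \<le> 3/4 \<Longrightarrow> x\<^sup>2 / 2 \<le> (sin (pi * x))\<^sup>2"
proof -
  have pos: "x\<^sup>2 / 2 \<le> (sin (pi * x))\<^sup>2" if x: "0 \<le> x" "x \<le> 3/4" for x :: real
  proof (cases "x \<le> 1/4")
    case True
    have "\<bar>sin (pi * x) - (\<Sum>m<3. sin_coeff m * (pi * x) ^ m)\<bar> \<le> inverse (fact 3) * \<bar>pi * x\<bar> ^ 3"
      by (rule Maclaurin_sin_bound)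
    moreover have "(\<Sum>m<3. sin_coeff m * (pi * x) ^ m) = pi * x"
      by (simp add: numeral_3_eq_3 sin_coeff_def)
    ultimately have "\<bar>sin (pi * x) - pi * x\<bar> \<le> (pi * x) ^ 3 / 6" using x by (simp add: fact_numeral)
    then have b: "pi * x - (pi * x) ^ 3 / 6 \<le> sin (pi * x)" by linarith
    have px: "0 \<le> pi * x" "pi * x \<le> 1" using x True pi_less_4 mult_mono[of pi 4 x "1/4"] by auto
    then have "(pi * x) ^ 3 \<le> pi * x" using power_decreasing[of 1 3 "pi * x"] by simp
    moreover have "3 * x \<le> pi * x" using x pi_gt3 by (intro mult_right_mono) auto
    ultimately have "x \<le> sin (pi * x)" using b x by linarith
    then have "x\<^sup>2 \<le> (sin (pi * x))\<^sup>2" using x by (intro power_mono) auto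
    then show ?thesis using zero_le_power2[of x] by linarith
  next
    case False
    have "x\<^sup>2 \<le> 1" using x by (simp add: power_le_one)
    then show ?thesis using sin_pi_sq_ge_half[of x] False x by simp
  qed
  assume "\<bar>x\<bar> \<le> 3/4"
  then show ?thesis using pos[of "\<bar>x\<bar>"] by (cases "x \<ge> 0") auto
qed

lemma sin_pi_sq_le: "(sin (pi * x))\<^sup>2 \<le> 16 * x\<^sup>2"
proof -
  have "\<bar>sin (pi * x)\<bar> \<le> \<bar>pi * x\<bar>" by (rule abs_sin_x_le_abs_x)
  also have "\<dots> \<le> 4 * \<bar>x\<bar>" using pi_less_4 by (simp add: abs_mult mult_right_mono)
  finally have "\<bar>sin (pi * x)\<bar> \<le> \<bar>4 * x\<bar>" by simp
  then have "(sin (pi * x))\<^sup>2 \<le> (4 * x)\<^sup>2" by (rule abs_le_square_iff[THEN iffD1])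
  then show ?thesis by (simp add: power_mult_distrib)
qed

lemma sin_pi_sq_eq: "(sin (pi * x))\<^sup>2 = 1/2 - cos (2 * pi * x) / 2"
  using cos_double_sin[of "pi * x"] by (simp add: mult.assoc field_simps)

definition pendulum :: "real \<Rightarrow> real \<Rightarrow> real" where
  "pendulum s x = 2 * s\<^sup>2 * (sin (pi * x))\<^sup>2"

text \<open>The cosine power concentrates at \<open>d\<close> modulo 1 as \<open>m\<close> grows;
  the sine factor makes the bump vanish quadratically at the integers, so they remain zeros of the
  total potential.\<close>

definition bump :: "real \<Rightarrow> nat \<Rightarrow> real \<Rightarrow> real" where
  "bump d m x = (sin (pi * x))\<^sup>2 * ((cos (pi * (x - d)))\<^sup>2) ^ m"

lemma sin_pi_sq_per: "(sin (pi * (x + 1)))\<^sup>2 = (sin (pi * x))\<^sup>2"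
  by (simp add: distrib_left)

lemma cos_pi_sq_per: "(cos (pi * (x + 1 - d)))\<^sup>2 = (cos (pi * (x - d)))\<^sup>2"
proof -
  have "pi * (x + 1 - d) = pi * (x - d) + pi" by (simp add: algebra_simps)
  then show ?thesis by simp
qed

lemma sin_sq_le_one: "(sin x)\<^sup>2 \<le> (1::real)" and cos_sq_le_one: "(cos x)\<^sup>2 \<le> (1::real)"
  using sin_cos_squared_add[of x] zero_le_power2[of "sin x"] zero_le_power2[of "cos x"] by linarith+

lemma s_sq_le: "0 < s \<Longrightarrow> s \<le> 1/100 \<Longrightarrow> s\<^sup>2 \<le> 1/(10000::real)"
  using power_mono[of s "1/100" 2] by (simp add: power_divide)

lemma barrier_pendulum:
  assumes s: "0 < s" "s \<le> 1/100"
  shows "barrier (pendulum s) s"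
proof
  fix x :: real
  show "0 < s" "s \<le> 1/100" by fact+
  show "0 \<le> pendulum s x" by (simp add: pendulum_def)
  show "pendulum s (- x) = pendulum s x" by (simp add: pendulum_def)
  show "pendulum s (x + 1) = pendulum s x" by (simp only: pendulum_def sin_pi_sq_per)
  show "pendulum s x \<le> 2 * s\<^sup>2"
    unfolding pendulum_def using mult_left_mono[OF sin_sq_le_one[of "pi * x"], of "2 * s\<^sup>2"] by simp
  have "pendulum s x \<le> 2 * (1/10000) * (16 * x\<^sup>2)"
    unfolding pendulum_def by (intro mult_mono sin_pi_sq_le) (use s_sq_le[OF s] in auto)
  then show "pendulum s x \<le> x\<^sup>2" using zero_le_power2[of x] by linarith
  show "\<bar>x\<bar> \<le> 3/4 \<Longrightarrow> s\<^sup>2 * x\<^sup>2 \<le> pendulum s x"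
    unfolding pendulum_def using mult_left_mono[OF sin_pi_sq_ge[of x], of "2 * s\<^sup>2"] by simp
  show "1/4 \<le> x \<Longrightarrow> x \<le> 3/4 \<Longrightarrow> s\<^sup>2 \<le> pendulum s x"
    unfolding pendulum_def using mult_left_mono[OF sin_pi_sq_ge_half[of x], of "2 * s\<^sup>2"] by simp
qed

lemma bump_nonneg: "0 \<le> bump d m x"
  by (simp add: bump_def)

lemma bump_le: "bump d m x \<le> (sin (pi * x))\<^sup>2"
proof -
  have "((cos (pi * (x - d)))\<^sup>2) ^ m \<le> 1" by (rule power_le_one) (auto intro: cos_sq_le_one)
  then show ?thesis unfolding bump_def using mult_left_mono[of _ 1 "(sin (pi * x))\<^sup>2"] by simp
qed

lemma bump_off:
  assumes "\<rho> \<ge> 0" "\<rho> \<le> \<bar>x - d\<bar>" "\<bar>x - d\<bar> \<le> 3/4"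
  shows "bump d m x \<le> (1 - \<rho>\<^sup>2 / 2) ^ m"
proof -
  have "\<rho>\<^sup>2 \<le> \<bar>x - d\<bar>\<^sup>2" using assms by (intro power_mono) auto
  then have "(sin (pi * (x - d)))\<^sup>2 \<ge> \<rho>\<^sup>2 / 2" using sin_pi_sq_ge[OF assms(3)] by simp
  then have "(cos (pi * (x - d)))\<^sup>2 \<le> 1 - \<rho>\<^sup>2 / 2" by (simp add: cos_squared_eq)
  then have "((cos (pi * (x - d)))\<^sup>2) ^ m \<le> (1 - \<rho>\<^sup>2 / 2) ^ m" by (intro power_mono) auto
  moreover have "bump d m x \<le> 1 * ((cos (pi * (x - d)))\<^sup>2) ^ m"
    unfolding bump_def by (intro mult_right_mono sin_sq_le_one) auto
  ultimately show ?thesis by simp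
qed

lemma trig_sum_pendulum: "trig_sum 1 (2 * s\<^sup>2) (pendulum s)"
proof -
  have "trig_sum 1 (2 * s\<^sup>2) (\<lambda>x. s\<^sup>2 + (- s\<^sup>2) * cos (2 * pi * real 1 * x + 0))"
    by (rule trig_sum.add[OF trig_sum_const[of _ "s\<^sup>2"]]) auto
  moreover have "(\<lambda>x. s\<^sup>2 + (- s\<^sup>2) * cos (2 * pi * real 1 * x + 0)) = pendulum s"
    by (simp add: pendulum_def sin_pi_sq_eq fun_eq_iff right_diff_distrib)
  ultimately show ?thesis by simp
qed

text \<open>Each factor cos^2 is 1/2 plus half a cosine, with amplitude sum 1, so the total stays
  bounded by 1 for every \<open>m\<close>.\<close>

lemma trig_sum_bump: "trig_sum (Suc m) 1 (bump d m)"
proof (induction m)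
  case 0
  have "trig_sum 1 1 (\<lambda>x. 1/2 + (- 1/2) * cos (2 * pi * real 1 * x + 0))"
    by (rule trig_sum.add[OF trig_sum_const[of _ "1/2"]]) auto
  moreover have "(\<lambda>x. 1/2 + (- 1/2) * cos (2 * pi * real 1 * x + 0)) = bump d 0"
    by (simp add: bump_def sin_pi_sq_eq fun_eq_iff)
  ultimately show ?case by simp
next
  case (Suc m)
  let ?c = "\<lambda>x. cos (2 * pi * x + (- 2 * pi * d))"
  have "trig_sum (Suc (Suc m)) (\<bar>1/2\<bar> * 1 + \<bar>1/2\<bar> * 1) (\<lambda>x. 1/2 * bump d m x + 1/2 * (bump d m x * ?c x))"
    by (rule trig_sum_plus[OF trig_sum_scale[OF trig_sum_mono[OF Suc]] trig_sum_scale[OF trig_sum_mult_cos[OF Suc]]]) auto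
  moreover have "1/2 * bump d m x + 1/2 * (bump d m x * ?c x) = bump d (Suc m) x" for x
  proof -
    have "2 * pi * x + (- 2 * pi * d) = 2 * (pi * (x - d))" by (simp add: algebra_simps)
    then have "?c x = 2 * (cos (pi * (x - d)))\<^sup>2 - 1" by (simp only: cos_double_cos)
    then have "1/2 * bump d m x + 1/2 * (bump d m x * ?c x) = bump d m x * (cos (pi * (x - d)))\<^sup>2"
      by (simp only: right_diff_distrib)
    then show ?thesis by (simp add: bump_def)
  qed
  ultimately show ?case by simp
qed

lemma bumped_pendulum:
  fixes m w :: nat
  defines "N \<equiv> 2 * w + 1"
  assumes s: "0 < s" "s \<le> 1/100" and \<eta>: "0 < \<eta>" "\<eta> \<le> s\<^sup>2" and tol: "tol > 0" and \<theta>: "\<theta> < s\<^sup>2"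
    and small: "4 * \<theta> + 2 * barrier.short_err s w + 3 * tol + 2 * N * (\<eta> * (1 - (s/100)\<^sup>2 / 2) ^ m) < \<eta> / 2"
  shows "\<exists>d. bumped (pendulum s) s (\<lambda>x. pendulum s x + \<eta> * bump d m x) d \<eta> ((1 - (s/100)\<^sup>2 / 2) ^ m) tol \<theta> w N"
proof -
  interpret barrier "pendulum s" s by (rule barrier_pendulum[OF s])
  obtain d where d: "3/8 \<le> d" "d \<le> 1/2" "\<And>x. 3/8 \<le> x \<Longrightarrow> x \<le> 5/8 \<Longrightarrow> E x \<le> E d + tol"
    using E_near_max[OF tol] by blast
  have "bumped (pendulum s) s (\<lambda>x. pendulum s x + \<eta> * bump d m x) d \<eta> ((1 - (s/100)\<^sup>2 / 2) ^ m) tol \<theta> w N"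
  proof
    fix x :: real
    show "3/8 \<le> d" "d \<le> 1/2" "tol > 0" "\<theta> < s\<^sup>2" by fact+
    show "3/8 \<le> x \<Longrightarrow> x \<le> 5/8 \<Longrightarrow> E x \<le> E d + tol" by (rule d(3))
    show "pendulum s x \<le> pendulum s x + \<eta> * bump d m x" using \<eta> bump_nonneg[of d m x] by simp
    show "pendulum s (x + 1) + \<eta> * bump d m (x + 1) = pendulum s x + \<eta> * bump d m x"
      by (simp only: V_per bump_def sin_pi_sq_per cos_pi_sq_per)
    have "pendulum s x + \<eta> * bump d m x \<le> 2 * s\<^sup>2 * (sin (pi * x))\<^sup>2 + s\<^sup>2 * (sin (pi * x))\<^sup>2"
      unfolding pendulum_def by (intro add_mono mult_mono bump_le) (use \<eta> bump_nonneg in auto)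
    also have "\<dots> = 3 * s\<^sup>2 * (sin (pi * x))\<^sup>2" by simp
    also have "\<dots> \<le> 3 * (1/10000) * (16 * x\<^sup>2)"
      by (intro mult_mono sin_pi_sq_le) (use s_sq_le[OF s] in auto)
    also have "\<dots> \<le> x\<^sup>2" using zero_le_power2[of x] by linarith
    finally show "pendulum s x + \<eta> * bump d m x \<le> x\<^sup>2" .
    have "bump d m d \<ge> 1/2" using sin_pi_sq_ge_half[of d] d by (simp add: bump_def)
    then show "pendulum s d + \<eta> / 2 \<le> pendulum s d + \<eta> * bump d m d"
      using mult_left_mono[of "1/2" "bump d m d" \<eta>] \<eta> by simp
    show "pendulum s x + \<eta> * bump d m x \<le> pendulum s x + \<eta> * (1 - (s/100)\<^sup>2 / 2) ^ m"
      if "0 \<le> x" "x \<le> 1" "s/100 \<le> \<bar>x - d\<bar>"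
    proof -
      have "\<bar>x - d\<bar> \<le> 3/4" using that d by (auto simp: abs_if)
      then have "bump d m x \<le> (1 - (s/100)\<^sup>2 / 2) ^ m" using that s by (intro bump_off) auto
      then show ?thesis using \<eta> by (intro add_left_mono mult_left_mono) auto
    qed
    show "N = 2 * w + 1" by (simp add: N_def)
    show "4 * \<theta> + 2 * short_err w + 3 * tol + 2 * N * (\<eta> * (1 - (s/100)\<^sup>2 / 2) ^ m) < \<eta> / 2"
      using small by simp
  qed
  then show ?thesis by blast
qed

section \<open>Choice of parameters\<close>

lemma powr_exp_eventually_le:
  fixes c a K \<delta> :: real
  assumes "c > 0" "a > 0" "\<delta> > 0"
  shows "\<forall>\<^sub>F x in at_top. x powr K * exp (- (c * x powr a)) \<le> \<delta>"
proof -
  have "((\<lambda>x::real. x powr K * exp (- (c * x powr a))) \<longlongrightarrow> 0) at_top"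
    using assms by real_asymp
  then have "\<forall>\<^sub>F x in at_top. x powr K * exp (- (c * x powr a)) < \<delta>"
    using assms(3) by (rule order_tendstoD)
  then show ?thesis by (rule eventually_mono) simp
qed

lemma inverse_power_le_exp:
  assumes "0 \<le> S" "S \<le> 1"
  shows "(1 / (1 + S)) ^ w \<le> exp (- (S / 2 * real w))"
proof -
  have "exp (S / 2) \<le> 1 + S / 2 + (S / 2)\<^sup>2" using assms by (intro exp_bound) auto
  moreover have "S\<^sup>2 \<le> S" using assms power_decreasing[of 1 2 S] by simp
  ultimately have "exp (S / 2) \<le> 1 + S" using assms by (simp add: power_divide)
  then have "1 / (1 + S) \<le> 1 / exp (S / 2)" using assms by (intro divide_left_mono) (auto simp: add_pos_nonneg)
  then have "(1 / (1 + S)) ^ w \<le> (exp (- (S / 2))) ^ w"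
    using assms by (intro power_mono) (auto simp: exp_minus inverse_eq_divide)
  also have "\<dots> = exp (- (S / 2 * real w))" by (simp add: exp_of_nat_mult[symmetric] mult.commute)
  finally show ?thesis .
qed

text \<open>\<open>S\<close> stands for s^2. The product S w is of order q^a with a = 1 + \<mu> -
  \<lambda> > 0, so the settling errors decay like exp(-c q^a). Off its peak the bump has decayed by
  exp(-c' q^2), because its power q^(\<lambda>+2) is q^2 times the inverse of s^2 up to a constant.
  Both beat the polynomial \<open>\<eta>\<close>.\<close>

lemma parameters_exist:
  fixes \<mu> e1 e2 :: real and lam b :: nat
  assumes \<mu>: "\<mu> \<ge> 0" and lam: "real lam < 1 + \<mu>" and e1: "0 < e1" "e1 \<le> 1/10000" and e2: "0 < e2" "e2 \<le> e1"
    and b: "lam \<le> b"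
  shows "\<exists>Q. \<forall>q\<ge>Q. \<forall>S \<eta> w \<theta>. S = e1 / real q ^ lam \<longrightarrow> \<eta> = e2 / real q ^ b \<longrightarrow>
    w = nat \<lfloor>real q powr (1 + \<mu>) / 100\<rfloor> \<longrightarrow> \<theta> = (1 / (1 + S)) ^ w * real (4 * w + 10) \<longrightarrow>
    \<theta> < S \<and> 4 * \<theta> + 2 * (2 * ((1 / (1 + S)) ^ w * (2 + 1 / S))) + 3 * (\<eta> / 100) +
      2 * real (2 * w + 1) * (\<eta> * (1 - S / 20000) ^ (q ^ (lam + 2))) < \<eta> / 2"
proof -
  define a where "a = 1 + \<mu> - real lam"
  have a: "a > 0" using lam by (simp add: a_def)
  define c where "c = e1 / 200"
  define c' where "c' = e1 / 20000"
  have cc: "c > 0" "c' > 0" using e1 by (auto simp: c_def c'_def)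
  have "\<forall>\<^sub>F x in at_top. x powr (1 + \<mu> + real b) * exp (- (c * x powr a)) \<le> e2 / 4000"
    by (rule powr_exp_eventually_le) (use cc a e2 in auto)
  moreover have "\<forall>\<^sub>F x in at_top. x powr (real lam + real b) * exp (- (c * x powr a)) \<le> e1 * e2 / 4000"
    by (rule powr_exp_eventually_le) (use cc a e1 e2 in auto)
  moreover have "\<forall>\<^sub>F x in at_top. x powr (1 + \<mu>) * exp (- (c' * x powr 2)) \<le> 1 / 100"
    by (rule powr_exp_eventually_le) (use cc in auto)
  ultimately have "\<forall>\<^sub>F x in at_top. 
      x powr (1 + \<mu> + real b) * exp (- (c * x powr a)) \<le> e2 / 4000 \<and>
      x powr (real lam + real b) * exp (- (c * x powr a)) \<le> e1 * e2 / 4000 \<and>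
      x powr (1 + \<mu>) * exp (- (c' * x powr 2)) \<le> 1 / 100"
    by eventually_elim simp
  then obtain X0 where X0: "\<And>x. x \<ge> X0 \<Longrightarrow>
      x powr (1 + \<mu> + real b) * exp (- (c * x powr a)) \<le> e2 / 4000 \<and>
      x powr (real lam + real b) * exp (- (c * x powr a)) \<le> e1 * e2 / 4000 \<and>
      x powr (1 + \<mu>) * exp (- (c' * x powr 2)) \<le> 1 / 100"
    by (auto simp: eventually_at_top_linorder)
  show ?thesis
  proof (intro exI[of _ "nat \<lceil>max X0 1\<rceil>"] allI impI)
    fix q :: nat and S \<eta> \<theta> :: real and w :: nat
    assume q: "nat \<lceil>max X0 1\<rceil> \<le> q" and S: "S = e1 / real q ^ lam" and \<eta>: "\<eta> = e2 / real q ^ b"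
      and w: "w = nat \<lfloor>real q powr (1 + \<mu>) / 100\<rfloor>" and \<theta>: "\<theta> = (1 / (1 + S)) ^ w * real (4 * w + 10)"
    have q1: "real q \<ge> 1" "real q \<ge> X0" using q by linarith+
    define X where "X = real q powr (1 + \<mu>)"
    define G where "G = exp (- (c * real q powr a))"
    define H where "H = exp (- (c' * real q powr 2))"
    have pw: "real q ^ k = real q powr real k" for k using q1 by (simp add: powr_realpow)
    have q0: "q > 0" using q1 by simp
    have qb: "real q ^ b > 0" "real q ^ lam > 0" using q1 by auto
    have b1: "X * G * real q ^ b \<le> e2 / 4000"
      using X0[OF q1(2)] unfolding X_def G_def pw by (simp add: powr_add algebra_simps)
    have b2: "G * real q ^ lam * real q ^ b \<le> e1 * e2 / 4000"
      using X0[OF q1(2)] unfolding G_def pw by (simp add: powr_add algebra_simps)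
    have b3: "X * H \<le> 1 / 100" using X0[OF q1(2)] by (simp add: X_def H_def)
    have X1: "X \<ge> 1" unfolding X_def using q1 \<mu> by (intro ge_one_powr_ge_zero) auto
    have w1: "real w \<le> X / 100" "real w \<ge> X / 100 - 1"
      using X1 unfolding w X_def[symmetric] by linarith+
    have S0: "S > 0" using e1 qb by (simp add: S)
    have S1: "S \<le> e1" using e1 q1 qb one_le_power[OF q1(1), of lam] unfolding S by (simp add: divide_le_eq)
    have \<eta>0: "\<eta> > 0" using e2 qb by (simp add: \<eta>)
    have \<eta>S: "\<eta> \<le> S"
      unfolding \<eta> S using e1 e2 qb q1 b by (intro frac_le power_increasing) auto
    have SX: "S * X / 200 = c * real q powr a"
      unfolding S X_def c_def a_def using pw q1 by (simp add: powr_diff)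
    have G0: "G > 0" by (simp add: G_def)
    \<comment> \<open>The factor 3 > e absorbs the rounding in \<open>w\<close>.\<close>
    have kap: "(1 / (1 + S)) ^ w \<le> 3 * G"
    proof -
      have "S / 2 * (X / 100 - 1) \<le> S / 2 * real w" using w1 S0 by (intro mult_left_mono) auto
      moreover have "S / 2 * (X / 100 - 1) = c * real q powr a - S / 2" using SX by (simp add: algebra_simps)
      moreover have "S / 2 \<le> 1" using S1 e1 by simp
      ultimately have "- (S / 2 * real w) \<le> 1 + - (c * real q powr a)" by linarith
      then have "exp (- (S / 2 * real w)) \<le> exp (1 + - (c * real q powr a))" by simp
      also have "\<dots> = exp 1 * G" by (simp add: exp_add[symmetric] G_def)
      also have "\<dots> \<le> 3 * G" using exp_le G0 by (intro mult_right_mono) auto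
      finally show ?thesis using inverse_power_le_exp[of S w] S0 S1 e1 by simp
    qed
    have \<theta>\<eta>: "\<theta> \<le> \<eta> / 100"
    proof -
      have "real (4 * w + 10) \<le> 11 * X" using w1 X1 by simp
      then have "\<theta> \<le> 3 * G * (11 * X)" unfolding \<theta> using kap G0 S0 by (intro mult_mono) auto
      also have "\<dots> = 33 * (X * G * real q ^ b) / real q ^ b" using q0 by simp
      also have "\<dots> \<le> 33 * (e2 / 4000) / real q ^ b" using b1 qb by (intro divide_right_mono mult_left_mono) auto
      also have "\<dots> = 33 / 4000 * \<eta>" by (simp add: \<eta>)
      also have "\<dots> \<le> \<eta> / 100" using \<eta>0 by simp
      finally show ?thesis .
    qed
    have short: "2 * ((1 / (1 + S)) ^ w * (2 + 1 / S)) \<le> \<eta> / 200"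
    proof -
      have "1 / S = real q ^ lam / e1" by (simp add: S)
      moreover have "real q ^ lam / e1 \<ge> 1"
        using one_le_power[OF q1(1), of lam] e1 by (simp add: le_divide_eq)
      ultimately have "2 + 1 / S \<le> 3 * (real q ^ lam / e1)" by simp
      then have "(1 / (1 + S)) ^ w * (2 + 1 / S) \<le> 3 * G * (3 * (real q ^ lam / e1))"
        using kap G0 S0 by (intro mult_mono) (auto simp: add_nonneg_nonneg)
      also have "\<dots> = 9 * (G * real q ^ lam * real q ^ b) / (e1 * real q ^ b)" using q0 e1 by simp
      also have "\<dots> \<le> 9 * (e1 * e2 / 4000) / (e1 * real q ^ b)"
        using b2 qb e1 by (intro divide_right_mono mult_left_mono) auto
      also have "\<dots> = 9 / 4000 * \<eta>" using e1 by (simp add: \<eta>)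
      finally show ?thesis using \<eta>0 by linarith
    qed
    have beta: "2 * real (2 * w + 1) * (\<eta> * (1 - S / 20000) ^ (q ^ (lam + 2))) \<le> \<eta> / 25"
    proof -
      have "(1 - S / 20000) ^ (q ^ (lam + 2)) \<le> exp (- (S / 20000)) ^ (q ^ (lam + 2))"
        using exp_ge_add_one_self[of "- (S / 20000)"] S1 e1 by (intro power_mono) auto
      also have "\<dots> = exp (- (S * real q ^ (lam + 2) / 20000))"
        by (simp add: exp_of_nat_mult[symmetric] algebra_simps)
      also have "S * real q ^ (lam + 2) / 20000 = c' * real q powr 2"
      proof -
        have "real q powr 2 = real q ^ 2" using pw[of 2] by simp
        then show ?thesis using qb unfolding S c'_def by (simp add: power_add power2_eq_square)
      qed
      finally have h: "(1 - S / 20000) ^ (q ^ (lam + 2)) \<le> H" by (simp add: H_def)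
      have "real (2 * w + 1) \<le> 2 * X" using w1 X1 by simp
      then have "real (2 * w + 1) * (1 - S / 20000) ^ (q ^ (lam + 2)) \<le> 2 * X * H"
        using h S1 e1 X1 by (intro mult_mono) auto
      also have "\<dots> \<le> 2 * (1/100)" using b3 by simp
      finally have "real (2 * w + 1) * (1 - S / 20000) ^ (q ^ (lam + 2)) \<le> 1/50" by simp
      from mult_left_mono[OF this, of "2 * \<eta>"] show ?thesis using \<eta>0 by (simp add: algebra_simps)
    qed
    \<comment> \<open>The four terms are at most 4/100, 1/100, 3/100 and 4/100 of
      \<open>\<eta>\<close>.\<close>
    show "\<theta> < S \<and> 4 * \<theta> + 2 * (2 * ((1 / (1 + S)) ^ w * (2 + 1 / S))) + 3 * (\<eta> / 100) +
      2 * real (2 * w + 1) * (\<eta> * (1 - S / 20000) ^ (q ^ (lam + 2))) < \<eta> / 2"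
      using \<theta>\<eta> short beta \<eta>0 \<eta>S S0 by linarith
  qed
qed

section \<open>Destruction of the circle\<close>

context invariant_circle
begin

text \<open>A solution of the recurrence is the first coordinate of an orbit of \<open>F\<close>
  whose second coordinate is the forward difference.\<close>

lemma orbit_comparison:
  "\<exists>C. \<forall>x L M. (\<forall>n. 0 < n \<longrightarrow> n < L + M \<longrightarrow> x (n + 1) - 2 * x n + x (n - 1) = \<phi> (x n)) \<longrightarrow>
    \<not> (x L - x 0 < real L * \<omega> - C \<and> x (L + M) - x L > real M * \<omega> + C)"
proof -
  obtain C where C: "\<And>z L M. \<not> (fst ((F ^^ L) z) - fst z < real L * \<omega> - C \<and>
                 fst ((F ^^ (L + M)) z) - fst ((F ^^ L) z) > real M * \<omega> + C)"
    using comparison by blast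
  have "\<not> (x L - x 0 < real L * \<omega> - C \<and> x (L + M) - x L > real M * \<omega> + C)"
    if EL: "\<forall>n. 0 < n \<longrightarrow> n < L + M \<longrightarrow> x (n + 1) - 2 * x n + x (n - 1) = \<phi> (x n)" for x L M
  proof -
    define z where "z = (x 0, x 1 - x 0)"
    have orb: "(F ^^ n) z = (x n, x (n + 1) - x n)" if "n < L + M" for n
      using that
    proof (induction n)
      case 0
      show ?case by (simp add: z_def)
    next
      case (Suc n)
      then have "(F ^^ Suc n) z = (x (Suc n), x (Suc n) - x n + \<phi> (x (Suc n)))" by (simp add: F_eq)
      moreover have "x (Suc n + 1) - 2 * x (Suc n) + x n = \<phi> (x (Suc n))"
        using EL Suc.prems by (metis diff_Suc_1 zero_less_Suc)
      ultimately show ?case by simp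
    qed
    have fo: "fst ((F ^^ n) z) = x n" if "n \<le> L + M" for n
    proof (cases n)
      case 0
      then show ?thesis by (simp add: z_def)
    next
      case (Suc k)
      then show ?thesis using orb[of k] that by (simp add: F_fst)
    qed
    show ?thesis using C[of L z M] fo[of L] fo[of "L + M"] by (simp add: z_def)
  qed
  then show ?thesis by blast
qed

end

lemma gen_map_kick:
  assumes "\<And>x. (R has_field_derivative \<phi> x) (at x)"
  shows "gen_map (\<lambda>x x'. (x - x')\<^sup>2 / 2 + R x') (x, y) = (x + y, y + \<phi> (x + y))"
proof -
  have p1: "partial1 (\<lambda>x x'. (x - x')\<^sup>2 / 2 + R x') x x' = x - x'" for x x'
    unfolding partial1_def by (rule DERIV_imp_deriv) (auto intro!: derivative_eq_intros)
  have p2: "partial2 (\<lambda>x x'. (x - x')\<^sup>2 / 2 + R x') x x' = x' - x + \<phi> x'" for x x'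
    unfolding partial2_def by (rule DERIV_imp_deriv) (auto intro!: derivative_eq_intros assms)
  show ?thesis
    unfolding gen_map_def p1 p2 prod.case
    by (rule the_equality) (auto simp: case_prod_beta prod_eq_iff)
qed

text \<open>Rescaling by \<open>q\<close> and passing to the frame moving with speed \<open>p/q\<close> turns the frequency \<open>\<omega>\<close> into
  \<open>q\<omega> - p\<close>; the orbits below wait near 0 and then advance at a speed exceeding \<open>\<bar>q\<omega> - p\<bar>\<close>, which no
  orbit can do in the presence of an invariant circle.\<close>

lemma no_invariant_circle:
  fixes P P' :: "real \<Rightarrow> real" and q T :: nat and p :: int
  assumes q: "q > 0" and P': "\<And>x. (P has_field_derivative P' x) (at x)"
    and contP': "continuous_on UNIV P'" and perP: "\<And>x. P (x + 1) = P x"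
    and \<alpha>: "real q * \<omega> - real_of_int p \<noteq> 0" "real T * \<bar>real q * \<omega> - real_of_int p\<bar> \<le> 1/2"
    and orbits: "\<And>L K. T \<le> L \<Longrightarrow> 0 < K \<Longrightarrow> \<exists>x. x 0 = 0 \<and> x L \<le> 1 \<and> x (L + K * T) = real K \<and>
      (\<forall>n. 0 < n \<longrightarrow> n < L + K * T \<longrightarrow> x (n + 1) - 2 * x n + x (n - 1) = P' (x n))"
  shows "\<not> has_invariant_circle_freq
    (gen_map (\<lambda>x x'. (x - x')\<^sup>2 / 2 + P (real q * x') / (real q)\<^sup>2)) \<omega>"
proof
  define \<phi> where "\<phi> x = P' (real q * x) / real q" for x
  define F where "F = gen_map (\<lambda>x x'. (x - x')\<^sup>2 / 2 + P (real q * x') / (real q)\<^sup>2)"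
  assume "has_invariant_circle_freq
    (gen_map (\<lambda>x x'. (x - x')\<^sup>2 / 2 + P (real q * x') / (real q)\<^sup>2)) \<omega>"
  then obtain \<gamma> where \<gamma>: "continuous_on UNIV \<gamma>" "inj \<gamma>" "\<forall>t. \<gamma> (t + 1) = \<gamma> t + (1, 0)"
      "F ` range \<gamma> = range \<gamma>"
      "\<forall>t. ((\<lambda>n. (((\<lambda>s. inv \<gamma> (F (\<gamma> s))) ^^ n) t - t) / real n) \<longlonglongrightarrow> \<omega>)"
    unfolding has_invariant_circle_freq_def F_def by blast
  have "((\<lambda>x. P (real q * x) / (real q)\<^sup>2) has_field_derivative \<phi> x) (at x)" for x
  proof -
    have "((\<lambda>x. P (real q * x)) has_field_derivative P' (real q * x) * real q) (at x)"
      by (rule DERIV_chain2[OF P']) (auto intro!: derivative_eq_intros)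
    then have "((\<lambda>x. P (real q * x) / (real q)\<^sup>2) has_field_derivative (P' (real q * x) * real q) / (real q)\<^sup>2) (at x)"
      by (rule DERIV_cdivide)
    then show ?thesis using q by (simp add: \<phi>_def power2_eq_square)
  qed
  then have F: "F (x, y) = (x + y, y + \<phi> (x + y))" for x y
    unfolding F_def by (rule gen_map_kick)
  have perP': "P' (x + 1) = P' x" for x
  proof -
    have "((\<lambda>x. P (x + 1)) has_field_derivative P' (x + 1) * 1) (at x)"
      by (rule DERIV_chain2[OF P']) (auto intro!: derivative_eq_intros)
    then show ?thesis using DERIV_unique[of P "P' (x + 1)" x "P' x"] P'[of x] by (simp add: perP)
  qed
  have perP'n: "P' (x + real n) = P' x" for x n
    by (induction n) (simp_all add: perP' add.assoc[symmetric] add.commute[of 1])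
  have perP'i: "P' (x + of_int k) = P' x" for x k
  proof (cases "k \<ge> 0")
    case True
    then show ?thesis using perP'n[of x "nat k"] by simp
  next
    case False
    then show ?thesis using perP'n[of "x + of_int k" "nat (- k)"] by simp
  qed
  interpret invariant_circle \<phi> F \<gamma> \<omega>
  proof
    show "continuous_on UNIV \<phi>" unfolding \<phi>_def
      using q by (intro continuous_intros continuous_on_compose2[OF contP']) auto
    show "\<phi> (x + 1) = \<phi> x" for x
      using perP'n[of "real q * x" q] by (simp add: \<phi>_def distrib_left)
  qed (use F \<gamma> in auto)
  obtain C where C: "\<And>x L M. (\<forall>n. 0 < n \<longrightarrow> n < L + M \<longrightarrow> x (n + 1) - 2 * x n + x (n - 1) = \<phi> (x n)) \<Longrightarrow>
    \<not> (x L - x 0 < real L * \<omega> - C \<and> x (L + M) - x L > real M * \<omega> + C)"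
    using orbit_comparison by blast
  define \<alpha> where "\<alpha> = real q * \<omega> - real_of_int p"
  have \<alpha>0: "\<alpha> \<noteq> 0" "real T * \<bar>\<alpha>\<bar> \<le> 1/2" using assms(5,6) by (auto simp: \<alpha>_def)
  have \<omega>: "\<omega> = (\<alpha> + real_of_int p) / real q" using q by (simp add: \<alpha>_def)
  \<comment> \<open>Here X = qx - np; the integer np is invisible to the periodic
    \<open>P'\<close>.\<close>
  have key: "\<not> (X L - X 0 < real L * \<alpha> - real q * C \<and> X (L + M) - X L > real M * \<alpha> + real q * C)"
    if EL: "\<forall>n. 0 < n \<longrightarrow> n < L + M \<longrightarrow> X (n + 1) - 2 * X n + X (n - 1) = P' (X n)" for X :: "nat \<Rightarrow> real" and L M
  proof -
    define x where "x n = (X n + real n * real_of_int p) / real q" for n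
    have "\<not> (x L - x 0 < real L * \<omega> - C \<and> x (L + M) - x L > real M * \<omega> + C)"
    proof (rule C, intro allI impI)
      fix n assume n: "0 < n" "n < L + M"
      then obtain k where k: "n = Suc k" by (cases n) auto
      have "x (n + 1) - 2 * x n + x (n - 1) = (X (n + 1) - 2 * X n + X (n - 1)) / real q"
        using q by (simp add: x_def k field_simps)
      also have "\<dots> = P' (X n) / real q" using EL n by simp
      also have "P' (X n) = P' (real q * x n)"
        using perP'i[of "X n" "int n * p"] q by (simp add: x_def)
      finally show "x (n + 1) - 2 * x n + x (n - 1) = \<phi> (x n)" by (simp add: \<phi>_def)
    qed
    moreover have xd: "x (k + l) - x k = (X (k + l) - X k + real l * real_of_int p) / real q" for k l
      by (simp add: x_def diff_divide_distrib[symmetric] algebra_simps)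
    have \<omega>d: "real l * \<omega> + c = (real l * \<alpha> + real q * c + real l * real_of_int p) / real q" for l c
      using q by (simp add: \<omega> field_simps)
    have "x L - x 0 < real L * \<omega> - C \<longleftrightarrow> X L - X 0 < real L * \<alpha> - real q * C"
      using q xd[of 0 L] \<omega>d[of L "- C"] by (simp add: divide_less_cancel)
    moreover have "x (L + M) - x L > real M * \<omega> + C \<longleftrightarrow> X (L + M) - X L > real M * \<alpha> + real q * C"
      unfolding xd \<omega>d using q by (simp add: divide_less_cancel)
    ultimately show ?thesis by blast
  qed
  \<comment> \<open>The waiting time must be long enough for the drift \<open>\<alpha>\<close> to
    outweigh one unit plus the scaled constant.\<close>
  obtain L0 where L0: "real L0 * \<bar>\<alpha>\<bar> > 1 + real q * C"
    using reals_Archimedean3[of "\<bar>\<alpha>\<bar>"] \<alpha>0 by auto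
  define L where "L = max L0 T"
  have "real L * \<bar>\<alpha>\<bar> \<ge> real L0 * \<bar>\<alpha>\<bar>" by (intro mult_right_mono) (auto simp: L_def)
  then have L: "real L * \<bar>\<alpha>\<bar> > 1 + real q * C" "T \<le> L" using L0 by (auto simp: L_def)
  \<comment> \<open>During the jumps the orbit advances by about K but the circle by at most K/2;
    half of K must exceed 1 + qC.\<close>
  obtain K0 :: nat where K0: "real K0 > 2 * (1 + real q * C)" using reals_Archimedean2 by blast
  define K where "K = max K0 1"
  have K: "real K > 2 + 2 * (real q * C)" "0 < K" using K0 by (auto simp: K_def)
  have KT: "real (K * T) * \<bar>\<alpha>\<bar> \<le> real K / 2"
    using mult_left_mono[OF \<alpha>0(2), of "real K"] by (simp add: mult.assoc)
  obtain X where X: "X 0 = 0" "X L \<le> 1" "X (L + K * T) = real K"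
      "\<forall>n. 0 < n \<longrightarrow> n < L + K * T \<longrightarrow> X (n + 1) - 2 * X n + X (n - 1) = P' (X n)"
    using orbits[OF L(2) K(2)] by blast
  show False
  proof (cases "\<alpha> > 0")
    case True
    then have "X L - X 0 < real L * \<alpha> - real q * C" using X(1,2) L(1) by simp
    moreover have "X (L + K * T) - X L > real (K * T) * \<alpha> + real q * C"
      using True X(2,3) K(1) KT unfolding abs_of_pos[OF True] by linarith
    ultimately show False using key[OF X(4)] by blast
  next
    case False
    \<comment> \<open>The recurrence is symmetric in time. The reversed orbit first falls faster
      than the negative drift, then waits and is thus faster than the drift: again slow before
      fast.\<close>
    define Y where "Y n = X (L + K * T - n)" for n
    have "\<not> (Y (K * T) - Y 0 < real (K * T) * \<alpha> - real q * C \<and>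
        Y (K * T + L) - Y (K * T) > real L * \<alpha> + real q * C)"
    proof (rule key, intro allI impI)
      fix n assume n: "0 < n" "n < K * T + L"
      define m where "m = L + K * T - n"
      have m: "0 < m" "m < L + K * T" "L + K * T - (n + 1) = m - 1" "L + K * T - (n - 1) = m + 1"
        using n by (auto simp: m_def)
      then show "Y (n + 1) - 2 * Y n + Y (n - 1) = P' (Y n)"
        using X(4) unfolding Y_def m_def[symmetric] m(3,4) by (simp add: algebra_simps)
    qed
    moreover have "\<bar>\<alpha>\<bar> = - \<alpha>" using False by simp
    then have KT': "real (K * T) * - \<alpha> \<le> real K / 2" and L': "real L * - \<alpha> > 1 + real q * C"
      using KT L(1) by simp_all
    have "Y (K * T) = X L" "Y 0 = real K" "Y (K * T + L) = 0"
      using X(1,3) by (simp_all add: Y_def add.commute)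
    then have "Y (K * T) - Y 0 < real (K * T) * \<alpha> - real q * C"
        "Y (K * T + L) - Y (K * T) > real L * \<alpha> + real q * C"
      using X(2) K(1) KT' L' unfolding mult_minus_right by linarith+
    ultimately show False by blast
  qed
qed

theorem theorem1p1:
  fixes \<mu> \<omega> r \<epsilon> :: real
  assumes "\<mu> \<ge> 0" and "\<omega> \<notin> \<rat>" and "well_approximable \<mu> \<omega>"
    and "0 \<le> r" and "r < 3 + \<mu>" and "\<epsilon> > 0"
  shows "\<exists>N R. trig_poly N R \<and> cr_norm r R < \<epsilon> \<and>
           \<not> has_invariant_circle_freq (gen_map (\<lambda>x x'. (x - x')\<^sup>2 / 2 + R x')) \<omega>"
proof -
  \<comment> \<open>Derivatives up to order \<open>nat \<lfloor>r\<rfloor>\<close> must be small;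
    raising the order to at least 2 keeps \<lambda> = J - 2 nonnegative and J < 3 + \<mu> still
    holds.\<close>
  define J where "J = max 2 (nat \<lfloor>r\<rfloor>)"
  define lam where "lam = J - 2"
  \<comment> \<open>After dilation the bump has degree at most 2 q^(\<lambda>+3), so J derivatives
    cost q^((\<lambda>+3)J); the extra \<lambda> yields \<open>\<eta>\<close> at most s^2.\<close>
  define b where "b = (lam + 3) * J + lam"
  \<comment> \<open>\<open>e1\<close> and \<open>e2\<close> give the pendulum part and the bump part
    a quarter of \<open>\<epsilon>\<close> each.\<close>
  define e1 where "e1 = min (1/10000) (\<epsilon> / (8 * (2 * pi) ^ J))"
  define e2 where "e2 = min e1 (\<epsilon> / (4 * (4 * pi) ^ J))"
  have J2: "J = lam + 2" by (simp add: J_def lam_def)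
  have "real J < 3 + \<mu>" unfolding J_def using assms by (auto simp: of_nat_nat max_def) linarith
  then have lam: "real lam < 1 + \<mu>" using J2 by simp
  have e1: "0 < e1" "e1 \<le> 1/10000" "e1 \<le> \<epsilon> / (8 * (2 * pi) ^ J)"
    using assms(6) by (auto simp: e1_def)
  have e2: "0 < e2" "e2 \<le> e1" "e2 \<le> \<epsilon> / (4 * (4 * pi) ^ J)"
    using assms(6) e1 by (auto simp: e2_def)
  obtain Q where Q: "\<And>q S \<eta> w \<theta>. q \<ge> Q \<Longrightarrow> S = e1 / real q ^ lam \<Longrightarrow> \<eta> = e2 / real q ^ b \<Longrightarrow>
    w = nat \<lfloor>real q powr (1 + \<mu>) / 100\<rfloor> \<Longrightarrow> \<theta> = (1 / (1 + S)) ^ w * real (4 * w + 10) \<Longrightarrow>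
    \<theta> < S \<and> 4 * \<theta> + 2 * (2 * ((1 / (1 + S)) ^ w * (2 + 1 / S))) + 3 * (\<eta> / 100) +
      2 * real (2 * w + 1) * (\<eta> * (1 - S / 20000) ^ (q ^ (lam + 2))) < \<eta> / 2"
    using parameters_exist[OF assms(1) lam e1(1,2) e2(1,2), of b] by (auto simp: b_def)
  \<comment> \<open>Infinitely many good denominators provide one beyond any threshold; q at least
    100 also ensures T = 4w + 10 is at most half of q^(1+\<mu>).\<close>
  obtain q :: nat where q: "q \<ge> max Q 100" and "q > 0 \<and> (\<exists>p::int. \<bar>real q * \<omega> - real_of_int p\<bar> < real q powr (-1 - \<mu>))"
    using assms(3) unfolding well_approximable_def infinite_nat_iff_unbounded_le by blast
  then obtain p :: int where p: "\<bar>real q * \<omega> - real_of_int p\<bar> < real q powr (-1 - \<mu>)" by blast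
  have q1: "real q \<ge> 100" "q \<ge> Q" using q by auto
  define s where "s = sqrt (e1 / real q ^ lam)"
  have s2: "s\<^sup>2 = e1 / real q ^ lam" using e1 by (simp add: s_def)
  have ql: "real q ^ lam \<ge> 1" using q1 by simp
  have s2e: "s\<^sup>2 \<le> e1" using e1 ql unfolding s2 by (simp add: divide_le_eq)
  have s0: "s > 0" using e1 q1 by (simp add: s_def)
  have s1: "s \<le> 1/100"
    by (rule power2_le_imp_le) (use s2e e1 in \<open>auto simp: power_divide\<close>)
  define \<eta> where "\<eta> = e2 / real q ^ b"
  define w where "w = nat \<lfloor>real q powr (1 + \<mu>) / 100\<rfloor>"
  define \<theta> where "\<theta> = (1 / (1 + s\<^sup>2)) ^ w * real (4 * w + 10)"
  define m where "m = q ^ (lam + 2)"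
  define T where "T = 4 * w + 10"
  interpret b: barrier "pendulum s" s by (rule barrier_pendulum[OF s0 s1])
  note par = Q[OF q1(2) s2 \<eta>_def w_def \<theta>_def]
  have \<eta>: "0 < \<eta>" "\<eta> \<le> s\<^sup>2"
  proof -
    show "0 < \<eta>" using e2 q1 by (simp add: \<eta>_def)
    show "\<eta> \<le> s\<^sup>2" unfolding \<eta>_def s2
      using e1 e2 q1 by (intro frac_le power_increasing) (auto simp: b_def)
  qed
  have e: "(s/100)\<^sup>2 / 2 = s\<^sup>2 / 20000" by (simp add: power_divide)
  have "4 * \<theta> + 2 * b.short_err w + 3 * (\<eta> / 100) + 2 * real (2 * w + 1) * (\<eta> * (1 - (s/100)\<^sup>2 / 2) ^ m) < \<eta> / 2"
    unfolding e b.short_err_def m_def by (rule conjunct2[OF par])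
  then obtain d where bumped: "bumped (pendulum s) s (\<lambda>x. pendulum s x + \<eta> * bump d m x) d \<eta>
      ((1 - (s/100)\<^sup>2 / 2) ^ m) (\<eta> / 100) \<theta> w (2 * w + 1)"
    using bumped_pendulum[OF s0 s1 \<eta>, of "\<eta> / 100" \<theta> w m] \<eta> par by auto
  define P where "P x = pendulum s x + \<eta> * bump d m x" for x
  interpret bumped "pendulum s" s P d \<eta> "(1 - (s/100)\<^sup>2 / 2) ^ m" "\<eta> / 100" \<theta> w "2 * w + 1"
    unfolding P_def by (rule bumped)
  have tV: "trig_sum 1 (2 * s\<^sup>2) (pendulum s)" by (rule trig_sum_pendulum)
  have tB: "trig_sum (Suc m) (\<bar>\<eta>\<bar> * 1) (\<lambda>x. \<eta> * bump d m x)" by (rule trig_sum_scale[OF trig_sum_bump])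
  have tP: "trig_sum (Suc m) (2 * s\<^sup>2 + \<bar>\<eta>\<bar> * 1) P"
    unfolding P_def by (rule trig_sum_plus[OF trig_sum_mono[OF tV] tB]) auto
  have P': "(P has_field_derivative deriv P x) (at x)" for x by (rule trig_sum_deriv(1)[OF tP])
  have contP': "continuous_on UNIV (deriv P)"
    using trig_sum_deriv(1)[OF trig_sum_deriv(2)[OF tP]]
    by (meson DERIV_isCont continuous_at_imp_continuous_on)
  define R where "R x = P (real q * x) / (real q)\<^sup>2" for x
  have "\<not> has_invariant_circle_freq (gen_map (\<lambda>x x'. (x - x')\<^sup>2 / 2 + R x')) \<omega>"
    unfolding R_def
  proof (rule no_invariant_circle[where P' = "deriv P" and T = T and p = p, OF _ P' contP' P_per])
    show "q > 0" using q1 by simp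
    show "real q * \<omega> - real_of_int p \<noteq> 0"
    proof
      assume "real q * \<omega> - real_of_int p = 0"
      then have "\<omega> = of_int p / of_nat q" using q1 by (simp add: field_simps)
      then have "\<omega> \<in> \<rat>" by simp
      then show False using assms(2) by simp
    qed
    show "real T * \<bar>real q * \<omega> - real_of_int p\<bar> \<le> 1/2"
    proof -
      have X: "real q powr (1 + \<mu>) \<ge> real q powr 1" using q1 assms(1) by (intro powr_mono) auto
      have "real w \<le> real q powr (1 + \<mu>) / 100" using X q1 unfolding w_def by simp linarith
      then have "real T \<le> real q powr (1 + \<mu>) / 2" using X q1 by (simp add: T_def)
      then have "real T * \<bar>real q * \<omega> - real_of_int p\<bar> \<le> real q powr (1 + \<mu>) / 2 * real q powr (-1 - \<mu>)"
        using p by (intro mult_mono) auto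
      also have "\<dots> = 1/2" using q1 by (simp add: powr_add[symmetric])
      finally show ?thesis .
    qed
    show "\<exists>x. x 0 = 0 \<and> x L \<le> 1 \<and> x (L + K * T) = real K \<and>
      (\<forall>n. 0 < n \<longrightarrow> n < L + K * T \<longrightarrow> x (n + 1) - 2 * x n + x (n - 1) = deriv P (x n))"
      if "T \<le> L" "0 < K" for L K
      by (rule kink_orbit[OF P']) (use that in \<open>auto simp: T_def \<theta>_def\<close>)
  qed
  moreover define R1 where "R1 x = 1 / (real q)\<^sup>2 * pendulum s (real q * x)" for x
  define R2 where "R2 x = 1 / (real q)\<^sup>2 * (\<eta> * bump d m (real q * x))" for x
  have R12: "R = (\<lambda>x. R1 x + R2 x)" by (simp add: R_def R1_def R2_def P_def fun_eq_iff add_divide_distrib)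
  have t1: "trig_sum (q * 1) (\<bar>1 / (real q)\<^sup>2\<bar> * (2 * s\<^sup>2)) R1"
    unfolding R1_def by (rule trig_sum_scale[OF trig_sum_dilate[OF tV]])
  have t2: "trig_sum (q * Suc m) (\<bar>1 / (real q)\<^sup>2\<bar> * (\<bar>\<eta>\<bar> * 1)) R2"
    unfolding R2_def by (rule trig_sum_scale[OF trig_sum_dilate[OF tB]])
  have "trig_poly (q * Suc m) R"
    unfolding R12 by (rule trig_poly_if_trig_sum, rule trig_sum_plus[OF trig_sum_mono[OF t1] t2]) auto
  moreover have "cr_norm r R \<le> \<epsilon> / 2"
  proof (rule cr_norm_le)
    fix j x assume "j \<le> nat \<lfloor>r\<rfloor>"
    then have j: "j \<le> J" by (simp add: J_def)
    have "\<bar>(deriv ^^ j) R1 x\<bar> \<le> (2 * pi * real (q * 1)) ^ j * (\<bar>1 / (real q)\<^sup>2\<bar> * (2 * s\<^sup>2))"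
      by (rule trig_sum_bound[OF trig_sum_higher_deriv[OF t1]])
    also have "\<dots> \<le> (2 * pi * real q) ^ J * (1 / (real q)\<^sup>2 * (2 * s\<^sup>2))"
    proof -
      have "1 * 1 \<le> 2 * pi * real q" using q1 pi_gt3 by (intro mult_mono) auto
      then have "(2 * pi * real q) ^ j \<le> (2 * pi * real q) ^ J" using j by (intro power_increasing) auto
      then show ?thesis by (simp add: mult_right_mono divide_right_mono)
    qed
    also have "\<dots> = 2 * e1 * (2 * pi) ^ J"
    proof -
      have "(2 * pi * real q) ^ J = (2 * pi) ^ J * (real q ^ lam * (real q)\<^sup>2)"
        by (simp add: power_mult_distrib J2 power_add power2_eq_square)
      then show ?thesis unfolding s2 using q1 by simp
    qed
    also have "\<dots> \<le> \<epsilon> / 4" using e1(3) by (simp add: field_simps)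
    finally have D1: "\<bar>(deriv ^^ j) R1 x\<bar> \<le> \<epsilon> / 4" .
    have "\<bar>(deriv ^^ j) R2 x\<bar> \<le> (2 * pi * real (q * Suc m)) ^ j * (\<bar>1 / (real q)\<^sup>2\<bar> * (\<bar>\<eta>\<bar> * 1))"
      by (rule trig_sum_bound[OF trig_sum_higher_deriv[OF t2]])
    also have "\<dots> \<le> (4 * pi * real q ^ (lam + 3)) ^ J * (1 * \<eta>)"
    proof -
      have m1: "real m \<ge> 1" using one_le_power[of "real q" "lam + 2"] q1 unfolding m_def of_nat_power by simp
      then have "real q * real (Suc m) \<le> real q * (2 * real m)" by (intro mult_left_mono) auto
      then have "2 * pi * (real q * real (Suc m)) \<le> 2 * pi * (real q * (2 * real m))"
        by (rule mult_left_mono) simp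
      moreover have "real q ^ (lam + 3) = real q * real m"
        by (simp add: m_def power_add numeral_3_eq_3)
      ultimately have le: "2 * pi * real (q * Suc m) \<le> 4 * pi * real q ^ (lam + 3)"
        by (simp only: of_nat_mult)
      have "real q * 1 \<le> real q * real (Suc m)" by (intro mult_left_mono) auto
      then have "1 \<le> real (q * Suc m)" using q1 unfolding of_nat_mult by linarith
      then have "1 * 1 \<le> 2 * pi * real (q * Suc m)" using pi_gt3 by (intro mult_mono) linarith+
      then have "(2 * pi * real (q * Suc m)) ^ j \<le> (2 * pi * real (q * Suc m)) ^ J"
        using j by (intro power_increasing) auto
      also have "\<dots> \<le> (4 * pi * real q ^ (lam + 3)) ^ J" using le by (intro power_mono) auto
      finally have pw: "(2 * pi * real (q * Suc m)) ^ j \<le> (4 * pi * real q ^ (lam + 3)) ^ J" .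
      have "1 / (real q)\<^sup>2 \<le> 1" using q1 by simp
      then have "\<bar>1 / (real q)\<^sup>2\<bar> * (\<bar>\<eta>\<bar> * 1) \<le> 1 * \<eta>" using \<eta> by (intro mult_mono) auto
      from mult_mono[OF pw this] show ?thesis by simp
    qed
    also have "\<dots> = (4 * pi) ^ J * e2 / real q ^ lam"
    proof -
      have "(4 * pi * real q ^ (lam + 3)) ^ J = (4 * pi) ^ J * real q ^ ((lam + 3) * J)"
        by (simp add: power_mult_distrib power_mult)
      then show ?thesis using q1 by (simp add: \<eta>_def b_def power_add)
    qed
    also have "\<dots> \<le> (4 * pi) ^ J * e2" using ql e2 by (simp add: divide_le_eq mult_ge1_I)
    also have "\<dots> \<le> \<epsilon> / 4" using e2(3) by (simp add: field_simps)
    finally have D2: "\<bar>(deriv ^^ j) R2 x\<bar> \<le> \<epsilon> / 4" .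
    show "\<bar>(deriv ^^ j) R x\<bar> \<le> \<epsilon> / 2"
      unfolding R12 higher_deriv_add_trig_sum[OF t1 t2] using D1 D2 by linarith
  qed
  ultimately show ?thesis using assms(6) by (intro exI[of _ "q * Suc m"] exI[of _ R]) auto
qed

end
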